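(* Let $0\le s<\frac12$. The static kink $Q(x,t;0,0)=4\arctan e^x$ of the sine-Gordon equation $\partial_{tt}f-\partial_{xx}f+\sin f=0$ is not asymptotically stable for perturbations in $H^{1,s}_{\sin}(\mathbb{R})\times L^{2,s}(\mathbb{R})$.
   Context: $\langle x\rangle=(1+x^2)^{1/2}$; $\|g\|_{L^{2,s}}=\|\langle x\rangle^sg\|_{L^2}$; the distance between $(g_1,g_2)$ and $(h_1,h_2)$ in $H^{1,s}_{\sin}\times L^{2,s}$ is $\big(\|\sin\frac{g_1-h_1}2\|_{L^{2,s}}^2+\|\partial_x(g_1-h_1)\|_{L^{2,s}}^2+\|g_2-h_2\|_{L^{2,s}}^2\big)^{1/2}$. Kinks: $Q(x,t;\beta,x_0)=4\arctan e^{\gamma(x-\beta t+x_0)}$, $\gamma=(1-\beta^2)^{-1/2}$. Failure of asymptotic stability means that arbitrarily small perturbations can produce new non-decaying components besides a kink: for every $\varepsilon>0$ there are initial data within distance $\varepsilon$ of $(Q(\cdot,0;0,0),0)$ in $H^{1,s}_{\sin}\times L^{2,s}$ whose solution $f$ cannot be written as $f=Q(x,t;v_k,x_k(t))+f_r$, with a velocity $v_k\in(-1,1)$ and a trajectory $x_k(t)$, such that $\lim_{t\to\infty}\int_{|x-\mathfrak vt|<\mathfrak L}(|f_r|^2+|\partial_xf_r|^2+|\partial_tf_r|^2)\,dx=0$ for all fixed $\mathfrak v\in\mathbb{R}$ and $\mathfrak L>0$. *)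

theory Defs
  imports "HOL-Analysis.Analysis"
begin

text \<open>Functions of space and time are curried with time first, so that \<open>f t\<close> is the spatial profile
  at time \<open>t\<close>. Elements of Lebesgue spaces are Borel representatives \<open>real \<Rightarrow> real\<close>.\<close>

definition locally_integrable :: "(real \<Rightarrow> real) \<Rightarrow> bool" where
  "locally_integrable g \<longleftrightarrow> (\<forall>a b. set_integrable lborel {a..b} g)"

definition test_function :: "(real \<Rightarrow> real) \<Rightarrow> bool" where
  "test_function \<phi> \<longleftrightarrow>
     (\<forall>n x. ((deriv ^^ n) \<phi>) field_differentiable (at x)) \<and>
     (\<exists>R. \<forall>x. \<bar>x\<bar> > R \<longrightarrow> \<phi> x = 0)"

definition has_weak_deriv :: "(real \<Rightarrow> real) \<Rightarrow> (real \<Rightarrow> real) \<Rightarrow> bool" where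
  "has_weak_deriv g g' \<longleftrightarrow>
     locally_integrable g \<and> locally_integrable g' \<and>
     (\<forall>\<phi>. test_function \<phi> \<longrightarrow>
        (LINT x|lborel. g x * deriv \<phi> x) = - (LINT x|lborel. g' x * \<phi> x))"

text \<open>The weak derivative is unique up to null sets, and it is only used under integrals.\<close>

definition weak_deriv :: "(real \<Rightarrow> real) \<Rightarrow> real \<Rightarrow> real" where
  "weak_deriv g = (SOME g'. has_weak_deriv g g')"

definition jbracket :: "real \<Rightarrow> real" where
  "jbracket x = sqrt (1 + x\<^sup>2)"

definition L2w :: "real \<Rightarrow> (real \<Rightarrow> real) set" where
  "L2w s = {g \<in> borel_measurable lborel. integrable lborel (\<lambda>x. (jbracket x powr s * g x)\<^sup>2)}"

definition L2w_norm :: "real \<Rightarrow> (real \<Rightarrow> real) \<Rightarrow> real" where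
  "L2w_norm s g = sqrt (LINT x|lborel. (jbracket x powr s * g x)\<^sup>2)"

definition H1sin :: "real \<Rightarrow> (real \<Rightarrow> real) set" where
  "H1sin s = {g. (\<exists>g'. has_weak_deriv g g') \<and>
                 (\<lambda>x. sin (g x / 2)) \<in> L2w s \<and> weak_deriv g \<in> L2w s}"

definition sin_dist ::
  "real \<Rightarrow> (real \<Rightarrow> real) \<times> (real \<Rightarrow> real) \<Rightarrow> (real \<Rightarrow> real) \<times> (real \<Rightarrow> real) \<Rightarrow> real" where
  "sin_dist s g h =
     sqrt ((L2w_norm s (\<lambda>x. sin ((fst g x - fst h x) / 2)))\<^sup>2
         + (L2w_norm s (weak_deriv (\<lambda>x. fst g x - fst h x)))\<^sup>2
         + (L2w_norm s (\<lambda>x. snd g x - snd h x))\<^sup>2)"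

definition kink :: "real \<Rightarrow> real \<Rightarrow> real \<Rightarrow> real \<Rightarrow> real" where
  "kink \<beta> x0 t x = 4 * arctan (exp ((x - \<beta> * t + x0) / sqrt (1 - \<beta>\<^sup>2)))"

text \<open>Energy-class solutions on \<open>t \<ge> 0\<close>: \<open>(f, ft)\<close> is a continuous curve in the unweighted space,
  \<open>ft\<close> is the time derivative of \<open>f\<close>, and the equation \<open>f_tt - f_xx + sin f = 0\<close> holds in the
  sense of distributions. As the curve is continuous in time, testing in \<open>x\<close> alone, at every time,
  is equivalent to testing in space-time. The distance does not see a shift of \<open>f\<close> by a multiple
  of \<open>2 * pi\<close>; jumps by such shifts are excluded by the first of the two tested equations.\<close>

definition sine_gordon_solution ::
  "(real \<Rightarrow> real) \<Rightarrow> (real \<Rightarrow> real) \<Rightarrow> (real \<Rightarrow> real \<Rightarrow> real) \<Rightarrow> (real \<Rightarrow> real \<Rightarrow> real) \<Rightarrow> bool" where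
  "sine_gordon_solution g1 g2 f ft \<longleftrightarrow>
     (AE x in lborel. f 0 x = g1 x) \<and> (AE x in lborel. ft 0 x = g2 x) \<and>
     (\<forall>t\<ge>0. f t \<in> H1sin 0 \<and> ft t \<in> L2w 0) \<and>
     (\<forall>t\<ge>0. ((\<lambda>\<tau>. sin_dist 0 (f \<tau>, ft \<tau>) (f t, ft t)) \<longlongrightarrow> 0) (at t within {0..})) \<and>
     (\<forall>\<phi>. test_function \<phi> \<longrightarrow> (\<forall>t\<ge>0.
        ((\<lambda>\<tau>. LINT x|lborel. f \<tau> x * \<phi> x) has_real_derivative
           (LINT x|lborel. ft t x * \<phi> x)) (at t within {0..}) \<and>
        ((\<lambda>\<tau>. LINT x|lborel. ft \<tau> x * \<phi> x) has_real_derivative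
           (LINT x|lborel. f t x * deriv (deriv \<phi>) x - sin (f t x) * \<phi> x)) (at t within {0..})))"

text \<open>The decomposition \<open>f = Q(x,t;v,xk(t)) + fr\<close> with locally vanishing remainder in every
  frame. The trajectory is differentiable so that the time derivative of the remainder makes sense.
  The equation and the distance \<open>sin_dist\<close> are invariant under \<open>f \<mapsto> f + 2 * pi\<close>, so profiles
  are identified modulo \<open>2 * pi\<close>; hence the integer \<open>k\<close>. Without it, the data \<open>Q + 2 * pi\<close>,
  at distance zero from the kink \<open>Q\<close>, would already fail to decompose.\<close>

definition decomposes_into_kink ::
  "(real \<Rightarrow> real \<Rightarrow> real) \<Rightarrow> (real \<Rightarrow> real \<Rightarrow> real) \<Rightarrow> bool" where
  "decomposes_into_kink f ft \<longleftrightarrow>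
     (\<exists>v xk. \<exists>k::int. -1 < v \<and> v < 1 \<and> (\<forall>t>0. xk differentiable (at t)) \<and>
        (\<forall>V. \<forall>L>0.
           ((\<lambda>t. LINT x:{x. \<bar>x - V * t\<bar> < L}|lborel.
                (f t x - (kink v (xk t) t x + 2 * pi * of_int k))\<^sup>2
              + (weak_deriv (\<lambda>y. f t y - (kink v (xk t) t y + 2 * pi * of_int k)) x)\<^sup>2
              + (ft t x - deriv (\<lambda>\<tau>. kink v (xk \<tau>) \<tau> x) t)\<^sup>2) \<longlongrightarrow> 0) at_top))"

end

(*
  The counterexample is the kink with a breather of small parameter b sitting on it. The
  breather has amplitude of order b and width of order 1 / b, so its size in the weighted space is of
  order b^(1/2 - s), which tends to 0 with b because s < 1/2. The solution is periodic in time, and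
  once per period the velocity of the breather is an odd function of x with a strict sign on each
  half line. The time derivative of a kink with an arbitrary trajectory has one sign on the whole
  line, so the remainder stays away from zero near the origin on at least one side.

  As this has to hold for every energy-class solution with these data, uniqueness is needed. It is
  proved by duality: the difference of two solutions is tested against solutions of the backward wave
  equation given by d'Alembert's formula. This bounds the difference pointwise by a time integral
  of itself, and the iteration starts from the trivial bound |sin a - sin b| <= 2.
*)

theory Submission
  imports Defs "HOL-Probability.Sinc_Integral"
begin

section \<open>Test functions\<close>

text \<open>A solution is tested only against functions that do not depend on time, while duality
  needs test functions that travel with the backward wave. Bridging this gap is the technical core
  of uniqueness: a product rule for pairings in which both factors move. It asks for continuity of
  the curve that is uniform over bounded test functions of fixed support. For positions this cannot
  be read off from the distance, which sees \<open>f\<close> only modulo 2 * pi; it is derived from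
  a bound on the velocity. The d'Alembert kernel in one dimension is nonnegative, so an a.e. bound
  on the nonlinearity passes to the solution without any energy estimate. Neither decay nor
  boundedness of the difference of two solutions is known beforehand; boundedness of sin takes their
  place. The trajectory in the decomposition has no bound on its derivative. Hence nothing but the
  sign of the kink's time derivative can be exploited, and this sign may change from one period to
  the next; a velocity profile with opposite signs on the two half lines copes with both signs. The
  frame at rest is enough for the contradiction.\<close>

definition differentiable_upto :: "nat \<Rightarrow> (real \<Rightarrow> real) \<Rightarrow> bool" where
  "differentiable_upto n f \<longleftrightarrow> (\<forall>m\<le>n. \<forall>x. ((deriv ^^ m) f) field_differentiable (at x))"

lemma differentiable_upto_0:
  "differentiable_upto 0 f \<longleftrightarrow> (\<forall>x. f field_differentiable (at x))"
  by (simp add: differentiable_upto_def)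

lemma differentiable_upto_Suc:
  "differentiable_upto (Suc n) f \<longleftrightarrow>
     (\<forall>x. f field_differentiable (at x)) \<and> differentiable_upto n (deriv f)"
proof -
  have "(\<forall>m\<le>Suc n. P m) \<longleftrightarrow> P 0 \<and> (\<forall>m\<le>n. P (Suc m))" for P
    by (metis Suc_le_mono le0 not0_implies_Suc)
  then show ?thesis
    unfolding differentiable_upto_def
    by (simp add: funpow_Suc_right del: funpow.simps(2))
qed

lemma differentiable_upto_SucD: "differentiable_upto (Suc n) f \<Longrightarrow> differentiable_upto n f"
  by (simp add: differentiable_upto_def)

lemma differentiable_uptoD0: "differentiable_upto n f \<Longrightarrow> f field_differentiable (at x)"
  by (auto simp: differentiable_upto_def)

lemma differentiable_upto_SucI:
  assumes "\<And>x. (f has_real_derivative f' x) (at x)" "differentiable_upto n f'"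
  shows "differentiable_upto (Suc n) f"
proof -
  have "deriv f = f'"
    using assms(1) DERIV_imp_deriv by blast
  then show ?thesis
    using assms by (auto simp: differentiable_upto_Suc field_differentiable_def)
qed

lemma differentiable_upto_deriv:
  assumes "differentiable_upto n f"
  shows "(f has_real_derivative deriv f x) (at x)"
  using assms differentiable_uptoD0 field_differentiable_derivI by blast

lemma differentiable_upto_const: "differentiable_upto n (\<lambda>x. c)"
  by (induction n arbitrary: c)
     (auto simp: differentiable_upto_0 intro: differentiable_upto_SucI[where f'="\<lambda>_. 0"])

lemma differentiable_upto_add:
  "differentiable_upto n f \<Longrightarrow> differentiable_upto n g \<Longrightarrow> differentiable_upto n (\<lambda>x. f x + g x)"
proof (induction n arbitrary: f g)
  case 0
  then show ?case
    by (auto simp: differentiable_upto_0 intro: field_differentiable_add)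
next
  case (Suc n)
  show ?case
    by (rule differentiable_upto_SucI[where f'="\<lambda>x. deriv f x + deriv g x"])
       (use Suc in \<open>auto simp: differentiable_upto_Suc intro!: DERIV_add field_differentiable_derivI\<close>)
qed

lemma differentiable_upto_mult:
  "differentiable_upto n f \<Longrightarrow> differentiable_upto n g \<Longrightarrow> differentiable_upto n (\<lambda>x. f x * g x)"
proof (induction n arbitrary: f g)
  case 0
  then show ?case
    by (auto simp: differentiable_upto_0 intro: field_differentiable_mult)
next
  case (Suc n)
  show ?case
  proof (rule differentiable_upto_SucI)
    show "((\<lambda>x. f x * g x) has_real_derivative deriv f x * g x + deriv g x * f x) (at x)" for x
      using Suc.prems by (intro DERIV_mult differentiable_upto_deriv)
    show "differentiable_upto n (\<lambda>x. deriv f x * g x + deriv g x * f x)"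
      using Suc.prems
      by (intro differentiable_upto_add Suc.IH)
         (auto simp: differentiable_upto_Suc intro: differentiable_upto_SucD[unfolded differentiable_upto_Suc])
  qed
qed

lemma differentiable_upto_affine:
  "differentiable_upto n f \<Longrightarrow> differentiable_upto n (\<lambda>x. f (a * x + b))"
proof (induction n arbitrary: f)
  case 0
  have "((\<lambda>x. f (a * x + b)) has_real_derivative deriv f (a * x + b) * a) (at x)" for x
    by (rule DERIV_chain2[OF differentiable_upto_deriv[OF 0]]) (auto intro!: derivative_eq_intros)
  then show ?case
    by (auto simp: differentiable_upto_0 field_differentiable_def)
next
  case (Suc n)
  show ?case
  proof (rule differentiable_upto_SucI)
    show "((\<lambda>x. f (a * x + b)) has_real_derivative deriv f (a * x + b) * a) (at x)" for x
      by (rule DERIV_chain2[OF differentiable_upto_deriv[OF Suc.prems]])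
         (auto intro!: derivative_eq_intros)
    show "differentiable_upto n (\<lambda>x. deriv f (a * x + b) * a)"
      using Suc by (intro differentiable_upto_mult differentiable_upto_const)
        (auto simp: differentiable_upto_Suc)
  qed
qed

text \<open>Closure under sums, products and affine substitutions is proved at each finite order by
  induction, because \<open>deriv\<close> of such an expression is again built from these operations
  at one order less. Order 0 of \<open>differentiable_upto\<close> already means one derivative;
  quantified over all orders this shift disappears.\<close>

definition smooth :: "(real \<Rightarrow> real) \<Rightarrow> bool" where
  "smooth f \<longleftrightarrow> (\<forall>n. differentiable_upto n f)"

lemma smooth_iff: "smooth f \<longleftrightarrow> (\<forall>n x. ((deriv ^^ n) f) field_differentiable (at x))"
  by (auto simp: smooth_def differentiable_upto_def)

lemma test_function_iff: "test_function \<phi> \<longleftrightarrow> smooth \<phi> \<and> (\<exists>R. \<forall>x. \<bar>x\<bar> > R \<longrightarrow> \<phi> x = 0)"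
  by (simp add: test_function_def smooth_iff)

lemma smooth_const [intro]: "smooth (\<lambda>x. c)"
  by (simp add: smooth_def differentiable_upto_const)

lemma smooth_add [intro]: "smooth f \<Longrightarrow> smooth g \<Longrightarrow> smooth (\<lambda>x. f x + g x)"
  by (simp add: smooth_def differentiable_upto_add)

lemma smooth_mult [intro]: "smooth f \<Longrightarrow> smooth g \<Longrightarrow> smooth (\<lambda>x. f x * g x)"
  by (simp add: smooth_def differentiable_upto_mult)

lemma smooth_diff [intro]: "smooth f \<Longrightarrow> smooth g \<Longrightarrow> smooth (\<lambda>x. f x - g x)"
  using smooth_add[of f "\<lambda>x. (-1) * g x"] smooth_mult[of "\<lambda>_. -1" g] by auto

lemma smooth_affine: "smooth f \<Longrightarrow> smooth (\<lambda>x. f (a * x + b))"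
  by (simp add: smooth_def differentiable_upto_affine)

lemma smooth_shift: "smooth f \<Longrightarrow> smooth (\<lambda>x. f (x + b))"
  using smooth_affine[of f 1 b] by simp

lemma smooth_deriv: "smooth f \<Longrightarrow> smooth (deriv f)"
  unfolding smooth_def using differentiable_upto_Suc by blast

lemma smooth_has_deriv: "smooth f \<Longrightarrow> (f has_real_derivative deriv f x) (at x)"
  unfolding smooth_def using differentiable_upto_deriv by blast

lemma smooth_antideriv:
  assumes "\<And>x. (f has_real_derivative f' x) (at x)" "smooth f'"
  shows "smooth f"
  unfolding smooth_def
proof
  fix n show "differentiable_upto n f"
    using assms differentiable_upto_SucI differentiable_upto_SucD unfolding smooth_def by blast
qed

lemma smooth_power: "smooth f \<Longrightarrow> smooth (\<lambda>x. f x ^ n)"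
  by (induction n) auto

lemma smooth_prod: "(\<And>i. i \<in> I \<Longrightarrow> smooth (f i)) \<Longrightarrow> smooth (\<lambda>x. \<Prod>i\<in>I. f i x)"
  by (induction I rule: infinite_finite_induct) auto

lemma smooth_continuous: "smooth f \<Longrightarrow> continuous_on S f"
  by (meson DERIV_continuous_on smooth_has_deriv has_field_derivative_at_within)

section \<open>Smooth functions of compact support\<close>

definition flat :: "nat \<Rightarrow> real \<Rightarrow> real" where
  "flat k x = (if x > 0 then inverse x ^ k * exp (- inverse x) else 0)"

text \<open>\<open>flat 0\<close> is the classical exp (- 1 / x) extended by 0. The powers of
  \<open>inverse x\<close> are carried along so that the family is closed under differentiation up
  to linear combinations; smoothness is then an induction over all \<open>k\<close> at once. Only
  the origin needs a limit: from the right the difference quotient is y^(k+1) * exp (- y) with y = 1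
  / x.\<close>

lemma flat_has_deriv:
  "(flat k has_real_derivative flat (k + 2) x - real k * flat (k + 1) x) (at x)"
proof -
  consider "x > 0" | "x < 0" | "x = 0" by linarith
  then show ?thesis
  proof cases
    case 1
    define y where "y = inverse x"
    have "((\<lambda>y. y ^ k * exp (- y)) has_real_derivative
        real k * y ^ (k - 1) * exp (- y) - y ^ k * exp (- y)) (at y)"
      by (auto intro!: derivative_eq_intros)
    moreover have "(inverse has_real_derivative - (y * y)) (at x)"
      using DERIV_inverse[of x] 1 by (simp add: y_def power2_eq_square)
    ultimately have "((\<lambda>x. inverse x ^ k * exp (- inverse x)) has_real_derivative
        (real k * y ^ (k - 1) * exp (- y) - y ^ k * exp (- y)) * - (y * y)) (at x)"
      unfolding y_def by (rule DERIV_chain2)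
    also have "(real k * y ^ (k - 1) * exp (- y) - y ^ k * exp (- y)) * - (y * y) =
        flat (k + 2) x - real k * flat (k + 1) x"
      using 1 by (cases k) (simp_all add: flat_def y_def[symmetric] algebra_simps)
    finally have "((\<lambda>x. inverse x ^ k * exp (- inverse x)) has_real_derivative
        flat (k + 2) x - real k * flat (k + 1) x) (at x)" .
    moreover have "eventually (\<lambda>y. flat k y = inverse y ^ k * exp (- inverse y)) (nhds x)"
      using eventually_nhds_in_open[of "{0<..}" x] 1
      by (auto simp: flat_def elim!: eventually_mono)
    ultimately show ?thesis
      by (subst DERIV_cong_ev[OF refl _ refl]) assumption+
  next
    case 2
    have "((\<lambda>x. 0) has_real_derivative flat (k + 2) x - real k * flat (k + 1) x) (at x)"
      using 2 by (auto simp: flat_def)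
    moreover have "eventually (\<lambda>y. flat k y = 0) (nhds x)"
      using eventually_nhds_in_open[of "{..<0}" x] 2
      by (auto simp: flat_def elim!: eventually_mono)
    ultimately show ?thesis
      by (subst DERIV_cong_ev[OF refl _ refl]) assumption+
  next
    case 3
    have "((\<lambda>h::real. inverse h ^ k * exp (- inverse h) / h) \<longlongrightarrow> 0) (at_right 0)"
    proof -
      have "((\<lambda>y::real. y ^ Suc k * exp (- y)) \<longlongrightarrow> 0) at_top"
        using tendsto_power_div_exp_0[of "Suc k"] by (simp add: exp_minus divide_inverse)
      from filterlim_compose[OF this filterlim_inverse_at_top_right]
      have "((\<lambda>h::real. inverse h ^ Suc k * exp (- inverse h)) \<longlongrightarrow> 0) (at_right 0)" .
      moreover have "inverse h ^ Suc k * exp (- inverse h) = inverse h ^ k * exp (- inverse h) / h" for h :: real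
        by (simp add: divide_inverse)
      ultimately show ?thesis by (simp only:)
    qed
    then have "((\<lambda>h. flat k h / h) \<longlongrightarrow> 0) (at_right 0)"
      by (rule Lim_transform_eventually) (auto simp: flat_def eventually_at_filter)
    moreover have "((\<lambda>h. flat k h / h) \<longlongrightarrow> 0) (at_left 0)"
      by (rule Lim_transform_eventually[OF tendsto_const])
         (auto simp: flat_def eventually_at_filter)
    ultimately have "((\<lambda>h. flat k h / h) \<longlongrightarrow> 0) (at 0)"
      by (simp add: filterlim_at_split)
    then show ?thesis
      using 3 by (simp add: has_field_derivative_iff flat_def)
  qed
qed

lemma smooth_flat: "smooth (flat k)"
proof -
  have "differentiable_upto n (flat k)" for n
  proof (induction n arbitrary: k)
    case 0
    show ?case
      using flat_has_deriv by (auto simp: differentiable_upto_0 field_differentiable_def)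
  next
    case (Suc n)
    have "differentiable_upto n (\<lambda>x. flat (k + 2) x + (- real k) * flat (k + 1) x)"
      by (intro differentiable_upto_add differentiable_upto_mult differentiable_upto_const Suc)
    then show ?case
      using flat_has_deriv[of k] by (intro differentiable_upto_SucI[OF flat_has_deriv]) simp
  qed
  then show ?thesis by (simp add: smooth_def)
qed

lemma bump_exists:
  fixes a b :: real
  obtains \<beta> where "smooth \<beta>" "\<And>x. 0 \<le> \<beta> x" "\<And>x. \<beta> x \<le> 1" "\<And>x. \<beta> x > 0 \<longleftrightarrow> a < x \<and> x < b"
proof -
  define \<beta> where "\<beta> x = flat 0 (x - a) * flat 0 (b - x)" for x
  have f: "0 \<le> flat 0 x" "flat 0 x \<le> 1" "flat 0 x > 0 \<longleftrightarrow> x > 0" for x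
    by (auto simp: flat_def)
  have "smooth \<beta>"
    using smooth_affine[OF smooth_flat, of 0 1 "-a"] smooth_affine[OF smooth_flat, of 0 "-1" b]
    unfolding \<beta>_def by (auto simp: algebra_simps)
  moreover have "0 \<le> \<beta> x" "\<beta> x \<le> 1" for x
    unfolding \<beta>_def using f by (auto intro: mult_le_one)
  moreover have "\<beta> x > 0 \<longleftrightarrow> a < x \<and> x < b" for x
    unfolding \<beta>_def using f(1,3)[of "x-a"] f(1,3)[of "b-x"]
    by (smt (verit) mult_pos_pos zero_less_mult_iff)
  ultimately show thesis using that by blast
qed

text \<open>A function is the pointwise limit of its truncations to growing intervals. For the
  position of a solution this is the source of measurability: \<open>H1sin\<close> speaks of sin (g
  / 2) and of the weak derivative only, and the latter includes local integrability of
  \<open>g\<close>.\<close>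

lemma locally_integrable_measurable:
  assumes "locally_integrable g"
  shows "g \<in> borel_measurable borel"
proof (rule borel_measurable_LIMSEQ_real)
  fix x :: real
  have "eventually (\<lambda>n. indicator {- real n..real n} x * g x = g x) sequentially"
    using eventually_ge_at_top[of "nat \<lceil>\<bar>x\<bar>\<rceil>"]
    by eventually_elim (auto simp: indicator_def nat_le_iff ceiling_le_iff)
  then show "(\<lambda>n. indicator {- real n..real n} x * g x) \<longlonglongrightarrow> g x"
    by (rule tendsto_eventually)
next
  show "(\<lambda>x. indicator {- real n..real n} x * g x) \<in> borel_measurable borel" for n
    using assms borel_measurable_integrable[of lborel]
    unfolding locally_integrable_def set_integrable_def by fastforce
qed

lemma integrable_mult_compact_support:
  fixes g \<psi> :: "real \<Rightarrow> real"
  assumes g: "locally_integrable g" and \<psi>: "continuous_on UNIV \<psi>" "\<And>x. \<bar>x\<bar> > R \<Longrightarrow> \<psi> x = 0"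
  shows "integrable lborel (\<lambda>x. g x * \<psi> x)"
proof -
  have "compact (\<psi> ` {-R..R})"
    using \<psi>(1) by (intro compact_continuous_image) (auto intro: continuous_on_subset)
  then obtain C where "\<And>y. y \<in> \<psi> ` {-R..R} \<Longrightarrow> norm y \<le> C"
    using compact_imp_bounded bounded_iff by metis
  then have C: "\<bar>\<psi> x\<bar> \<le> C" if "\<bar>x\<bar> \<le> R" for x
    using that by (auto simp: abs_le_iff)
  show ?thesis
  proof (rule Bochner_Integration.integrable_bound)
    show "integrable lborel (\<lambda>x. C * (indicator {-R..R} x *\<^sub>R g x))"
      using g unfolding locally_integrable_def set_integrable_def by (intro integrable_mult_right) blast
    show "(\<lambda>x. g x * \<psi> x) \<in> borel_measurable lborel"
      using locally_integrable_measurable[OF g] borel_measurable_continuous_onI[OF \<psi>(1)] by simp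
    show "AE x in lborel. norm (g x * \<psi> x) \<le> norm (C * (indicator {-R..R} x *\<^sub>R g x))"
    proof (intro AE_I2)
      fix x
      show "norm (g x * \<psi> x) \<le> norm (C * (indicator {-R..R} x *\<^sub>R g x))"
      proof (cases "\<bar>x\<bar> \<le> R")
        case True
        then have "x \<in> {-R..R}" "\<bar>\<psi> x\<bar> \<le> \<bar>C\<bar>" using C[OF True] by auto
        then show ?thesis by (simp add: abs_mult mult.commute mult_right_mono)
      qed (use \<psi>(2) in auto)
    qed
  qed
qed

lemma test_function_smooth: "test_function \<phi> \<Longrightarrow> smooth \<phi>"
  by (simp add: test_function_iff)

lemma test_function_support:
  assumes "test_function \<phi>"
  obtains R where "0 < R" "\<And>x. \<bar>x\<bar> > R \<Longrightarrow> \<phi> x = 0"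
proof -
  obtain R where "\<forall>x. \<bar>x\<bar> > R \<longrightarrow> \<phi> x = 0"
    using assms by (auto simp: test_function_def)
  then show thesis by (intro that[of "max R 1"]) auto
qed

lemma test_functionI:
  "smooth \<phi> \<Longrightarrow> (\<And>x. \<bar>x\<bar> > R \<Longrightarrow> \<phi> x = 0) \<Longrightarrow> test_function \<phi>"
  by (auto simp: test_function_iff)

lemma test_function_continuous: "test_function \<phi> \<Longrightarrow> continuous_on S \<phi>"
  by (simp add: smooth_continuous test_function_smooth)

lemma test_function_has_deriv: "test_function \<phi> \<Longrightarrow> (\<phi> has_real_derivative deriv \<phi> x) (at x)"
  by (simp add: smooth_has_deriv test_function_smooth)

lemma deriv_eq_0_outside:
  fixes \<phi> :: "real \<Rightarrow> real"
  assumes "\<And>x. \<bar>x\<bar> > R \<Longrightarrow> \<phi> x = 0" "\<bar>x\<bar> > R"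
  shows "deriv \<phi> x = 0"
proof -
  have "open {x::real. \<bar>x\<bar> > R}"
    by (intro open_Collect_less continuous_intros)
  then have "eventually (\<lambda>y. \<phi> y = 0) (nhds x)"
    using assms unfolding eventually_nhds by (intro exI[of _ "{x. \<bar>x\<bar> > R}"]) auto
  then have "deriv \<phi> x = deriv (\<lambda>_. 0) x"
    by (intro deriv_cong_ev) auto
  then show ?thesis by simp
qed

lemma test_function_deriv:
  assumes "test_function \<phi>"
  shows "test_function (deriv \<phi>)"
proof -
  obtain R where "\<And>x. \<bar>x\<bar> > R \<Longrightarrow> \<phi> x = 0"
    using test_function_support[OF assms] by blast
  then show ?thesis
    using assms by (intro test_functionI[of _ R] smooth_deriv deriv_eq_0_outside) (auto simp: test_function_smooth)
qed

lemma test_function_cmult: "test_function \<phi> \<Longrightarrow> test_function (\<lambda>x. c * \<phi> x)"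
  by (auto simp: test_function_iff)

lemma test_function_add:
  assumes "test_function \<phi>" "test_function \<psi>"
  shows "test_function (\<lambda>x. \<phi> x + \<psi> x)"
proof -
  obtain R S where "\<And>x. \<bar>x\<bar> > R \<Longrightarrow> \<phi> x = 0" "\<And>x. \<bar>x\<bar> > S \<Longrightarrow> \<psi> x = 0"
    using assms by (metis test_function_support)
  then show ?thesis
    using assms by (intro test_functionI[of _ "max R S"]) (auto simp: test_function_smooth)
qed

lemma test_function_shift:
  assumes "test_function \<phi>"
  shows "test_function (\<lambda>x. \<phi> (x + b))"
proof -
  obtain R where "\<And>x. \<bar>x\<bar> > R \<Longrightarrow> \<phi> x = 0"
    using test_function_support[OF assms] by blast
  then show ?thesis
    using assms
    by (intro test_functionI[of _ "R + \<bar>b\<bar>"] smooth_shift) (auto simp: test_function_smooth abs_if split: if_splits)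
qed

lemma integrable_mult_test:
  assumes "locally_integrable g" "test_function \<phi>"
  shows "integrable lborel (\<lambda>x. g x * \<phi> x)"
  using assms by (metis integrable_mult_compact_support test_function_continuous test_function_support)

section \<open>The fundamental lemma of the calculus of variations, for inequalities\<close>

text \<open>Test functions approximate the indicator of a bounded open set, a countable union of
  intervals, by \<open>1 - (\<Prod>i<n. (1 - \<beta> i x) ^ n)\<close> with bumps \<open>\<beta> i\<close> on the intervals.\<close>

lemma set_integral_open_nonneg:
  assumes g: "locally_integrable g"
    and pos: "\<And>\<phi>. test_function \<phi> \<Longrightarrow> (\<And>x. 0 \<le> \<phi> x) \<Longrightarrow> 0 \<le> (LINT x|lborel. g x * \<phi> x)"
    and U: "open U" "U \<subseteq> {-R..R}"
  shows "0 \<le> (LINT x|lborel. indicator U x * g x)"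
proof (cases "U = {}")
  case False
  obtain \<D> where D: "countable \<D>" "\<And>X. X \<in> \<D> \<Longrightarrow> \<exists>a b. X = box a b" "\<Union>\<D> = U"
    using open_countable_Union_open_box[OF U(1)] by metis
  with False have "\<D> \<noteq> {}" by auto
  define I where "I = from_nat_into \<D>"
  have I_range: "range I = \<D>"
    unfolding I_def using \<open>\<D> \<noteq> {}\<close> D(1) by (rule range_from_nat_into)
  have "\<exists>a b. I i = {a<..<b}" for i
    using D(2)[of "I i"] I_range by auto
  then obtain a b where ab: "\<And>i. I i = {a i<..<b i}" by metis
  have "\<exists>\<beta>. smooth \<beta> \<and> (\<forall>x. 0 \<le> \<beta> x \<and> \<beta> x \<le> 1) \<and> (\<forall>x. \<beta> x > 0 \<longleftrightarrow> x \<in> I i)" for i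
    using bump_exists[of "a i" "b i"] ab[of i] by (metis greaterThanLessThan_iff)
  then obtain \<beta> where \<beta>: "\<And>i. smooth (\<beta> i)" "\<And>i x. 0 \<le> \<beta> i x" "\<And>i x. \<beta> i x \<le> 1"
    "\<And>i x. \<beta> i x > 0 \<longleftrightarrow> x \<in> I i" by metis
  define \<eta> where "\<eta> n x = 1 - (\<Prod>i<n. (1 - \<beta> i x) ^ n)" for n :: nat and x
  have prod01: "0 \<le> (\<Prod>i<n. (1 - \<beta> i x) ^ n) \<and> (\<Prod>i<n. (1 - \<beta> i x) ^ n) \<le> 1" for n x
    using \<beta>(2,3) by (auto intro!: prod_nonneg prod_le_1 power_le_one)
  have chi0: "\<eta> n x = 0" if "x \<notin> U" for n x
  proof -
    have "I i \<subseteq> U" for i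
      using D(3) I_range by blast
    then have "\<beta> i x = 0" for i
      using \<beta>(2)[of i x] \<beta>(4)[of i x] that by force
    then show ?thesis by (simp add: \<eta>_def)
  qed
  have test: "test_function (\<eta> n)" for n
  proof (rule test_functionI[of _ R])
    show "smooth (\<eta> n)"
      unfolding \<eta>_def using \<beta>(1) by (intro smooth_diff smooth_const smooth_prod smooth_power)
    show "\<eta> n x = 0" if "\<bar>x\<bar> > R" for x
    proof -
      have "x \<notin> {-R..R}" using that by auto
      then have "x \<notin> U" using U(2) by blast
      then show ?thesis by (rule chi0)
    qed
  qed
  have lim: "(\<lambda>n. \<eta> n x) \<longlonglongrightarrow> indicator U x" for x
  proof (cases "x \<in> U")
    case True
    then obtain i where "x \<in> I i" using D(3) I_range by auto
    then have i: "0 \<le> 1 - \<beta> i x" "1 - \<beta> i x < 1" using \<beta>(3,4)[of i x] by auto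
    \<comment> \<open>One bump that is positive at \<open>x\<close> suffices: its factor enters as
      soon as n > i, all other factors are at most 1, and the growing exponent makes up for a bump
      that is tiny at \<open>x\<close>.\<close>
    have "(\<lambda>n. \<Prod>i<n. (1 - \<beta> i x) ^ n) \<longlonglongrightarrow> 0"
    proof (rule tendsto_sandwich[OF _ _ tendsto_const LIMSEQ_power_zero[of "1 - \<beta> i x"]])
      show "\<forall>\<^sub>F n in sequentially. (\<Prod>j<n. (1 - \<beta> j x) ^ n) \<le> (1 - \<beta> i x) ^ n"
        using eventually_gt_at_top[of i]
      proof eventually_elim
        case (elim n)
        have "(\<Prod>j<n. (1 - \<beta> j x) ^ n) = (1 - \<beta> i x) ^ n * (\<Prod>j\<in>{..<n} - {i}. (1 - \<beta> j x) ^ n)"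
          using elim by (intro prod.remove) auto
        also have "\<dots> \<le> (1 - \<beta> i x) ^ n * 1"
          using \<beta>(2,3) by (intro mult_left_mono prod_le_1) (auto intro!: power_le_one)
        finally show ?case by simp
      qed
    qed (use i prod01 in auto)
    from tendsto_diff[OF tendsto_const[of 1] this] show ?thesis
      using True by (simp add: \<eta>_def)
  qed (simp add: chi0)
  have "(\<lambda>n. LINT x|lborel. g x * \<eta> n x) \<longlonglongrightarrow> (LINT x|lborel. g x * indicator U x)"
  proof (rule integral_dominated_convergence)
    show "integrable lborel (\<lambda>x. indicator {-R..R} x *\<^sub>R \<bar>g x\<bar>)"
      using g unfolding locally_integrable_def by (intro set_integrable_abs[unfolded set_integrable_def]) (auto simp: set_integrable_def)
    show "(\<lambda>x. g x * indicator U x) \<in> borel_measurable lborel"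
      using locally_integrable_measurable[OF g] U(1) by simp
    show "(\<lambda>x. g x * \<eta> n x) \<in> borel_measurable lborel" for n
      using integrable_mult_test[OF g test] by (rule borel_measurable_integrable)
    show "AE x in lborel. (\<lambda>n. g x * \<eta> n x) \<longlonglongrightarrow> g x * indicator U x"
      using lim by (intro AE_I2 tendsto_mult tendsto_const)
    show "AE x in lborel. norm (g x * \<eta> n x) \<le> indicator {-R..R} x *\<^sub>R \<bar>g x\<bar>" for n
    proof (intro AE_I2)
      fix x
      have "\<bar>\<eta> n x\<bar> \<le> 1" using prod01[of x n] by (simp add: \<eta>_def)
      then show "norm (g x * \<eta> n x) \<le> indicator {-R..R} x *\<^sub>R \<bar>g x\<bar>"
        using chi0[of x n] U(2) by (cases "x \<in> U") (auto simp: abs_mult mult_left_le)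
    qed
  qed
  moreover have "0 \<le> (LINT x|lborel. g x * \<eta> n x)" for n
    using prod01 by (intro pos test) (simp add: \<eta>_def)
  ultimately show ?thesis
    by (intro tendsto_lowerbound[of "\<lambda>n. LINT x|lborel. g x * \<eta> n x" _ sequentially]) (auto simp: mult.commute)
qed simp

text \<open>Outer regularity puts the negativity set inside a bounded interval into a countable
  intersection of open sets, up to a null set. Integrals of \<open>g\<close> over open sets are
  nonnegative, and this survives the limit; over the negativity set the integral is also at most 0,
  so the set is null. The one-sided form is needed because uniqueness rests on a.e. inequalities,
  not only on equalities.\<close>

lemma AE_nonneg_if_test_nonneg:
  assumes g: "locally_integrable g"
    and pos: "\<And>\<phi>. test_function \<phi> \<Longrightarrow> (\<And>x. 0 \<le> \<phi> x) \<Longrightarrow> 0 \<le> (LINT x|lborel. g x * \<phi> x)"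
  shows "AE x in lborel. 0 \<le> g x"
proof -
  have gm [measurable]: "g \<in> borel_measurable borel" by (rule locally_integrable_measurable[OF g])
  have "AE x in lborel. x \<in> {-R<..<R} \<longrightarrow> 0 \<le> g x" for R :: real
  proof -
    define A where "A = {x. g x < 0} \<inter> {-R<..<R}"
    have Am [measurable]: "A \<in> sets borel" by (simp add: A_def)
    have "\<exists>T. open T \<and> A \<subseteq> T \<and> emeasure lebesgue (T - A) < ennreal (1 / Suc n)" for n
      using sets_lebesgue_outer_open[of A "1 / Suc n"] Am by (metis divide_pos_pos of_nat_0_less_iff sets_completionI_sets sets_lborel zero_less_Suc zero_less_one)
    then obtain T where T: "\<And>n. open (T n)" "\<And>n. A \<subseteq> T n"
      "\<And>n. emeasure lebesgue (T n - A) < ennreal (1 / Suc n)" by metis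
    \<comment> \<open>Finite intersections remain open, so the lemma on open sets applies to each of
      them, and they decrease to \<open>G\<close>; the indicators of the single sets
      \<open>T n\<close> need not converge.\<close>
    define V where "V n = (\<Inter>k\<le>n. T k) \<inter> {-R<..<R}" for n
    define G where "G = (\<Inter>n. T n) \<inter> {-R<..<R}"
    have V: "open (V n)" "V n \<subseteq> {-R..R}" for n
      using T(1) by (auto simp: V_def intro!: open_Int open_INT)
    have Gm [measurable]: "G \<in> sets borel"
      unfolding G_def using T(1) by (intro sets.Int sets.countable_INT) auto
    have "emeasure lborel (G - A) \<le> ennreal (1 / Suc n)" for n
    proof -
      have "emeasure lborel (G - A) \<le> emeasure lborel (T n - A)"
        using T(1) Am by (intro emeasure_mono) (auto simp: G_def)
      also have "\<dots> = emeasure lebesgue (T n - A)"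
        using T(1) Am by (subst emeasure_completion) (auto simp: main_part_sets)
      finally show ?thesis using T(3)[of n] by simp
    qed
    then have "emeasure lborel (G - A) \<le> ennreal 0"
      by (intro tendsto_le[OF _ tendsto_ennrealI[OF LIMSEQ_inverse_real_of_nat] tendsto_const])
         (auto simp: inverse_eq_divide)
    then have null: "G - A \<in> null_sets lborel"
      using Am Gm by (auto simp: null_sets_def)
    have "A \<subseteq> G" using T(2) by (auto simp: G_def A_def)
    have "(\<lambda>n. LINT x|lborel. indicator (V n) x * g x) \<longlonglongrightarrow> (LINT x|lborel. indicator G x * g x)"
    proof (rule integral_dominated_convergence)
      show "integrable lborel (\<lambda>x. indicator {-R..R} x *\<^sub>R \<bar>g x\<bar>)"
        using g unfolding locally_integrable_def by (intro set_integrable_abs[unfolded set_integrable_def]) (auto simp: set_integrable_def)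
      show "(\<lambda>x. indicator G x * g x) \<in> borel_measurable lborel" by simp
      show "(\<lambda>x. indicator (V n) x * g x) \<in> borel_measurable lborel" for n
        using V by simp
      show "AE x in lborel. (\<lambda>n. indicator (V n) x * g x) \<longlonglongrightarrow> indicator G x * g x"
      proof (intro AE_I2 tendsto_mult tendsto_const)
        fix x
        show "(\<lambda>n. indicator (V n) x :: real) \<longlonglongrightarrow> indicator G x"
        proof (cases "x \<in> G")
          case True
          then have "x \<in> V n" for n by (auto simp: G_def V_def)
          with True show ?thesis by simp
        next
          case False
          then obtain m where m: "x \<notin> T m \<or> x \<notin> {-R<..<R}" by (auto simp: G_def)
          have "eventually (\<lambda>n. (indicator (V n) x :: real) = indicator G x) sequentially"
            using eventually_ge_at_top[of m]
            by eventually_elim (use m False in \<open>auto simp: V_def indicator_def\<close>)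
          then show ?thesis by (rule tendsto_eventually)
        qed
      qed
      show "AE x in lborel. norm (indicator (V n) x * g x) \<le> indicator {-R..R} x *\<^sub>R \<bar>g x\<bar>" for n
        using V(2)[of n] by (intro AE_I2) (auto simp: indicator_def)
    qed
    moreover have "0 \<le> (LINT x|lborel. indicator (V n) x * g x)" for n
      by (rule set_integral_open_nonneg[OF g pos V])
    ultimately have "0 \<le> (LINT x|lborel. indicator G x * g x)"
      by (intro tendsto_lowerbound) auto
    also have "\<dots> = (LINT x|lborel. indicator A x * g x)"
    proof (rule integral_cong_AE)
      have "AE x in lborel. x \<notin> G - A" by (rule AE_not_in[OF null])
      then show "AE x in lborel. indicator G x * g x = indicator A x * g x"
        by eventually_elim (use \<open>A \<subseteq> G\<close> in \<open>auto simp: indicator_def\<close>)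
    qed auto
    finally have ge: "0 \<le> (LINT x|lborel. indicator A x * g x)" .
    have int: "integrable lborel (\<lambda>x. - (indicator A x * g x))"
    proof (rule Bochner_Integration.integrable_bound)
      show "integrable lborel (\<lambda>x. indicator {-R..R} x *\<^sub>R g x)"
        using g by (auto simp: locally_integrable_def set_integrable_def)
      show "AE x in lborel. norm (- (indicator A x * g x)) \<le> norm (indicator {-R..R} x *\<^sub>R g x)"
        by (intro AE_I2) (auto simp: indicator_def A_def)
    qed simp
    have nn: "AE x in lborel. 0 \<le> - (indicator A x * g x)"
      by (intro AE_I2) (auto simp: indicator_def A_def)
    have "(LINT x|lborel. - (indicator A x * g x)) = 0"
      using ge integral_nonneg_AE[OF nn] by simp
    then have "AE x in lborel. - (indicator A x * g x) = 0"
      using integral_nonneg_eq_0_iff_AE[OF int nn] by simp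
    then show ?thesis
      by eventually_elim (auto simp: A_def indicator_def split: if_splits)
  qed
  then have "AE x in lborel. \<forall>n::nat. x \<in> {- real n<..<real n} \<longrightarrow> 0 \<le> g x"
    unfolding AE_all_countable by blast
  then show ?thesis
  proof eventually_elim
    case (elim x)
    obtain n :: nat where "\<bar>x\<bar> < real n" using reals_Archimedean2 by blast
    with elim show ?case by (auto simp: abs_less_iff)
  qed
qed

lemma locally_integrable_diff:
  "locally_integrable f \<Longrightarrow> locally_integrable g \<Longrightarrow> locally_integrable (\<lambda>x. f x - g x)"
  unfolding locally_integrable_def by (auto intro: set_integral_diff)

lemma locally_integrable_continuous: "continuous_on UNIV f \<Longrightarrow> locally_integrable f"
  unfolding locally_integrable_def
  by (auto intro!: borel_integrable_atLeastAtMost' intro: continuous_on_subset)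

lemma AE_eq_if_test_eq:
  assumes f: "locally_integrable f" and g: "locally_integrable g"
    and eq: "\<And>\<phi>. test_function \<phi> \<Longrightarrow> (LINT x|lborel. f x * \<phi> x) = (LINT x|lborel. g x * \<phi> x)"
  shows "AE x in lborel. f x = g x"
proof -
  have "AE x in lborel. 0 \<le> f x - g x" "AE x in lborel. 0 \<le> g x - f x"
    by (rule AE_nonneg_if_test_nonneg;
        use f g eq in \<open>simp add: locally_integrable_diff left_diff_distrib integrable_mult_test\<close>)+
  then show ?thesis by eventually_elim simp
qed

section \<open>Weak derivatives and weakly differentiable curves\<close>

lemma has_weak_deriv_unique:
  assumes "has_weak_deriv g a" "has_weak_deriv g b"
  shows "AE x in lborel. a x = b x"
proof (rule AE_eq_if_test_eq)
  show "locally_integrable a" "locally_integrable b"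
    using assms by (auto simp: has_weak_deriv_def)
  show "(LINT x|lborel. a x * \<phi> x) = (LINT x|lborel. b x * \<phi> x)" if "test_function \<phi>" for \<phi>
  proof -
    have "(LINT x|lborel. g x * deriv \<phi> x) = - (LINT x|lborel. a x * \<phi> x)"
      "(LINT x|lborel. g x * deriv \<phi> x) = - (LINT x|lborel. b x * \<phi> x)"
      using assms that unfolding has_weak_deriv_def by blast+
    then show ?thesis by linarith
  qed
qed

lemma has_weak_deriv_weak_deriv: "has_weak_deriv g g' \<Longrightarrow> has_weak_deriv g (weak_deriv g)"
  unfolding weak_deriv_def by (rule someI[of "has_weak_deriv g"])

lemma weak_deriv_AE: "has_weak_deriv g g' \<Longrightarrow> AE x in lborel. weak_deriv g x = g' x"
  using has_weak_deriv_unique has_weak_deriv_weak_deriv by blast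

lemma weak_deriv_measurable: "has_weak_deriv g g' \<Longrightarrow> weak_deriv g \<in> borel_measurable borel"
  using has_weak_deriv_weak_deriv locally_integrable_measurable unfolding has_weak_deriv_def by blast

lemma integral_mult_deriv_test:
  fixes g g' :: "real \<Rightarrow> real"
  assumes g: "\<And>x. (g has_real_derivative g' x) (at x)" and g': "continuous_on UNIV g'"
    and \<phi>: "test_function \<phi>"
  shows "(LINT x|lborel. g x * deriv \<phi> x) = - (LINT x|lborel. g' x * \<phi> x)"
proof -
  obtain R where R: "0 < R" "\<And>x. \<bar>x\<bar> > R \<Longrightarrow> \<phi> x = 0"
    using test_function_support[OF \<phi>] by blast
  have R': "\<And>x. \<bar>x\<bar> > R \<Longrightarrow> deriv \<phi> x = 0"
    using R(2) by (rule deriv_eq_0_outside)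
  have gc: "continuous_on UNIV g"
    using g by (meson DERIV_continuous_on has_field_derivative_at_within)
  \<comment> \<open>The interval reaches to \<open>R + 1\<close> since \<phi> is only known to
    vanish strictly beyond \<open>R\<close>; thus the boundary terms drop out.\<close>
  have "(LINT x|lborel. indicator {-(R+1)..R+1} x *\<^sub>R (g x * deriv \<phi> x + g' x * \<phi> x))
      = g (R+1) * \<phi> (R+1) - g (-(R+1)) * \<phi> (-(R+1))"
  proof (rule integral_FTC_atLeastAtMost)
    show "((\<lambda>x. g x * \<phi> x) has_vector_derivative g x * deriv \<phi> x + g' x * \<phi> x)
        (at x within {-(R+1)..R+1})" for x
      using DERIV_mult'[OF g[of x] test_function_has_deriv[OF \<phi>, of x]]
      by (simp add: has_real_derivative_iff_has_vector_derivative has_vector_derivative_at_within)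
    show "continuous_on {-(R+1)..R+1} (\<lambda>x. g x * deriv \<phi> x + g' x * \<phi> x)"
      by (intro continuous_intros test_function_continuous test_function_deriv \<phi>
          continuous_on_subset[OF gc] continuous_on_subset[OF g']) auto
  qed (use R in auto)
  also have "\<dots> = 0" using R by simp
  finally have "0 = (LINT x|lborel. indicator {-(R+1)..R+1} x *\<^sub>R (g x * deriv \<phi> x + g' x * \<phi> x))"
    by simp
  also have "\<dots> = (LINT x|lborel. g x * deriv \<phi> x + g' x * \<phi> x)"
  proof (intro Bochner_Integration.integral_cong refl)
    show "indicator {-(R+1)..R+1} x *\<^sub>R (g x * deriv \<phi> x + g' x * \<phi> x) =
        g x * deriv \<phi> x + g' x * \<phi> x" for x
    proof (cases "x \<in> {-(R+1)..R+1}")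
      case False
      then have "\<bar>x\<bar> > R" by auto
      then show ?thesis using R R' by simp
    qed simp
  qed
  also have "\<dots> = (LINT x|lborel. g x * deriv \<phi> x) + (LINT x|lborel. g' x * \<phi> x)"
    using gc g' \<phi>
    by (intro Bochner_Integration.integral_add integrable_mult_test locally_integrable_continuous test_function_deriv)
  finally show ?thesis by simp
qed

lemma has_weak_deriv_if_C1:
  assumes "\<And>x. (g has_real_derivative g' x) (at x)" "continuous_on UNIV g'"
  shows "has_weak_deriv g g'"
proof -
  have "continuous_on UNIV g"
    using assms(1) by (meson DERIV_continuous_on has_field_derivative_at_within)
  then show ?thesis
    using assms integral_mult_deriv_test locally_integrable_continuous by (auto simp: has_weak_deriv_def)
qed

lemma locally_integrable_cong_AE:
  assumes "locally_integrable g" "AE x in lborel. g x = h x" "h \<in> borel_measurable borel"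
  shows "locally_integrable h"
  unfolding locally_integrable_def
proof (intro allI)
  fix a b :: real
  have g: "g \<in> borel_measurable borel"
    using assms(1) by (rule locally_integrable_measurable)
  have "set_integrable lborel {a..b} g \<longleftrightarrow> set_integrable lborel {a..b} h"
    unfolding set_integrable_def
    by (rule integrable_cong_AE) (use g assms in \<open>auto elim: eventually_mono\<close>)
  then show "set_integrable lborel {a..b} h"
    using assms(1) by (simp add: locally_integrable_def)
qed

text \<open>Moves a weak derivative from the explicit solution to any other solution with the same
  data, which agrees with it only almost everywhere. Borel representatives are used, so
  measurability of \<open>h\<close> does not follow from that of \<open>g\<close> and is a
  hypothesis.\<close>

lemma has_weak_deriv_cong_AE:
  assumes "has_weak_deriv g g'" "AE x in lborel. g x = h x" "h \<in> borel_measurable borel"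
  shows "has_weak_deriv h g'"
proof -
  have g: "g \<in> borel_measurable borel" "locally_integrable g"
    using assms(1) locally_integrable_measurable by (auto simp: has_weak_deriv_def)
  have "(LINT x|lborel. g x * deriv \<phi> x) = (LINT x|lborel. h x * deriv \<phi> x)"
    if "test_function \<phi>" for \<phi>
  proof (rule integral_cong_AE)
    have "deriv \<phi> \<in> borel_measurable borel"
      using that by (intro borel_measurable_continuous_onI test_function_continuous test_function_deriv)
    then show "(\<lambda>x. g x * deriv \<phi> x) \<in> borel_measurable lborel"
      "(\<lambda>x. h x * deriv \<phi> x) \<in> borel_measurable lborel"
      using g assms(3) by auto
  qed (use assms(2) in \<open>auto elim: eventually_mono\<close>)
  then show ?thesis
    using assms(1) locally_integrable_cong_AE[OF g(2) assms(2,3)] by (simp add: has_weak_deriv_def)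
qed

lemma has_weak_deriv_diff:
  assumes "has_weak_deriv f f'" "has_weak_deriv g g'"
  shows "has_weak_deriv (\<lambda>x. f x - g x) (\<lambda>x. f' x - g' x)"
  using assms unfolding has_weak_deriv_def
  by (auto simp: locally_integrable_diff left_diff_distrib integrable_mult_test test_function_deriv)

section \<open>Pairings of curves with test functions\<close>

lemma abs_integral_mult_test_le:
  assumes d: "locally_integrable d" and \<phi>: "test_function \<phi>"
    "\<And>x. \<bar>x\<bar> > R \<Longrightarrow> \<phi> x = 0" "\<And>x. \<bar>\<phi> x\<bar> \<le> K"
  shows "\<bar>LINT x|lborel. d x * \<phi> x\<bar> \<le> (LINT x:{-R..R}|lborel. \<bar>d x\<bar>) * K"
proof -
  have int: "integrable lborel (\<lambda>x. indicator {-R..R} x *\<^sub>R \<bar>d x\<bar>)"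
    using d set_integrable_abs unfolding locally_integrable_def set_integrable_def by fastforce
  have "norm (LINT x|lborel. d x * \<phi> x) \<le> (LINT x|lborel. indicator {-R..R} x *\<^sub>R \<bar>d x\<bar> * K)"
  proof (rule Bochner_Integration.integral_norm_bound_integral)
    show "integrable lborel (\<lambda>x. d x * \<phi> x)"
      using d \<phi>(1) by (rule integrable_mult_test)
    show "integrable lborel (\<lambda>x. indicator {-R..R} x *\<^sub>R \<bar>d x\<bar> * K)"
      using int by (rule integrable_mult_left)
    show "norm (d x * \<phi> x) \<le> indicator {-R..R} x *\<^sub>R \<bar>d x\<bar> * K" for x
    proof (cases "\<bar>x\<bar> > R")
      case False
      then have "x \<in> {-R..R}" by auto
      then show ?thesis using \<phi>(3)[of x] by (simp add: abs_mult mult_left_mono)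
    next
      case True
      moreover have "0 \<le> K" using \<phi>(3)[of x] abs_ge_zero[of "\<phi> x"] by linarith
      ultimately show ?thesis by (simp add: \<phi>(2))
    qed
  qed
  then show ?thesis
    by (simp add: set_lebesgue_integral_def)
qed

lemma test_function_bounded:
  assumes "test_function \<phi>"
  obtains K where "0 \<le> K" "\<And>x. \<bar>\<phi> x\<bar> \<le> K"
proof -
  obtain R where R: "0 < R" "\<And>x. \<bar>x\<bar> > R \<Longrightarrow> \<phi> x = 0"
    using test_function_support[OF assms] by blast
  have "compact (\<phi> ` {-R..R})"
    using test_function_continuous[OF assms] by (intro compact_continuous_image) auto
  then obtain C where C: "\<And>y. y \<in> \<phi> ` {-R..R} \<Longrightarrow> norm y \<le> C"
    using compact_imp_bounded bounded_iff by metis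
  show thesis
  proof (rule that[of "max C 0"])
    show "\<bar>\<phi> x\<bar> \<le> max C 0" for x
    proof (cases "\<bar>x\<bar> > R")
      case False
      then have "x \<in> {-R..R}" by auto
      then have "\<phi> x \<in> \<phi> ` {-R..R}" by blast
      then show ?thesis using C by fastforce
    qed (auto simp: R)
  qed auto
qed

lemma weak_curve_product_rule:
  fixes u :: "real \<Rightarrow> real \<Rightarrow> real"
  assumes t: "0 \<le> t"
    and u: "\<And>\<tau>. \<tau> \<ge> 0 \<Longrightarrow> locally_integrable (u \<tau>)"
    and du: "((\<lambda>\<tau>. LINT x|lborel. u \<tau> x * \<psi> t x) has_real_derivative D) (at t within {0..})"
    and equi: "\<exists>\<omega>. (\<omega> \<longlongrightarrow> 0) (at t within {0..}) \<and>
      (\<forall>\<^sub>F \<tau> in at t within {0..}. \<forall>\<phi> K. test_function \<phi> \<longrightarrow> (\<forall>x. \<bar>x\<bar> > R \<longrightarrow> \<phi> x = 0) \<longrightarrow>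
         (\<forall>x. \<bar>\<phi> x\<bar> \<le> K) \<longrightarrow>
         \<bar>(LINT x|lborel. u \<tau> x * \<phi> x) - (LINT x|lborel. u t x * \<phi> x)\<bar> \<le> \<omega> \<tau> * K)"
    and \<psi>: "\<And>\<tau>. test_function (\<psi> \<tau>)" and \<psi>': "test_function \<psi>'"
    and supp: "\<And>\<tau> x. \<bar>\<tau> - t\<bar> < 1 \<Longrightarrow> \<bar>x\<bar> > R \<Longrightarrow> \<psi> \<tau> x = 0" "\<And>x. \<bar>x\<bar> > R \<Longrightarrow> \<psi>' x = 0"
    and C: "\<And>\<tau> x. \<bar>\<tau> - t\<bar> < 1 \<Longrightarrow> \<bar>\<psi> \<tau> x - \<psi> t x - (\<tau> - t) * \<psi>' x\<bar> \<le> C * (\<tau> - t)\<^sup>2"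
  shows "((\<lambda>\<tau>. LINT x|lborel. u \<tau> x * \<psi> \<tau> x) has_real_derivative
      D + (LINT x|lborel. u t x * \<psi>' x)) (at t within {0..})"
proof -
  obtain \<omega> where \<omega>: "(\<omega> \<longlongrightarrow> 0) (at t within {0..})"
    "\<forall>\<^sub>F \<tau> in at t within {0..}. \<forall>\<phi> K. test_function \<phi> \<longrightarrow> (\<forall>x. \<bar>x\<bar> > R \<longrightarrow> \<phi> x = 0) \<longrightarrow>
         (\<forall>x. \<bar>\<phi> x\<bar> \<le> K) \<longrightarrow>
         \<bar>(LINT x|lborel. u \<tau> x * \<phi> x) - (LINT x|lborel. u t x * \<phi> x)\<bar> \<le> \<omega> \<tau> * K"
    using equi by blast
  obtain K where K: "0 \<le> K" "\<And>x. \<bar>\<psi>' x\<bar> \<le> K"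
    using test_function_bounded[OF \<psi>'] by blast
  have "0 \<le> C" using C[of "t + 1/2" 0] abs_ge_zero[of "\<psi> (t + 1/2) 0 - \<psi> t 0 - 1/2 * \<psi>' 0"]
    by (simp add: power2_eq_square del: abs_ge_zero)
  define M where "M = (LINT x:{-R..R}|lborel. \<bar>u t x\<bar>)"
  define I where "I = (LINT x|lborel. u t x * \<psi>' x)"
  define F where "F \<tau> = (LINT x|lborel. u \<tau> x * \<psi> \<tau> x)" for \<tau>
  define P where "P \<tau> = (LINT x|lborel. u \<tau> x * \<psi> t x)" for \<tau>
  have near: "\<forall>\<^sub>F \<tau> in at t within {0..}. \<bar>\<tau> - t\<bar> < 1 \<and> \<tau> \<noteq> t \<and> 0 \<le> \<tau>"
    unfolding eventually_at by (intro exI[of _ 1]) (auto simp: dist_real_def)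
  have "\<forall>\<^sub>F \<tau> in at t within {0..}.
      \<bar>(F \<tau> - F t) / (\<tau> - t) - ((P \<tau> - P t) / (\<tau> - t) + I)\<bar> \<le> M * (C * \<bar>\<tau> - t\<bar>) + \<omega> \<tau> * (K + C)"
    using near \<omega>(2)
  proof eventually_elim
    case (elim \<tau>)
    define \<rho> where "\<rho> x = \<psi> \<tau> x - \<psi> t x - (\<tau> - t) * \<psi>' x" for x
    define \<delta> where "\<delta> x = \<psi> \<tau> x - \<psi> t x" for x
    have t\<delta>: "test_function \<delta>"
      unfolding \<delta>_def using test_function_add[OF \<psi>[of \<tau>] test_function_cmult[OF \<psi>[of t], of "-1"]] by simp
    have t\<rho>: "test_function \<rho>"
      unfolding \<rho>_def using test_function_add[OF t\<delta> test_function_cmult[OF \<psi>', of "-(\<tau>-t)"]]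
      by (simp add: \<delta>_def algebra_simps)
    have "\<bar>(LINT x|lborel. u t x * \<rho> x)\<bar> \<le> M * (C * (\<tau> - t)\<^sup>2)"
      unfolding M_def using elim supp C t
      by (intro abs_integral_mult_test_le u t\<rho>) (auto simp: \<rho>_def)
    moreover have "\<bar>(LINT x|lborel. u \<tau> x * \<delta> x) - (LINT x|lborel. u t x * \<delta> x)\<bar> \<le> \<omega> \<tau> * ((K + C) * \<bar>\<tau> - t\<bar>)"
    proof -
      have "\<bar>\<delta> x\<bar> \<le> (K + C) * \<bar>\<tau> - t\<bar>" for x
      proof -
        have "\<bar>\<delta> x\<bar> \<le> \<bar>\<rho> x\<bar> + \<bar>(\<tau> - t) * \<psi>' x\<bar>"
          unfolding \<rho>_def \<delta>_def by linarith
        also have "\<bar>\<rho> x\<bar> \<le> C * (\<tau> - t)\<^sup>2" using C elim by (simp add: \<rho>_def)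
        also have "C * (\<tau> - t)\<^sup>2 \<le> C * \<bar>\<tau> - t\<bar>"
          using elim mult_left_le[of "\<bar>\<tau> - t\<bar>" "\<bar>\<tau> - t\<bar>"] \<open>0 \<le> C\<close>
          by (intro mult_left_mono) (auto simp: power2_eq_square)
        also have "\<bar>(\<tau> - t) * \<psi>' x\<bar> \<le> \<bar>\<tau> - t\<bar> * K"
          using K(2)[of x] by (simp add: abs_mult mult_left_mono)
        finally show ?thesis by (simp add: algebra_simps)
      qed
      moreover have "\<forall>x. \<bar>x\<bar> > R \<longrightarrow> \<delta> x = 0" using supp elim by (auto simp: \<delta>_def)
      ultimately show ?thesis using elim t\<delta> by blast
    qed
    moreover have "F \<tau> - F t = (P \<tau> - P t) + (\<tau> - t) * I + (LINT x|lborel. u t x * \<rho> x)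
        + ((LINT x|lborel. u \<tau> x * \<delta> x) - (LINT x|lborel. u t x * \<delta> x))"
    proof -
      have ints: "integrable lborel (\<lambda>x. u \<tau> x * \<psi> s x)" "integrable lborel (\<lambda>x. u t x * \<psi> s x)"
        "integrable lborel (\<lambda>x. u t x * \<psi>' x)" for s
        using u elim t \<psi> \<psi>' by (auto intro!: integrable_mult_test)
      have "(LINT x|lborel. u t x * \<rho> x) =
          (LINT x|lborel. u t x * \<psi> \<tau> x) - (LINT x|lborel. u t x * \<psi> t x) - (\<tau> - t) * I"
        unfolding \<rho>_def I_def using ints
        by (simp add: right_diff_distrib mult.left_commute[of "u t _"])
      moreover have "(LINT x|lborel. u s x * \<delta> x) =
          (LINT x|lborel. u s x * \<psi> \<tau> x) - (LINT x|lborel. u s x * \<psi> t x)" if "s = t \<or> s = \<tau>" for s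
        unfolding \<delta>_def using that ints by (auto simp: right_diff_distrib)
      ultimately show ?thesis by (simp add: F_def P_def)
    qed
    ultimately have "\<bar>F \<tau> - F t - ((P \<tau> - P t) + (\<tau> - t) * I)\<bar>
        \<le> M * (C * (\<tau> - t)\<^sup>2) + \<omega> \<tau> * ((K + C) * \<bar>\<tau> - t\<bar>)" by linarith
    also have "\<dots> = (M * (C * \<bar>\<tau> - t\<bar>) + \<omega> \<tau> * (K + C)) * \<bar>\<tau> - t\<bar>"
      by (simp add: power2_eq_square algebra_simps flip: abs_mult_self_eq[of "\<tau> - t"])
    finally have "\<bar>F \<tau> - F t - ((P \<tau> - P t) + (\<tau> - t) * I)\<bar> / \<bar>\<tau> - t\<bar>
        \<le> M * (C * \<bar>\<tau> - t\<bar>) + \<omega> \<tau> * (K + C)"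
      using elim by (simp add: divide_le_eq)
    also have "\<bar>F \<tau> - F t - ((P \<tau> - P t) + (\<tau> - t) * I)\<bar> / \<bar>\<tau> - t\<bar> =
        \<bar>(F \<tau> - F t - ((P \<tau> - P t) + (\<tau> - t) * I)) / (\<tau> - t)\<bar>"
      by (simp add: abs_divide)
    also have "(F \<tau> - F t - ((P \<tau> - P t) + (\<tau> - t) * I)) / (\<tau> - t) =
        (F \<tau> - F t) / (\<tau> - t) - ((P \<tau> - P t) / (\<tau> - t) + I)"
      using elim by (simp add: diff_divide_distrib add_divide_distrib)
    finally show ?case .
  qed
  moreover have "((\<lambda>\<tau>. M * (C * \<bar>\<tau> - t\<bar>) + \<omega> \<tau> * (K + C)) \<longlongrightarrow> 0) (at t within {0..})"
    by (rule tendsto_eq_intros \<omega>(1) | simp)+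
  ultimately have "((\<lambda>\<tau>. (F \<tau> - F t) / (\<tau> - t) - ((P \<tau> - P t) / (\<tau> - t) + I)) \<longlongrightarrow> 0) (at t within {0..})"
    by (auto intro: Lim_null_comparison)
  moreover have "((\<lambda>\<tau>. (P \<tau> - P t) / (\<tau> - t) + I) \<longlongrightarrow> D + I) (at t within {0..})"
    using du unfolding has_field_derivative_iff P_def by (intro tendsto_add tendsto_const)
  ultimately have "((\<lambda>\<tau>. (F \<tau> - F t) / (\<tau> - t)) \<longlongrightarrow> D + I) (at t within {0..})"
    using tendsto_add by fastforce
  then show ?thesis
    unfolding has_field_derivative_iff F_def I_def .
qed

text \<open>Both \<open>h - G\<close> and \<open>h + G\<close> are nondecreasing. \<open>G\<close>
  is differentiable only relative to the half line, which at time 0 is a one-sided statement;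
  interior derivatives together with continuity on the closed interval are enough for
  monotonicity.\<close>

lemma abs_diff_le_if_deriv_bound:
  fixes G h :: "real \<Rightarrow> real"
  assumes "0 \<le> a" "a \<le> b"
    and G: "\<And>t. a \<le> t \<Longrightarrow> t \<le> b \<Longrightarrow> (G has_real_derivative G' t) (at t within {0..})"
    and h: "\<And>t. a \<le> t \<Longrightarrow> t \<le> b \<Longrightarrow> (h has_real_derivative h' t) (at t)"
    and le: "\<And>t. a \<le> t \<Longrightarrow> t \<le> b \<Longrightarrow> \<bar>G' t\<bar> \<le> h' t"
  shows "\<bar>G b - G a\<bar> \<le> h b - h a"
proof -
  have G_at: "(G has_real_derivative G' t) (at t)" if "a < t" "t < b" for t
  proof -
    have "at t within {0..} = at t"
      using that \<open>0 \<le> a\<close> by (intro at_within_interior) auto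
    then show ?thesis using G[of t] that by simp
  qed
  have "continuous_on {a..b} G"
  proof (rule DERIV_continuous_on)
    show "(G has_real_derivative G' t) (at t within {a..b})" if "t \<in> {a..b}" for t
      using that \<open>0 \<le> a\<close> by (intro DERIV_subset[OF G]) auto
  qed
  moreover have "continuous_on {a..b} h"
    using h by (intro DERIV_continuous_on) (auto intro: has_field_derivative_at_within)
  ultimately have cont: "continuous_on {a..b} (\<lambda>t. h t - G t)" "continuous_on {a..b} (\<lambda>t. h t + G t)"
    by (auto intro: continuous_intros)
  have "h a - G a \<le> h b - G b"
  proof (rule DERIV_nonneg_imp_increasing_open[OF \<open>a \<le> b\<close> _ cont(1)])
    show "\<exists>y. ((\<lambda>t. h t - G t) has_real_derivative y) (at t) \<and> 0 \<le> y" if "a < t" "t < b" for t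
      using le[of t] that by (intro exI[of _ "h' t - G' t"] conjI DERIV_diff h G_at) auto
  qed
  moreover have "h a + G a \<le> h b + G b"
  proof (rule DERIV_nonneg_imp_increasing_open[OF \<open>a \<le> b\<close> _ cont(2)])
    show "\<exists>y. ((\<lambda>t. h t + G t) has_real_derivative y) (at t) \<and> 0 \<le> y" if "a < t" "t < b" for t
      using le[of t] that by (intro exI[of _ "h' t + G' t"] conjI DERIV_add h G_at) auto
  qed
  ultimately show ?thesis by linarith
qed

section \<open>Uniqueness of energy-class solutions\<close>

lemma jbracket_pos: "0 < jbracket x"
  by (simp add: jbracket_def add_pos_nonneg)

lemma L2w_0_iff: "g \<in> L2w 0 \<longleftrightarrow> g \<in> borel_measurable borel \<and> integrable lborel (\<lambda>x. (g x)\<^sup>2)"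
  using jbracket_pos by (simp add: L2w_def less_imp_neq[symmetric])

lemma L2w_norm_0: "L2w_norm 0 g = sqrt (LINT x|lborel. (g x)\<^sup>2)"
  using jbracket_pos by (simp add: L2w_norm_def less_imp_neq[symmetric])

lemma locally_integrable_L2:
  assumes "g \<in> L2w 0"
  shows "locally_integrable g"
  unfolding locally_integrable_def
proof (intro allI)
  fix a b :: real
  have g: "g \<in> borel_measurable borel" "integrable lborel (\<lambda>x. (g x)\<^sup>2)"
    using assms by (auto simp: L2w_0_iff)
  have "integrable lborel (\<lambda>x. indicator {a..b} x *\<^sub>R (1::real) + (g x)\<^sup>2)"
    using borel_integrable_atLeastAtMost'[of a b "\<lambda>_. 1::real"] g(2)
    by (intro Bochner_Integration.integrable_add) (auto simp: set_integrable_def)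
  then show "set_integrable lborel {a..b} g"
    unfolding set_integrable_def
  proof (rule Bochner_Integration.integrable_bound)
    show "(\<lambda>x. indicator {a..b} x *\<^sub>R g x) \<in> borel_measurable lborel" using g(1) by simp
    have "\<bar>g x\<bar> \<le> 1 + (g x)\<^sup>2" for x
      using sum_squares_bound[of "\<bar>g x\<bar>" 1] by simp
    then show "AE x in lborel. norm (indicator {a..b} x *\<^sub>R g x) \<le> norm (indicator {a..b} x *\<^sub>R 1 + (g x)\<^sup>2)"
      by (intro AE_I2) (auto simp: indicator_def)
  qed
qed

lemma L2w_0_diff:
  assumes "f \<in> L2w 0" "g \<in> L2w 0"
  shows "(\<lambda>x. f x - g x) \<in> L2w 0"
proof -
  have "integrable lborel (\<lambda>x. (f x - g x)\<^sup>2)"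
  proof (rule Bochner_Integration.integrable_bound)
    show "integrable lborel (\<lambda>x. 2 * (f x)\<^sup>2 + 2 * (g x)\<^sup>2)"
      using assms by (auto simp: L2w_0_iff)
    have "(f x - g x)\<^sup>2 \<le> 2 * (f x)\<^sup>2 + 2 * (g x)\<^sup>2" for x
      using zero_le_power2[of "f x + g x"] by (simp add: power2_eq_square algebra_simps)
    then show "AE x in lborel. norm ((f x - g x)\<^sup>2) \<le> norm (2 * (f x)\<^sup>2 + 2 * (g x)\<^sup>2)"
      by (intro AE_I2) simp
  qed (use assms in \<open>auto simp: L2w_0_iff\<close>)
  then show ?thesis using assms by (auto simp: L2w_0_iff)
qed

text \<open>Young's inequality |g| <= n / 2 + g^2 / (2 n), with \<open>n\<close> the norm itself,
  takes the place of the Cauchy-Schwarz inequality. It integrates to R * n + n / 2, whence the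
  generous factor \<open>R + 1\<close>; any factor depending on \<open>R\<close> alone would do. The
  case n = 0 is separate because of the division.\<close>

lemma set_integral_abs_le_L2:
  assumes g: "g \<in> L2w 0" and "0 \<le> R"
  shows "(LINT x:{-R..R}|lborel. \<bar>g x\<bar>) \<le> (R + 1) * L2w_norm 0 g"
proof -
  have gm: "g \<in> borel_measurable borel" and g2: "integrable lborel (\<lambda>x. (g x)\<^sup>2)"
    using g by (auto simp: L2w_0_iff)
  have int: "integrable lborel (\<lambda>x. indicator {-R..R} x *\<^sub>R \<bar>g x\<bar>)"
    using locally_integrable_L2[OF g] set_integrable_abs[of lborel "{-R..R}" g]
    unfolding locally_integrable_def set_integrable_def by blast
  define n where "n = L2w_norm 0 g"
  have n2: "(LINT x|lborel. (g x)\<^sup>2) = n\<^sup>2" and "0 \<le> n"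
    by (auto simp: n_def L2w_norm_0)
  show ?thesis
  proof (cases "n = 0")
    case True
    then have "AE x in lborel. (g x)\<^sup>2 = 0"
      using n2 integral_nonneg_eq_0_iff_AE[OF g2] by simp
    then have "(LINT x|lborel. indicator {-R..R} x *\<^sub>R \<bar>g x\<bar>) = (LINT x::real|lborel. (0::real))"
      using gm by (intro integral_cong_AE) (auto elim: eventually_mono)
    then show ?thesis using True by (simp add: set_lebesgue_integral_def n_def)
  next
    case False
    then have n: "0 < n" using \<open>0 \<le> n\<close> by simp
    have i1: "integrable lborel (\<lambda>x. indicator {-R..R} x *\<^sub>R (1::real))"
      using borel_integrable_atLeastAtMost'[of "-R" R "\<lambda>_. 1::real"] by (simp add: set_integrable_def)
    have "(LINT x|lborel. indicator {-R..R} x *\<^sub>R \<bar>g x\<bar>)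
        \<le> (LINT x|lborel. n / 2 * (indicator {-R..R} x *\<^sub>R 1) + (g x)\<^sup>2 / (2 * n))"
    proof (rule integral_mono[OF int])
      show "integrable lborel (\<lambda>x. n / 2 * (indicator {-R..R} x *\<^sub>R 1) + (g x)\<^sup>2 / (2 * n))"
        using i1 g2 by (intro Bochner_Integration.integrable_add integrable_mult_right integrable_divide) auto
      have "\<bar>g x\<bar> \<le> n / 2 + (g x)\<^sup>2 / (2 * n)" for x
      proof -
        have "2 * n * \<bar>g x\<bar> \<le> n\<^sup>2 + (g x)\<^sup>2" using sum_squares_bound[of n "\<bar>g x\<bar>"] by simp
        then show ?thesis using n by (simp add: field_simps power2_eq_square)
      qed
      moreover have "0 \<le> (g x)\<^sup>2 / (2 * n)" for x using n by simp
      ultimately show "indicator {-R..R} x *\<^sub>R \<bar>g x\<bar> \<le> n / 2 * (indicator {-R..R} x *\<^sub>R 1) + (g x)\<^sup>2 / (2 * n)" for x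
        by (simp add: indicator_def)
    qed
    also have "\<dots> = n / 2 * (2 * R) + n\<^sup>2 / (2 * n)"
      using i1 g2 n2 \<open>0 \<le> R\<close> by simp
    also have "\<dots> \<le> (R + 1) * n"
      using n by (simp add: power2_eq_square field_simps)
    finally show ?thesis by (simp add: set_lebesgue_integral_def n_def)
  qed
qed

section \<open>The backward wave equation by d'Alembert's formula\<close>

text \<open>With \<open>\<Phi>' = \<phi>\<close>, the function \<open>wave_odd \<Phi> (T - t) x\<close> of \<open>(t, x)\<close> solves the backward wave equation
  with final data \<open>(0, - \<phi>)\<close> at time \<open>T\<close>; its time derivative is \<open>- wave_even \<phi> (T - t) x\<close>.\<close>

definition wave_odd :: "(real \<Rightarrow> real) \<Rightarrow> real \<Rightarrow> real \<Rightarrow> real" where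
  "wave_odd \<Phi> a x = (\<Phi> (x + a) - \<Phi> (x - a)) / 2"

definition wave_even :: "(real \<Rightarrow> real) \<Rightarrow> real \<Rightarrow> real \<Rightarrow> real" where
  "wave_even \<phi> a x = (\<phi> (x + a) + \<phi> (x - a)) / 2"

lemma wave_odd_0 [simp]: "wave_odd \<Phi> 0 x = 0" and wave_even_0 [simp]: "wave_even \<phi> 0 x = \<phi> x"
  by (simp_all add: wave_odd_def wave_even_def)

lemma test_wave_even:
  assumes "test_function \<phi>"
  shows "test_function (wave_even \<phi> a)"
  unfolding wave_even_def
  using test_function_cmult[OF test_function_add[OF test_function_shift[OF assms, of a]
        test_function_shift[OF assms, of "-a"]], of "1/2"]
  by simp

lemma deriv_wave_odd:
  assumes "\<And>x. (\<Phi> has_real_derivative \<phi> x) (at x)"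
  shows "(wave_odd \<Phi> a has_real_derivative wave_odd \<phi> a x) (at x)"
  unfolding wave_odd_def
  by (auto intro!: derivative_eq_intros DERIV_chain2[OF assms])

lemma wave_even_support:
  assumes "\<And>x. \<bar>x\<bar> > R \<Longrightarrow> \<phi> x = 0" "\<bar>x\<bar> > R + \<bar>a\<bar>"
  shows "wave_even \<phi> a x = 0"
  using assms(1)[of "x + a"] assms(1)[of "x - a"] assms(2) by (simp add: wave_even_def abs_if split: if_splits)

text \<open>Finite speed of propagation. \<Phi> itself need not have compact support: it is constant
  on either side of the support of \<phi>, possibly with different constants. Beyond the light cone
  both arguments lie on the same side, so the difference vanishes.\<close>

lemma wave_odd_support:
  assumes \<Phi>: "\<And>x. (\<Phi> has_real_derivative \<phi> x) (at x)" and \<phi>: "\<And>x. \<bar>x\<bar> > R \<Longrightarrow> \<phi> x = 0"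
    and x: "\<bar>x\<bar> > R + \<bar>a\<bar>" and "0 \<le> R"
  shows "wave_odd \<Phi> a x = 0"
proof -
  have d: "(\<Phi> has_real_derivative 0) (at y within S)" if "\<bar>y\<bar> > R" for y S
    using \<Phi>[of y] \<phi>[OF that] by (auto intro: has_field_derivative_at_within)
  have "\<exists>c. \<forall>y\<in>{R<..}. \<Phi> y = c"
    using \<open>0 \<le> R\<close> by (intro has_field_derivative_zero_constant d) auto
  moreover have "\<exists>c. \<forall>y\<in>{..<-R}. \<Phi> y = c"
    using \<open>0 \<le> R\<close> by (intro has_field_derivative_zero_constant d) auto
  ultimately obtain c d where c: "\<And>y. y > R \<Longrightarrow> \<Phi> y = c" "\<And>y. y < -R \<Longrightarrow> \<Phi> y = d"
    by auto
  show ?thesis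
  proof (cases "x > 0")
    case True
    then have "x + a > R" "x - a > R" using x by (auto simp: abs_if split: if_splits)
    then show ?thesis by (simp add: wave_odd_def c)
  next
    case False
    then have "x + a < -R" "x - a < -R" using x by (auto simp: abs_if split: if_splits)
    then show ?thesis by (simp add: wave_odd_def c)
  qed
qed

lemma test_wave_odd:
  assumes \<Phi>: "\<And>x. (\<Phi> has_real_derivative \<phi> x) (at x)" and \<phi>: "test_function \<phi>"
  shows "test_function (wave_odd \<Phi> a)"
proof -
  obtain R where R: "0 < R" "\<And>x. \<bar>x\<bar> > R \<Longrightarrow> \<phi> x = 0"
    using test_function_support[OF \<phi>] by blast
  have \<Phi>s: "smooth \<Phi>"
    using smooth_antideriv[OF \<Phi>] \<phi> by (simp add: test_function_smooth)
  have "smooth (\<lambda>x. (1/2) * (\<Phi> (x + a) - \<Phi> (x + - a)))"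
    by (intro smooth_mult smooth_diff smooth_const smooth_shift \<Phi>s)
  then have "smooth (wave_odd \<Phi> a)"
    unfolding wave_odd_def by simp
  then show ?thesis
    using R by (intro test_functionI[of _ "R + \<bar>a\<bar>"] wave_odd_support[OF \<Phi> R(2)]) auto
qed

lemma taylor_quadratic_bound:
  fixes \<Phi> \<phi> :: "real \<Rightarrow> real"
  assumes \<Phi>: "\<And>x. (\<Phi> has_real_derivative \<phi> x) (at x)"
    and \<phi>: "\<And>x. (\<phi> has_real_derivative \<phi>' x) (at x)" and C: "\<And>x. \<bar>\<phi>' x\<bar> \<le> C"
  shows "\<bar>\<Phi> z - \<Phi> y - (z - y) * \<phi> y\<bar> \<le> C * (z - y)\<^sup>2"
proof -
  have lip: "\<bar>\<phi> w - \<phi> y\<bar> \<le> C * \<bar>w - y\<bar>" for w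
    using field_differentiable_bound[of UNIV \<phi> \<phi>' C w y] \<phi> C by simp
  have "norm ((\<lambda>w. \<Phi> w - w * \<phi> y) z - (\<lambda>w. \<Phi> w - w * \<phi> y) y) \<le> C * \<bar>z - y\<bar> * norm (z - y)"
  proof (rule field_differentiable_bound[of "closed_segment y z" _ "\<lambda>w. \<phi> w - \<phi> y"])
    show "((\<lambda>w. \<Phi> w - w * \<phi> y) has_real_derivative \<phi> w - \<phi> y) (at w within closed_segment y z)" for w
      by (auto intro!: derivative_eq_intros has_field_derivative_at_within[OF \<Phi>])
    show "norm (\<phi> w - \<phi> y) \<le> C * \<bar>z - y\<bar>" if "w \<in> closed_segment y z" for w
    proof -
      have "\<bar>w - y\<bar> \<le> \<bar>z - y\<bar>"
        using that by (auto simp: closed_segment_eq_real_ivl split: if_splits)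
      moreover have "0 \<le> C" using C[of 0] by linarith
      ultimately show ?thesis
        using order_trans[OF lip[of w] mult_left_mono] by simp
    qed
  qed auto
  then show ?thesis
    by (simp add: algebra_simps power2_eq_square abs_mult_self_eq flip: abs_mult)
qed

text \<open>Differentiation in the time parameter turns \<open>wave_odd\<close> of \<Phi> into
  \<open>wave_even\<close> of \<phi>. The remainder is quadratic uniformly in \<open>x\<close>,
  which is the form that the product rule for moving test functions asks for.\<close>

lemma wave_odd_quadratic:
  assumes \<Phi>: "\<And>x. (\<Phi> has_real_derivative \<phi> x) (at x)"
    and \<phi>: "\<And>x. (\<phi> has_real_derivative \<phi>' x) (at x)" and C: "\<And>x. \<bar>\<phi>' x\<bar> \<le> C"
  shows "\<bar>wave_odd \<Phi> b x - wave_odd \<Phi> a x - (b - a) * wave_even \<phi> a x\<bar> \<le> C * (b - a)\<^sup>2"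
proof -
  define X where "X = \<Phi> (x + b) - \<Phi> (x + a) - (b - a) * \<phi> (x + a)"
  define Y where "Y = \<Phi> (x - b) - \<Phi> (x - a) - (a - b) * \<phi> (x - a)"
  have "\<bar>X\<bar> \<le> C * (b - a)\<^sup>2" "\<bar>Y\<bar> \<le> C * (b - a)\<^sup>2"
    using taylor_quadratic_bound[OF assms, of "x + b" "x + a"]
      taylor_quadratic_bound[OF assms, of "x - b" "x - a"]
    by (simp_all add: X_def Y_def power2_commute)
  then have "\<bar>(X - Y) / 2\<bar> \<le> C * (b - a)\<^sup>2"
    using abs_triangle_ineq4[of X Y] unfolding abs_divide by simp
  moreover have "wave_odd \<Phi> b x - wave_odd \<Phi> a x - (b - a) * wave_even \<phi> a x = (X - Y) / 2"
    by (simp add: wave_odd_def wave_even_def X_def Y_def field_simps)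
  ultimately show ?thesis by (simp only:)
qed

lemma wave_even_quadratic:
  assumes \<Phi>: "\<And>x. (\<Phi> has_real_derivative \<phi> x) (at x)"
    and \<phi>: "\<And>x. (\<phi> has_real_derivative \<phi>' x) (at x)" and C: "\<And>x. \<bar>\<phi>' x\<bar> \<le> C"
  shows "\<bar>wave_even \<Phi> b x - wave_even \<Phi> a x - (b - a) * wave_odd \<phi> a x\<bar> \<le> C * (b - a)\<^sup>2"
proof -
  define X where "X = \<Phi> (x + b) - \<Phi> (x + a) - (b - a) * \<phi> (x + a)"
  define Y where "Y = \<Phi> (x - b) - \<Phi> (x - a) - (a - b) * \<phi> (x - a)"
  have "\<bar>X\<bar> \<le> C * (b - a)\<^sup>2" "\<bar>Y\<bar> \<le> C * (b - a)\<^sup>2"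
    using taylor_quadratic_bound[OF assms, of "x + b" "x + a"]
      taylor_quadratic_bound[OF assms, of "x - b" "x - a"]
    by (simp_all add: X_def Y_def power2_commute)
  then have "\<bar>(X + Y) / 2\<bar> \<le> C * (b - a)\<^sup>2"
    using abs_triangle_ineq[of X Y] unfolding abs_divide by simp
  moreover have "wave_even \<Phi> b x - wave_even \<Phi> a x - (b - a) * wave_odd \<phi> a x = (X + Y) / 2"
    by (simp add: wave_odd_def wave_even_def X_def Y_def field_simps)
  ultimately show ?thesis by (simp only:)
qed

lemma integral_wave_even:
  assumes "test_function \<phi>"
  shows "(LINT x|lborel. wave_even \<phi> a x) = (LINT x|lborel. \<phi> x)"
proof -
  have int: "integrable lborel \<psi>" if "test_function \<psi>" for \<psi>
    using integrable_mult_test[of "\<lambda>_. 1"] that locally_integrable_continuous[of "\<lambda>_. 1"] by simp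
  have "(LINT x|lborel. \<phi> (x + c)) = (LINT x|lborel. \<phi> x)" for c
    using lborel_integral_real_affine[of 1 \<phi> c] by (simp add: add.commute)
  from this[of a] this[of "-a"] show ?thesis
    unfolding wave_even_def
    using int[OF test_function_shift[OF assms, of a]] int[OF test_function_shift[OF assms, of "-a"]] by simp
qed

text \<open>The weak time derivative of the curve enters as a functional \<open>D\<close> of the
  test function. The minus signs come from the waves running backwards, with parameter T -
  \<tau>.\<close>

lemma wave_product_rules:
  fixes u :: "real \<Rightarrow> real \<Rightarrow> real"
  assumes t: "0 \<le> t"
    and u: "\<And>\<tau>. \<tau> \<ge> 0 \<Longrightarrow> locally_integrable (u \<tau>)"
    and du: "\<And>\<phi>. test_function \<phi> \<Longrightarrow>
      ((\<lambda>\<tau>. LINT x|lborel. u \<tau> x * \<phi> x) has_real_derivative D \<phi>) (at t within {0..})"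
    and equi: "\<And>R. 0 \<le> R \<Longrightarrow> \<exists>\<omega>. (\<omega> \<longlongrightarrow> 0) (at t within {0..}) \<and>
      (\<forall>\<^sub>F \<tau> in at t within {0..}. \<forall>\<phi> K. test_function \<phi> \<longrightarrow> (\<forall>x. \<bar>x\<bar> > R \<longrightarrow> \<phi> x = 0) \<longrightarrow>
         (\<forall>x. \<bar>\<phi> x\<bar> \<le> K) \<longrightarrow>
         \<bar>(LINT x|lborel. u \<tau> x * \<phi> x) - (LINT x|lborel. u t x * \<phi> x)\<bar> \<le> \<omega> \<tau> * K)"
    and \<Phi>: "\<And>x. (\<Phi> has_real_derivative \<phi> x) (at x)" and \<phi>: "test_function \<phi>"
  shows "((\<lambda>\<tau>. LINT x|lborel. u \<tau> x * wave_odd \<Phi> (T - \<tau>) x) has_real_derivative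
      D (wave_odd \<Phi> (T - t)) - (LINT x|lborel. u t x * wave_even \<phi> (T - t) x)) (at t within {0..})"
    and "((\<lambda>\<tau>. LINT x|lborel. u \<tau> x * wave_even \<phi> (T - \<tau>) x) has_real_derivative
      D (wave_even \<phi> (T - t)) - (LINT x|lborel. u t x * wave_odd (deriv \<phi>) (T - t) x)) (at t within {0..})"
proof -
  obtain R where R: "0 < R" "\<And>x. \<bar>x\<bar> > R \<Longrightarrow> \<phi> x = 0"
    using test_function_support[OF \<phi>] by blast
  have R': "\<And>x. \<bar>x\<bar> > R \<Longrightarrow> deriv \<phi> x = 0"
    using R(2) by (rule deriv_eq_0_outside)
  have R'': "\<And>x. \<bar>x\<bar> > R \<Longrightarrow> deriv (deriv \<phi>) x = 0"
    using R' by (rule deriv_eq_0_outside)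
  note d1 = test_function_has_deriv[OF \<phi>] and d2 = test_function_has_deriv[OF test_function_deriv[OF \<phi>]]
  obtain C where C: "0 \<le> C" "\<And>x. \<bar>deriv \<phi> x\<bar> \<le> C"
    using test_function_bounded[OF test_function_deriv[OF \<phi>]] by blast
  obtain C' where C': "0 \<le> C'" "\<And>x. \<bar>deriv (deriv \<phi>) x\<bar> \<le> C'"
    using test_function_bounded[OF test_function_deriv[OF test_function_deriv[OF \<phi>]]] by blast
  \<comment> \<open>The light cone at time \<open>t\<close> plus 1: a common support bound for all
    times at distance less than 1 from \<open>t\<close>.\<close>
  define S where "S = R + \<bar>T - t\<bar> + 1"
  have "0 \<le> S" using R by (simp add: S_def)
  note e = equi[OF \<open>0 \<le> S\<close>]
  have far: "R + \<bar>T - \<tau>\<bar> < \<bar>x\<bar>" if "\<bar>\<tau> - t\<bar> < 1" "S < \<bar>x\<bar>" for \<tau> x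
    using that by (simp add: S_def)
  have "((\<lambda>\<tau>. LINT x|lborel. u \<tau> x * wave_odd \<Phi> (T - \<tau>) x) has_real_derivative
      D (wave_odd \<Phi> (T - t)) + (LINT x|lborel. u t x * (- 1 * wave_even \<phi> (T - t) x))) (at t within {0..})"
  proof (rule weak_curve_product_rule[OF t u _ e, where C=C])
    show "wave_odd \<Phi> (T - \<tau>) x = 0" if "\<bar>\<tau> - t\<bar> < 1" "S < \<bar>x\<bar>" for \<tau> x
      using far[OF that] R by (intro wave_odd_support[OF \<Phi> R(2)]) auto
    show "- 1 * wave_even \<phi> (T - t) x = 0" if "S < \<bar>x\<bar>" for x
      using far[of t x] that by (simp add: wave_even_support[OF R(2)])
    show "\<bar>wave_odd \<Phi> (T - \<tau>) x - wave_odd \<Phi> (T - t) x - (\<tau> - t) * (- 1 * wave_even \<phi> (T - t) x)\<bar>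
        \<le> C * (\<tau> - t)\<^sup>2" for \<tau> x
      using wave_odd_quadratic[OF \<Phi> d1 C(2), of "T - \<tau>" x "T - t"]
      by (simp add: algebra_simps power2_commute)
    show "test_function (\<lambda>x. - 1 * wave_even \<phi> (T - t) x)"
      by (rule test_function_cmult[OF test_wave_even[OF \<phi>]])
  qed (use du test_wave_odd[OF \<Phi> \<phi>] in auto)
  then show "((\<lambda>\<tau>. LINT x|lborel. u \<tau> x * wave_odd \<Phi> (T - \<tau>) x) has_real_derivative
      D (wave_odd \<Phi> (T - t)) - (LINT x|lborel. u t x * wave_even \<phi> (T - t) x)) (at t within {0..})"
    by simp
  have "((\<lambda>\<tau>. LINT x|lborel. u \<tau> x * wave_even \<phi> (T - \<tau>) x) has_real_derivative
      D (wave_even \<phi> (T - t)) + (LINT x|lborel. u t x * (- 1 * wave_odd (deriv \<phi>) (T - t) x))) (at t within {0..})"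
  proof (rule weak_curve_product_rule[OF t u _ e, where C=C'])
    show "wave_even \<phi> (T - \<tau>) x = 0" if "\<bar>\<tau> - t\<bar> < 1" "S < \<bar>x\<bar>" for \<tau> x
      using far[OF that] by (intro wave_even_support[OF R(2)]) auto
    show "- 1 * wave_odd (deriv \<phi>) (T - t) x = 0" if "S < \<bar>x\<bar>" for x
    proof -
      have "R + \<bar>T - t\<bar> < \<bar>x\<bar>" using far[of t x] that by simp
      then have "wave_odd (deriv \<phi>) (T - t) x = 0"
        using R by (intro wave_odd_support[OF d2 R'']) auto
      then show ?thesis by simp
    qed
    show "\<bar>wave_even \<phi> (T - \<tau>) x - wave_even \<phi> (T - t) x - (\<tau> - t) * (- 1 * wave_odd (deriv \<phi>) (T - t) x)\<bar>
        \<le> C' * (\<tau> - t)\<^sup>2" for \<tau> x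
      using wave_even_quadratic[OF d1 d2 C'(2), of "T - \<tau>" x "T - t"]
      by (simp add: algebra_simps power2_commute)
    show "test_function (\<lambda>x. - 1 * wave_odd (deriv \<phi>) (T - t) x)"
      by (rule test_function_cmult[OF test_wave_odd[OF d2 test_function_deriv[OF test_function_deriv[OF \<phi>]]]])
  qed (use du test_wave_even[OF \<phi>] in auto)
  then show "((\<lambda>\<tau>. LINT x|lborel. u \<tau> x * wave_even \<phi> (T - \<tau>) x) has_real_derivative
      D (wave_even \<phi> (T - t)) - (LINT x|lborel. u t x * wave_odd (deriv \<phi>) (T - t) x)) (at t within {0..})"
    by simp
qed

text \<open>The derivative in the time parameter is the integral of \<open>wave_even\<close>, which
  is constant by translation invariance, and the value at parameter 0 is 0. This factor
  \<open>a\<close> is the mass of the d'Alembert kernel and becomes the length of the time interval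
  in Duhamel's formula.\<close>

lemma integral_wave_odd:
  assumes \<Phi>: "\<And>x. (\<Phi> has_real_derivative \<phi> x) (at x)" and \<phi>: "test_function \<phi>" and "0 \<le> a"
  shows "(LINT x|lborel. wave_odd \<Phi> a x) = a * (LINT x|lborel. \<phi> x)"
proof -
  have one: "locally_integrable (\<lambda>_. 1)" by (intro locally_integrable_continuous continuous_intros)
  \<comment> \<open>the product rule for the constant curve \<open>1\<close>\<close>
  define J where "J \<tau> = (LINT x|lborel. 1 * wave_odd \<Phi> (a - \<tau>) x)" for \<tau>
  have J: "(J has_real_derivative 0 - (LINT x|lborel. 1 * wave_even \<phi> (a - t) x)) (at t within {0..})"
    if "0 \<le> t" for t
  proof -
    have "\<exists>\<omega>. (\<omega> \<longlongrightarrow> 0) (at t within {0..}) \<and>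
      (\<forall>\<^sub>F \<tau> in at t within {0..}. \<forall>\<phi> K. test_function \<phi> \<longrightarrow> (\<forall>x. \<bar>x\<bar> > R \<longrightarrow> \<phi> x = 0) \<longrightarrow>
         (\<forall>x. \<bar>\<phi> x\<bar> \<le> K) \<longrightarrow>
         \<bar>(LINT x|lborel. 1 * \<phi> x) - (LINT x|lborel. 1 * \<phi> x)\<bar> \<le> \<omega> \<tau> * K)" for R :: real
      by (intro exI[of _ "\<lambda>_. 0"]) simp
    from wave_product_rules(1)[where u="\<lambda>_ _. 1" and D="\<lambda>_. 0", OF that one DERIV_const this \<Phi> \<phi>]
    show ?thesis unfolding J_def .
  qed
  have "\<bar>(J a + a * (LINT x|lborel. \<phi> x)) - (J 0 + 0 * (LINT x|lborel. \<phi> x))\<bar> \<le> 0 - 0"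
  proof (rule abs_diff_le_if_deriv_bound[where G="\<lambda>t. J t + t * (LINT x|lborel. \<phi> x)" and h="\<lambda>_. 0" and h'="\<lambda>_. 0" and G'="\<lambda>_. 0"])
    show "((\<lambda>t. J t + t * (LINT x|lborel. \<phi> x)) has_real_derivative 0) (at t within {0..})" if "0 \<le> t" for t
      using J[OF that] integral_wave_even[OF \<phi>, of "a - t"] by (auto intro!: derivative_eq_intros)
  qed (use \<open>0 \<le> a\<close> in auto)
  then show ?thesis by (simp add: J_def)
qed

lemma test_function_antideriv:
  assumes "test_function \<phi>"
  obtains \<Phi> where "\<And>x. (\<Phi> has_real_derivative \<phi> x) (at x)"
proof -
  have "isCont \<phi> x" for x
    using test_function_has_deriv[OF assms] DERIV_isCont by blast
  then obtain \<Phi> where "\<And>x. (\<Phi> has_vector_derivative \<phi> x) (at x)"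
    using einterval_antiderivative[of "-\<infinity>" "\<infinity>" \<phi>] by auto
  then show thesis
    by (intro that) (simp add: has_real_derivative_iff_has_vector_derivative)
qed

section \<open>Time regularity of energy-class solutions\<close>

lemma sg_regular:
  assumes "sine_gordon_solution g1 g2 f ft" "0 \<le> t"
  shows "locally_integrable (f t)" "ft t \<in> L2w 0" "locally_integrable (ft t)"
  using assms locally_integrable_L2
  by (auto simp: sine_gordon_solution_def H1sin_def has_weak_deriv_def)

lemma sg_velocity_continuous:
  assumes sol: "sine_gordon_solution g1 g2 f ft" and "0 \<le> t"
  shows "((\<lambda>\<tau>. L2w_norm 0 (\<lambda>x. ft \<tau> x - ft t x)) \<longlongrightarrow> 0) (at t within {0..})"
proof (rule tendsto_sandwich[where f="\<lambda>_. 0" and h="\<lambda>\<tau>. sin_dist 0 (f \<tau>, ft \<tau>) (f t, ft t)"])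
  show "((\<lambda>\<tau>. sin_dist 0 (f \<tau>, ft \<tau>) (f t, ft t)) \<longlongrightarrow> 0) (at t within {0..})"
    using assms by (auto simp: sine_gordon_solution_def)
  show "\<forall>\<^sub>F \<tau> in at t within {0..}. L2w_norm 0 (\<lambda>x. ft \<tau> x - ft t x) \<le> sin_dist 0 (f \<tau>, ft \<tau>) (f t, ft t)"
    unfolding sin_dist_def by (intro always_eventually allI real_le_rsqrt) simp
qed (auto simp: L2w_norm_0)

text \<open>For velocities the modulus is the norm of the increment, which tends to 0 by continuity
  of the curve; restricting to a bounded interval turns it into a bound on the integral of the
  absolute value.\<close>

lemma sg_velocity_equicontinuous:
  assumes sol: "sine_gordon_solution g1 g2 f ft" and t: "0 \<le> t" and R: "0 \<le> R"
  shows "\<exists>\<omega>. (\<omega> \<longlongrightarrow> 0) (at t within {0..}) \<and>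
      (\<forall>\<^sub>F \<tau> in at t within {0..}. \<forall>\<phi> K. test_function \<phi> \<longrightarrow> (\<forall>x. \<bar>x\<bar> > R \<longrightarrow> \<phi> x = 0) \<longrightarrow>
         (\<forall>x. \<bar>\<phi> x\<bar> \<le> K) \<longrightarrow>
         \<bar>(LINT x|lborel. ft \<tau> x * \<phi> x) - (LINT x|lborel. ft t x * \<phi> x)\<bar> \<le> \<omega> \<tau> * K)"
proof (intro exI conjI)
  show "((\<lambda>\<tau>. (R + 1) * L2w_norm 0 (\<lambda>x. ft \<tau> x - ft t x)) \<longlongrightarrow> 0) (at t within {0..})"
    using tendsto_mult[OF tendsto_const sg_velocity_continuous[OF sol t]] by fastforce
  have "\<forall>\<^sub>F \<tau> in at t within {0..}. 0 \<le> \<tau>"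
    by (auto simp: eventually_at_filter)
  then show "\<forall>\<^sub>F \<tau> in at t within {0..}. \<forall>\<phi> K. test_function \<phi> \<longrightarrow> (\<forall>x. \<bar>x\<bar> > R \<longrightarrow> \<phi> x = 0) \<longrightarrow>
         (\<forall>x. \<bar>\<phi> x\<bar> \<le> K) \<longrightarrow>
         \<bar>(LINT x|lborel. ft \<tau> x * \<phi> x) - (LINT x|lborel. ft t x * \<phi> x)\<bar>
           \<le> (R + 1) * L2w_norm 0 (\<lambda>x. ft \<tau> x - ft t x) * K"
  proof (eventually_elim, intro allI impI)
    fix \<tau> K :: real and \<phi>
    assume \<tau>: "0 \<le> \<tau>" and \<phi>: "test_function \<phi>" "\<forall>x. \<bar>x\<bar> > R \<longrightarrow> \<phi> x = 0" "\<forall>x. \<bar>\<phi> x\<bar> \<le> K"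
    note r\<tau> = sg_regular[OF sol \<tau>] and rt = sg_regular[OF sol t]
    have "(LINT x|lborel. ft \<tau> x * \<phi> x) - (LINT x|lborel. ft t x * \<phi> x)
        = (LINT x|lborel. (ft \<tau> x - ft t x) * \<phi> x)"
      using r\<tau> rt \<phi>(1) by (simp add: left_diff_distrib integrable_mult_test)
    also have "\<bar>\<dots>\<bar> \<le> (LINT x:{-R..R}|lborel. \<bar>ft \<tau> x - ft t x\<bar>) * K"
      using r\<tau> rt \<phi> by (intro abs_integral_mult_test_le locally_integrable_diff) auto
    also have "\<dots> \<le> (R + 1) * L2w_norm 0 (\<lambda>x. ft \<tau> x - ft t x) * K"
    proof (rule mult_right_mono)
      show "0 \<le> K" using \<phi>(3) abs_ge_zero order_trans by blast
    qed (use r\<tau> rt R in \<open>auto intro!: set_integral_abs_le_L2 L2w_0_diff\<close>)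
    finally show "\<bar>(LINT x|lborel. ft \<tau> x * \<phi> x) - (LINT x|lborel. ft t x * \<phi> x)\<bar>
           \<le> (R + 1) * L2w_norm 0 (\<lambda>x. ft \<tau> x - ft t x) * K" .
  qed
qed

text \<open>Closeness in the distance leaves positions undetermined modulo 2 * pi, so it does not
  bound the integral of |f \<tau> - f t|. The first tested equation helps instead: the pairing with
  any \<phi> has the pairing of the velocity as its derivative, and velocities are bounded in the
  mean locally in time. This gives a Lipschitz modulus.\<close>

lemma sg_position_equicontinuous:
  assumes sol: "sine_gordon_solution g1 g2 f ft" and t: "0 \<le> t" and R: "0 \<le> R"
  shows "\<exists>\<omega>. (\<omega> \<longlongrightarrow> 0) (at t within {0..}) \<and>
      (\<forall>\<^sub>F \<tau> in at t within {0..}. \<forall>\<phi> K. test_function \<phi> \<longrightarrow> (\<forall>x. \<bar>x\<bar> > R \<longrightarrow> \<phi> x = 0) \<longrightarrow>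
         (\<forall>x. \<bar>\<phi> x\<bar> \<le> K) \<longrightarrow>
         \<bar>(LINT x|lborel. f \<tau> x * \<phi> x) - (LINT x|lborel. f t x * \<phi> x)\<bar> \<le> \<omega> \<tau> * K)"
proof -
  have "\<forall>\<^sub>F \<tau> in at t within {0..}. L2w_norm 0 (\<lambda>x. ft \<tau> x - ft t x) < 1"
    using order_tendstoD(2)[OF sg_velocity_continuous[OF sol t]] by simp
  then obtain \<delta> where \<delta>: "0 < \<delta>"
    "\<And>\<tau>. \<tau> \<in> {0..} \<Longrightarrow> \<tau> \<noteq> t \<Longrightarrow> dist \<tau> t < \<delta> \<Longrightarrow> L2w_norm 0 (\<lambda>x. ft \<tau> x - ft t x) < 1"
    unfolding eventually_at by blast
  \<comment> \<open>The summand \<open>R + 1\<close> covers the increment of the velocity, whose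
    norm is at most 1 near time \<open>t\<close>; the integral covers the velocity at time
    \<open>t\<close> itself.\<close>
  define L where "L = (R + 1) + (LINT x:{-R..R}|lborel. \<bar>ft t x\<bar>)"
  have abs_int: "set_integrable lborel {-R..R} (\<lambda>x. \<bar>g x\<bar>)" if "locally_integrable g" for g
    using that set_integrable_abs[of lborel "{-R..R}" g] unfolding locally_integrable_def by blast
  have L: "(LINT x:{-R..R}|lborel. \<bar>ft \<tau> x\<bar>) \<le> L" if \<tau>: "0 \<le> \<tau>" "\<bar>\<tau> - t\<bar> < \<delta>" for \<tau>
  proof -
    note r\<tau> = sg_regular[OF sol \<tau>(1)] and rt = sg_regular[OF sol t]
    have "L2w_norm 0 (\<lambda>x. ft \<tau> x - ft t x) \<le> 1"
      using \<delta>(2)[of \<tau>] \<tau> by (cases "\<tau> = t") (auto simp: dist_real_def L2w_norm_0)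
    then have "(LINT x:{-R..R}|lborel. \<bar>ft \<tau> x - ft t x\<bar>) \<le> (R + 1) * 1"
      using order_trans[OF set_integral_abs_le_L2[OF L2w_0_diff[OF r\<tau>(2) rt(2)] R] mult_left_mono[of _ 1]] R
      by simp
    moreover have "(LINT x:{-R..R}|lborel. \<bar>ft \<tau> x\<bar>) \<le>
        (LINT x:{-R..R}|lborel. \<bar>ft \<tau> x - ft t x\<bar> + \<bar>ft t x\<bar>)"
      using r\<tau> rt by (intro set_integral_mono set_integral_add abs_int locally_integrable_diff) auto
    moreover have "\<dots> = (LINT x:{-R..R}|lborel. \<bar>ft \<tau> x - ft t x\<bar>) + (LINT x:{-R..R}|lborel. \<bar>ft t x\<bar>)"
      using r\<tau> rt by (intro set_integral_add abs_int locally_integrable_diff) auto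
    ultimately show ?thesis by (simp add: L_def)
  qed
  show ?thesis
  proof (intro exI conjI)
    show "((\<lambda>\<tau>. L * \<bar>\<tau> - t\<bar>) \<longlongrightarrow> 0) (at t within {0..})"
      by (rule tendsto_eq_intros refl | simp)+
    have "\<forall>\<^sub>F \<tau> in at t within {0..}. 0 \<le> \<tau> \<and> \<bar>\<tau> - t\<bar> < \<delta>"
      unfolding eventually_at using \<delta>(1) by (auto simp: dist_real_def)
    then show "\<forall>\<^sub>F \<tau> in at t within {0..}. \<forall>\<phi> K. test_function \<phi> \<longrightarrow> (\<forall>x. \<bar>x\<bar> > R \<longrightarrow> \<phi> x = 0) \<longrightarrow>
         (\<forall>x. \<bar>\<phi> x\<bar> \<le> K) \<longrightarrow>
         \<bar>(LINT x|lborel. f \<tau> x * \<phi> x) - (LINT x|lborel. f t x * \<phi> x)\<bar> \<le> L * \<bar>\<tau> - t\<bar> * K"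
    proof (eventually_elim, intro allI impI)
      fix \<tau> K :: real and \<phi>
      assume \<tau>: "0 \<le> \<tau> \<and> \<bar>\<tau> - t\<bar> < \<delta>"
        and \<phi>: "test_function \<phi>" "\<forall>x. \<bar>x\<bar> > R \<longrightarrow> \<phi> x = 0" "\<forall>x. \<bar>\<phi> x\<bar> \<le> K"
      have K: "0 \<le> K" using \<phi>(3) abs_ge_zero order_trans by blast
      define G where "G s = (LINT x|lborel. f s x * \<phi> x)" for s
      have *: "\<bar>G b - G a\<bar> \<le> L * K * b - L * K * a"
        if ab: "0 \<le> a" "a \<le> b" "\<And>s. a \<le> s \<Longrightarrow> s \<le> b \<Longrightarrow> \<bar>s - t\<bar> < \<delta>" for a b
      proof (rule abs_diff_le_if_deriv_bound[where h="(*) (L * K)", OF ab(1,2)])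
        fix s assume s: "a \<le> s" "s \<le> b"
        then have s0: "0 \<le> s" using ab by simp
        show "(G has_real_derivative (LINT x|lborel. ft s x * \<phi> x)) (at s within {0..})"
          using sol \<phi>(1) s0 unfolding sine_gordon_solution_def G_def by blast
        show "((*) (L * K) has_real_derivative L * K) (at s)"
          by (auto intro!: derivative_eq_intros)
        have "\<bar>LINT x|lborel. ft s x * \<phi> x\<bar> \<le> (LINT x:{-R..R}|lborel. \<bar>ft s x\<bar>) * K"
          using \<phi> sg_regular[OF sol s0] by (intro abs_integral_mult_test_le) auto
        also have "\<dots> \<le> L * K"
          using L[OF s0 ab(3)[OF s]] K by (rule mult_right_mono)
        finally show "\<bar>LINT x|lborel. ft s x * \<phi> x\<bar> \<le> L * K" .
      qed
      have "\<bar>G \<tau> - G t\<bar> \<le> L * \<bar>\<tau> - t\<bar> * K"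
      proof (cases "t \<le> \<tau>")
        case True
        then show ?thesis using *[of t \<tau>] \<tau> t by (simp add: algebra_simps)
      next
        case False
        then show ?thesis using *[of \<tau> t] \<tau> t by (simp add: algebra_simps)
      qed
      then show "\<bar>(LINT x|lborel. f \<tau> x * \<phi> x) - (LINT x|lborel. f t x * \<phi> x)\<bar> \<le> L * \<bar>\<tau> - t\<bar> * K"
        by (simp add: G_def)
    qed
  qed
qed

section \<open>Duhamel's formula by duality, and its iteration\<close>

lemma locally_integrable_sin:
  assumes "locally_integrable g"
  shows "locally_integrable (\<lambda>x. sin (g x))"
  unfolding locally_integrable_def
proof (intro allI)
  fix a b :: real
  have "g \<in> borel_measurable borel" using assms by (rule locally_integrable_measurable)
  then have m: "(\<lambda>x. sin (g x)) \<in> borel_measurable borel" by measurable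
  show "set_integrable lborel {a..b} (\<lambda>x. sin (g x))"
    unfolding set_integrable_def
  proof (rule Bochner_Integration.integrable_bound)
    show "integrable lborel (\<lambda>x. indicator {a..b} x *\<^sub>R (1::real))"
      using borel_integrable_atLeastAtMost'[of a b "\<lambda>_. 1::real"] by (simp add: set_integrable_def)
  qed (use m in \<open>auto simp: indicator_def\<close>)
qed

text \<open>With \<open>w\<close> the backward wave, whose time derivative is minus the
  \<open>wave_even\<close> term, the quantity is the symplectic pairing of (f, ft) with (w, w_t). It
  is conserved by the linear wave equation: the terms with two space derivatives and those with the
  velocity cancel, and only the nonlinearity is left.\<close>

lemma sg_wave_pairing:
  assumes sol: "sine_gordon_solution g1 g2 f ft" and t: "0 \<le> t"
    and \<Phi>: "\<And>x. (\<Phi> has_real_derivative \<phi> x) (at x)" and \<phi>: "test_function \<phi>"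
  shows "((\<lambda>\<tau>. (LINT x|lborel. ft \<tau> x * wave_odd \<Phi> (T - \<tau>) x)
             + (LINT x|lborel. f \<tau> x * wave_even \<phi> (T - \<tau>) x)) has_real_derivative
           - (LINT x|lborel. sin (f t x) * wave_odd \<Phi> (T - t) x)) (at t within {0..})"
proof -
  note d1 = test_function_has_deriv[OF \<phi>] and d2 = test_function_has_deriv[OF test_function_deriv[OF \<phi>]]
  have weak1: "((\<lambda>\<tau>. LINT x|lborel. f \<tau> x * \<eta> x) has_real_derivative
           (LINT x|lborel. ft t x * \<eta> x)) (at t within {0..})"
    and weak2: "((\<lambda>\<tau>. LINT x|lborel. ft \<tau> x * \<eta> x) has_real_derivative
           (LINT x|lborel. f t x * deriv (deriv \<eta>) x - sin (f t x) * \<eta> x)) (at t within {0..})"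
    if "test_function \<eta>" for \<eta>
    using sol t that by (auto simp: sine_gordon_solution_def)
  have dd: "deriv (deriv (wave_odd \<Phi> a)) = wave_odd (deriv \<phi>) a" for a
  proof -
    have "deriv (wave_odd \<Phi> a) = wave_odd \<phi> a"
      using deriv_wave_odd[OF \<Phi>] DERIV_imp_deriv by blast
    moreover have "deriv (wave_odd \<phi> a) = wave_odd (deriv \<phi>) a"
      using deriv_wave_odd[OF d1] DERIV_imp_deriv by blast
    ultimately show ?thesis by simp
  qed
  have "((\<lambda>\<tau>. (LINT x|lborel. ft \<tau> x * wave_odd \<Phi> (T - \<tau>) x)
             + (LINT x|lborel. f \<tau> x * wave_even \<phi> (T - \<tau>) x)) has_real_derivative
      (LINT x|lborel. f t x * wave_odd (deriv \<phi>) (T - t) x - sin (f t x) * wave_odd \<Phi> (T - t) x)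
       - (LINT x|lborel. ft t x * wave_even \<phi> (T - t) x)
       + ((LINT x|lborel. ft t x * wave_even \<phi> (T - t) x)
          - (LINT x|lborel. f t x * wave_odd (deriv \<phi>) (T - t) x))) (at t within {0..})"
  proof (rule DERIV_add)
    show "((\<lambda>\<tau>. LINT x|lborel. ft \<tau> x * wave_odd \<Phi> (T - \<tau>) x) has_real_derivative
        (LINT x|lborel. f t x * wave_odd (deriv \<phi>) (T - t) x - sin (f t x) * wave_odd \<Phi> (T - t) x)
          - (LINT x|lborel. ft t x * wave_even \<phi> (T - t) x)) (at t within {0..})"
      using wave_product_rules(1)[OF t sg_regular(3)[OF sol] weak2 sg_velocity_equicontinuous[OF sol t] \<Phi> \<phi>, of T]
      by (simp add: dd)
    show "((\<lambda>\<tau>. LINT x|lborel. f \<tau> x * wave_even \<phi> (T - \<tau>) x) has_real_derivative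
        (LINT x|lborel. ft t x * wave_even \<phi> (T - t) x)
          - (LINT x|lborel. f t x * wave_odd (deriv \<phi>) (T - t) x)) (at t within {0..})"
      by (rule wave_product_rules(2)[OF t sg_regular(1)[OF sol] weak1 sg_position_equicontinuous[OF sol t] \<Phi> \<phi>])
  qed
  moreover have "(LINT x|lborel. f t x * wave_odd (deriv \<phi>) (T - t) x - sin (f t x) * wave_odd \<Phi> (T - t) x)
      = (LINT x|lborel. f t x * wave_odd (deriv \<phi>) (T - t) x) - (LINT x|lborel. sin (f t x) * wave_odd \<Phi> (T - t) x)"
    using sg_regular(1)[OF sol t]
    by (intro Bochner_Integration.integral_diff integrable_mult_test locally_integrable_sin
        test_wave_odd[OF \<Phi> \<phi>] test_wave_odd[OF d2 test_function_deriv[OF test_function_deriv[OF \<phi>]]])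
  ultimately show ?thesis by simp
qed

text \<open>Duhamel's formula tested against a nonnegative \<open>\<phi>\<close>. Iterating this gain of a factor \<open>1 / 2\<close>,
  starting from \<open>\<bar>sin a - sin b\<bar> \<le> 2\<close>, gives uniqueness.\<close>

lemma sg_difference_bound:
  assumes f: "sine_gordon_solution g1 g2 f ft" and F: "sine_gordon_solution g1 g2 F Ft"
    and S: "0 < S" and "0 \<le> B" and T: "0 \<le> T" "T \<le> S"
    and bound: "\<And>t. 0 \<le> t \<Longrightarrow> t \<le> S \<Longrightarrow>
      AE x in lborel. \<bar>sin (f t x) - sin (F t x)\<bar> \<le> B * exp (2 * S * t)"
  shows "AE x in lborel. \<bar>f T x - F T x\<bar> \<le> B / 2 * exp (2 * S * T)"
proof -
  define c where "c = B / 2 * exp (2 * S * T)"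
  have li: "locally_integrable (f T)" "locally_integrable (F T)" "locally_integrable (\<lambda>_. c)"
    using sg_regular f F T by (auto intro!: locally_integrable_continuous)
  have key: "\<bar>(LINT x|lborel. f T x * \<phi> x) - (LINT x|lborel. F T x * \<phi> x)\<bar> \<le> c * (LINT x|lborel. \<phi> x)"
    if \<phi>: "test_function \<phi>" and nonneg: "\<And>x. 0 \<le> \<phi> x" for \<phi>
  proof -
    obtain \<Phi> where \<Phi>: "\<And>x. (\<Phi> has_real_derivative \<phi> x) (at x)"
      using test_function_antideriv[OF \<phi>] by blast
    have mono: "\<Phi> x \<le> \<Phi> y" if "x \<le> y" for x y
      using that by (rule DERIV_nonneg_imp_nondecreasing) (use \<Phi> nonneg in blast)
    define P where "P = (LINT x|lborel. \<phi> x)"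
    have "0 \<le> P" unfolding P_def using nonneg by simp
    define H where "H u v \<tau> = (LINT x|lborel. v \<tau> x * wave_odd \<Phi> (T - \<tau>) x)
             + (LINT x|lborel. u \<tau> x * wave_even \<phi> (T - \<tau>) x)" for u v and \<tau> :: real
    \<comment> \<open>The rate 2 * S is chosen so that the comparison function has derivative B * S
      * exp (2 * S * t) * P; as T - t <= S, this dominates the source term, and integrating in time
      leaves the factor 1 / 2.\<close>
    have "\<bar>(H f ft T - H F Ft T) - (H f ft 0 - H F Ft 0)\<bar> \<le> B / 2 * exp (2 * S * T) * P - B / 2 * exp (2 * S * 0) * P"
    proof (rule abs_diff_le_if_deriv_bound[where G="\<lambda>t. H f ft t - H F Ft t" and
          h="\<lambda>t. B / 2 * exp (2 * S * t) * P", OF order_refl T(1)])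
      fix t assume t: "0 \<le> t" "t \<le> T"
      note test = test_wave_odd[OF \<Phi> \<phi>, of "T - t"]
      show "((\<lambda>t. H f ft t - H F Ft t) has_real_derivative
          (- (LINT x|lborel. sin (f t x) * wave_odd \<Phi> (T - t) x))
           - (- (LINT x|lborel. sin (F t x) * wave_odd \<Phi> (T - t) x))) (at t within {0..})"
        unfolding H_def
        by (rule DERIV_diff[OF sg_wave_pairing[OF f t(1) \<Phi> \<phi>] sg_wave_pairing[OF F t(1) \<Phi> \<phi>]])
      show "((\<lambda>t. B / 2 * exp (2 * S * t) * P) has_real_derivative (B * exp (2 * S * t)) * (S * P)) (at t)"
        by (auto intro!: derivative_eq_intros)
      have sl: "locally_integrable (\<lambda>x. sin (f t x))" "locally_integrable (\<lambda>x. sin (F t x))"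
        using sg_regular f F t by (auto intro!: locally_integrable_sin)
      \<comment> \<open>\<Phi> is nondecreasing because \<phi> is nonnegative. This positivity lets
        an a.e. bound on the nonlinearity pass through the pairing.\<close>
      have w0: "0 \<le> wave_odd \<Phi> (T - t) x" for x
        using mono[of "x - (T - t)" "x + (T - t)"] t by (simp add: wave_odd_def)
      have "\<bar>(- (LINT x|lborel. sin (f t x) * wave_odd \<Phi> (T - t) x))
           - (- (LINT x|lborel. sin (F t x) * wave_odd \<Phi> (T - t) x))\<bar>
        = norm (LINT x|lborel. (sin (f t x) - sin (F t x)) * wave_odd \<Phi> (T - t) x)"
        using sl test by (simp add: left_diff_distrib integrable_mult_test)
      also have "\<dots> \<le> (LINT x|lborel. norm ((sin (f t x) - sin (F t x)) * wave_odd \<Phi> (T - t) x))"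
        by (rule integral_norm_bound)
      also have "\<dots> \<le> (LINT x|lborel. B * exp (2 * S * t) * wave_odd \<Phi> (T - t) x)"
      proof (rule integral_mono_AE)
        show "integrable lborel (\<lambda>x. norm ((sin (f t x) - sin (F t x)) * wave_odd \<Phi> (T - t) x))"
          using sl test by (intro integrable_norm integrable_mult_test locally_integrable_diff)
        show "integrable lborel (\<lambda>x. B * exp (2 * S * t) * wave_odd \<Phi> (T - t) x)"
          using test by (intro integrable_mult_test locally_integrable_continuous continuous_intros)
        show "AE x in lborel. norm ((sin (f t x) - sin (F t x)) * wave_odd \<Phi> (T - t) x)
            \<le> B * exp (2 * S * t) * wave_odd \<Phi> (T - t) x"
          using bound[of t] t T
          by (auto elim!: eventually_mono simp: abs_mult w0 intro!: mult_right_mono)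
      qed
      also have "\<dots> = B * exp (2 * S * t) * ((T - t) * P)"
        using integral_wave_odd[OF \<Phi> \<phi>] t by (simp add: P_def)
      also have "\<dots> \<le> B * exp (2 * S * t) * (S * P)"
        using \<open>0 \<le> B\<close> \<open>0 \<le> P\<close> t T by (intro mult_left_mono mult_right_mono) auto
      finally show "\<bar>(- (LINT x|lborel. sin (f t x) * wave_odd \<Phi> (T - t) x))
           - (- (LINT x|lborel. sin (F t x) * wave_odd \<Phi> (T - t) x))\<bar> \<le> B * exp (2 * S * t) * (S * P)" .
    qed
    moreover have "H f ft 0 = H F Ft 0"
    proof -
      have "AE x in lborel. f 0 x = F 0 x" "AE x in lborel. ft 0 x = Ft 0 x"
        using f F unfolding sine_gordon_solution_def by (auto elim: AE_mp)
      moreover have "wave_odd \<Phi> T \<in> borel_measurable borel" "wave_even \<phi> T \<in> borel_measurable borel"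
        using test_wave_odd[OF \<Phi> \<phi>] test_wave_even[OF \<phi>]
        by (auto intro!: borel_measurable_continuous_onI test_function_continuous)
      moreover have "f 0 \<in> borel_measurable borel" "F 0 \<in> borel_measurable borel"
        "ft 0 \<in> borel_measurable borel" "Ft 0 \<in> borel_measurable borel"
        using sg_regular f F by (auto intro!: locally_integrable_measurable)
      ultimately show ?thesis
        unfolding H_def by (intro arg_cong2[where f="(+)"] integral_cong_AE) (auto elim: eventually_mono)
    qed
    moreover have "H f ft T = (LINT x|lborel. f T x * \<phi> x)" "H F Ft T = (LINT x|lborel. F T x * \<phi> x)"
      by (auto simp: H_def)
    moreover have "0 \<le> B / 2 * exp (2 * S * 0) * P" using \<open>0 \<le> B\<close> \<open>0 \<le> P\<close> by simp
    ultimately show ?thesis unfolding c_def P_def by linarith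
  qed
  have "AE x in lborel. 0 \<le> c - (f T x - F T x)"
  proof (rule AE_nonneg_if_test_nonneg)
    show "locally_integrable (\<lambda>x. c - (f T x - F T x))"
      using li by (intro locally_integrable_diff)
    show "0 \<le> (LINT x|lborel. (c - (f T x - F T x)) * \<phi> x)" if "test_function \<phi>" "\<And>x. 0 \<le> \<phi> x" for \<phi>
      using key[OF that] integrable_mult_test[OF li(1) that(1)] integrable_mult_test[OF li(2) that(1)]
        integrable_mult_test[OF li(3) that(1)]
      by (simp add: left_diff_distrib)
  qed
  moreover have "AE x in lborel. 0 \<le> c - (F T x - f T x)"
  proof (rule AE_nonneg_if_test_nonneg)
    show "locally_integrable (\<lambda>x. c - (F T x - f T x))"
      using li by (intro locally_integrable_diff)
    show "0 \<le> (LINT x|lborel. (c - (F T x - f T x)) * \<phi> x)" if "test_function \<phi>" "\<And>x. 0 \<le> \<phi> x" for \<phi>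
      using key[OF that] integrable_mult_test[OF li(1) that(1)] integrable_mult_test[OF li(2) that(1)]
        integrable_mult_test[OF li(3) that(1)]
      by (simp add: left_diff_distrib)
  qed
  ultimately show ?thesis
    unfolding c_def by eventually_elim linarith
qed

text \<open>For positions, each round of the iteration halves the bound, and the countably many
  exceptional null sets are merged before the limit is taken. For velocities nothing more has to be
  estimated: both are the weak time derivative of the same curve of positions.\<close>

lemma sg_unique:
  assumes f: "sine_gordon_solution g1 g2 f ft" and F: "sine_gordon_solution g1 g2 F Ft" and t: "0 \<le> t"
  shows "AE x in lborel. f t x = F t x" "AE x in lborel. ft t x = Ft t x"
proof -
  have eq: "AE x in lborel. f t x = F t x" if "0 \<le> t" for t
  proof -
    \<comment> \<open>One horizon serves all rounds, so the rate 2 * S never changes; the summand 1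
      keeps it positive for t = 0. Each round needs the preceding bound at all earlier times, hence
      the quantifier over \<open>T\<close>.\<close>
    define S where "S = t + 1"
    have S: "0 < S" "t \<le> S" using that by (auto simp: S_def)
    have sin_bound: "\<forall>T. 0 \<le> T \<longrightarrow> T \<le> S \<longrightarrow>
        (AE x in lborel. \<bar>sin (f T x) - sin (F T x)\<bar> \<le> 2 * (1/2) ^ n * exp (2 * S * T))" for n
    proof (induction n)
      case 0
      show ?case
      proof (intro allI impI AE_I2)
        fix T x assume "0 \<le> T" "T \<le> S"
        then have "1 \<le> exp (2 * S * T)" using S by simp
        moreover have "\<bar>sin (f T x) - sin (F T x)\<bar> \<le> 2"
          using abs_sin_le_one[of "f T x"] abs_sin_le_one[of "F T x"] by linarith
        ultimately show "\<bar>sin (f T x) - sin (F T x)\<bar> \<le> 2 * (1/2) ^ 0 * exp (2 * S * T)"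
          unfolding power_0 by linarith
      qed
    next
      case (Suc n)
      have lip: "\<bar>sin a - sin b\<bar> \<le> \<bar>a - b\<bar>" for a b :: real
        using field_differentiable_bound[of UNIV sin cos 1 a b]
        by (simp add: has_field_derivative_at_within)
      show ?case
      proof (intro allI impI)
        fix T assume T: "0 \<le> T" "T \<le> S"
        have "AE x in lborel. \<bar>f T x - F T x\<bar> \<le> (2 * (1/2) ^ n) / 2 * exp (2 * S * T)"
          using Suc.IH by (intro sg_difference_bound[OF f F S(1) _ T]) auto
        then show "AE x in lborel. \<bar>sin (f T x) - sin (F T x)\<bar> \<le> 2 * (1/2) ^ Suc n * exp (2 * S * T)"
          by eventually_elim (use lip order_trans in fastforce)
      qed
    qed
    have "AE x in lborel. \<bar>f t x - F t x\<bar> \<le> (2 * (1/2) ^ n) / 2 * exp (2 * S * t)" for n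
      using sin_bound[of n] S that by (intro sg_difference_bound[OF f F S(1)]) auto
    then have "AE x in lborel. \<forall>n. \<bar>f t x - F t x\<bar> \<le> (2 * (1/2) ^ n) / 2 * exp (2 * S * t)"
      unfolding AE_all_countable by blast
    then show ?thesis
    proof eventually_elim
      case (elim x)
      have lim: "(\<lambda>n. (2 * (1/2::real) ^ n) / 2 * exp (2 * S * t)) \<longlonglongrightarrow> (2 * 0) / 2 * exp (2 * S * t)"
        by (intro tendsto_intros LIMSEQ_power_zero) auto
      have "\<bar>f t x - F t x\<bar> \<le> (2 * 0) / 2 * exp (2 * S * t)"
        by (rule LIMSEQ_le_const[OF lim]) (use elim in blast)
      then show ?case by simp
    qed
  qed
  show "AE x in lborel. f t x = F t x" by (rule eq[OF t])
  show "AE x in lborel. ft t x = Ft t x"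
  proof (rule AE_eq_if_test_eq)
    show "locally_integrable (ft t)" "locally_integrable (Ft t)"
      using sg_regular f F t by auto
    fix \<phi> assume \<phi>: "test_function \<phi>"
    have same: "(LINT x|lborel. f \<tau> x * \<phi> x) = (LINT x|lborel. F \<tau> x * \<phi> x)" if "\<tau> \<in> {0..}" for \<tau>
    proof (rule integral_cong_AE)
      have "\<phi> \<in> borel_measurable borel"
        using \<phi> by (intro borel_measurable_continuous_onI test_function_continuous)
      moreover have "f \<tau> \<in> borel_measurable borel" "F \<tau> \<in> borel_measurable borel"
        using sg_regular f F that by (auto intro!: locally_integrable_measurable)
      ultimately show "(\<lambda>x. f \<tau> x * \<phi> x) \<in> borel_measurable lborel" "(\<lambda>x. F \<tau> x * \<phi> x) \<in> borel_measurable lborel"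
        by auto
      show "AE x in lborel. f \<tau> x * \<phi> x = F \<tau> x * \<phi> x"
        using eq[of \<tau>] that by (auto elim: eventually_mono)
    qed
    have 1: "((\<lambda>\<tau>. LINT x|lborel. F \<tau> x * \<phi> x) has_real_derivative (LINT x|lborel. ft t x * \<phi> x)) (at t within {0..})"
    proof (rule has_field_derivative_transform_within[of _ _ _ _ 1])
      show "((\<lambda>\<tau>. LINT x|lborel. f \<tau> x * \<phi> x) has_real_derivative (LINT x|lborel. ft t x * \<phi> x)) (at t within {0..})"
        using f \<phi> t by (auto simp: sine_gordon_solution_def)
    qed (use same t in auto)
    have 2: "((\<lambda>\<tau>. LINT x|lborel. F \<tau> x * \<phi> x) has_real_derivative (LINT x|lborel. Ft t x * \<phi> x)) (at t within {0..})"
      using F \<phi> t by (auto simp: sine_gordon_solution_def)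
    \<comment> \<open>Derivatives relative to the half line are unique only if this filter is
      proper; at time 0 only the right neighbourhood is available.\<close>
    have "at t within {0..} \<noteq> bot"
    proof -
      have "at_right t \<le> at t within {0..}"
        using t by (intro at_le) auto
      then show ?thesis
        using trivial_limit_at_right_real[of t] by (auto simp: bot_unique)
    qed
    then show "(LINT x|lborel. ft t x * \<phi> x) = (LINT x|lborel. Ft t x * \<phi> x)"
      using tendsto_unique 1 2 unfolding has_field_derivative_iff by blast
  qed
qed

section \<open>Weighted norms and integrals with parameters\<close>

lemma abs_sinh_le_cosh: "\<bar>sinh x\<bar> \<le> cosh (x :: real)"
  using sinh_le_cosh_real[of "\<bar>x\<bar>"] by simp

lemma cosh_mono_abs: "\<bar>x\<bar> \<le> \<bar>y\<bar> \<Longrightarrow> cosh x \<le> cosh (y :: real)"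
  using cosh_real_nonneg_le_iff[of "\<bar>x\<bar>" "\<bar>y\<bar>"] by simp

text \<open>Replaces hyperbolic decay by polynomial decay. The square of the resulting bound absorbs
  one factor 1 + y^2 from the weight and still leaves the integrable 1 / (1 + y^2), whose integral
  is known.\<close>

lemma cosh_ge_square: "(1 + y\<^sup>2) / 2 \<le> cosh (y :: real)"
proof -
  have "cosh y = 1 + 2 * (sinh (y / 2))\<^sup>2"
    using cosh_double[of "y / 2"] cosh_square_eq[of "y / 2"] by simp
  moreover have "(y / 2)\<^sup>2 \<le> (sinh (y / 2))\<^sup>2"
    unfolding sinh_field_def exp_minus abs_le_square_iff[symmetric] by (rule real_le_abs_sinh)
  ultimately show ?thesis by (simp add: power_divide)
qed

lemma integral_inverse_1_plus_square:
  shows "integrable lborel (\<lambda>x::real. inverse (1 + x\<^sup>2))"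
    and "(LINT x::real|lborel. inverse (1 + x\<^sup>2)) = pi"
  using integrable_inverse_1_plus_square LBINT_inverse_1_plus_square
  by (simp_all add: set_integrable_def interval_lebesgue_integral_def set_lebesgue_integral_def einterval_eq_UNIV)

text \<open>Rescales the weight to the width 1 / b of the breather: 1 + x^2 is at most b^(-2) times
  1 + (b x)^2. The power \<open>s\<close> is then applied, and lowered to a plain factor by s <=
  1.\<close>

lemma jbracket_powr_le:
  assumes "0 < b" "b \<le> 1" "0 \<le> s" "s \<le> 1"
  shows "(jbracket x powr s)\<^sup>2 \<le> b powr (- 2 * s) * (1 + (b * x)\<^sup>2)"
proof -
  have pos: "0 < 1 + x\<^sup>2" "1 \<le> 1 + (b * x)\<^sup>2" by (simp_all add: add_pos_nonneg)
  have "(jbracket x powr s)\<^sup>2 = ((jbracket x)\<^sup>2) powr s"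
    using jbracket_pos[of x] by (simp add: power2_eq_square powr_mult)
  also have "(jbracket x)\<^sup>2 = 1 + x\<^sup>2" using pos by (simp add: jbracket_def)
  also have "(1 + x\<^sup>2) powr s \<le> (inverse (b\<^sup>2) * (1 + (b * x)\<^sup>2)) powr s"
  proof (rule powr_mono2)
    have "b\<^sup>2 \<le> 1" using assms by (simp add: power_le_one)
    then show "1 + x\<^sup>2 \<le> inverse (b\<^sup>2) * (1 + (b * x)\<^sup>2)"
      using \<open>0 < b\<close> by (simp add: field_simps)
  qed (use assms pos in auto)
  also have "\<dots> = inverse (b\<^sup>2) powr s * (1 + (b * x)\<^sup>2) powr s"
    by (rule powr_mult)
  also have "inverse (b\<^sup>2) powr s = b powr (- 2 * s)"
  proof -
    have "inverse (b\<^sup>2) = b powr (- 2)"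
      using \<open>0 < b\<close> by (simp add: powr_minus powr_numeral)
    then show ?thesis by (simp add: powr_powr)
  qed
  also have "b powr (- 2 * s) * (1 + (b * x)\<^sup>2) powr s \<le> b powr (- 2 * s) * (1 + (b * x)\<^sup>2) powr 1"
    using pos assms by (intro mult_left_mono powr_mono) auto
  finally show ?thesis using pos by simp
qed

text \<open>A profile of height \<open>k\<close> and width 1 / b has squared norm of order k^2 *
  b^(-2 s) * b^(-1): the weight at distance 1 / b, times the width. With \<open>k\<close> of order
  \<open>b\<close> this is the exponent 1 / 2 - s of smallness. The bound is required only a.e. so
  that weak derivatives qualify.\<close>

lemma L2w_sech_bound:
  assumes b: "0 < b" "b \<le> 1" and s: "0 \<le> s" "s \<le> 1"
    and g: "g \<in> borel_measurable borel" and bound: "AE x in lborel. \<bar>g x\<bar> \<le> k / cosh (b * x)" and "0 \<le> k"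
  shows "g \<in> L2w s" "L2w_norm s g \<le> 4 * k * b powr (- (s + 1 / 2))"
proof -
  define w where "w x = 4 * k\<^sup>2 * b powr (- 2 * s) * inverse (1 + (b * x)\<^sup>2)" for x
  have wi: "integrable lborel w"
    unfolding w_def using lborel_integrable_real_affine[OF integral_inverse_1_plus_square(1), of b 0] b
    by (intro integrable_mult_right) simp
  have wI: "(LINT x|lborel. w x) = 4 * k\<^sup>2 * b powr (- 2 * s) * (pi / b)"
  proof -
    have "(LINT x|lborel. inverse (1 + (b * x)\<^sup>2)) = pi / b"
      using lborel_integral_real_affine[of b "\<lambda>x. inverse (1 + x\<^sup>2)" 0] b integral_inverse_1_plus_square(2)
      by (simp add: field_simps)
    then show ?thesis by (simp add: w_def)
  qed
  have le: "AE x in lborel. (jbracket x powr s * g x)\<^sup>2 \<le> w x"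
    using bound
  proof eventually_elim
    case (elim x)
    define y where "y = 1 + (b * x)\<^sup>2"
    have y: "0 < y" by (simp add: y_def add_pos_nonneg)
    have "(g x)\<^sup>2 \<le> (k / cosh (b * x))\<^sup>2"
      using elim \<open>0 \<le> k\<close> by (simp add: abs_le_square_iff[symmetric])
    also have "\<dots> \<le> (k / (y / 2))\<^sup>2"
      using y cosh_ge_square[of "b * x"] \<open>0 \<le> k\<close> by (intro power_mono divide_left_mono) (auto simp: y_def)
    finally have gx: "(g x)\<^sup>2 \<le> (k / (y / 2))\<^sup>2" .
    have "(jbracket x powr s * g x)\<^sup>2 \<le> (b powr (- 2 * s) * y) * (k / (y / 2))\<^sup>2"
      unfolding power_mult_distrib using jbracket_powr_le[OF b s, of x] gx y
      by (intro mult_mono) (auto simp: y_def)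
    also have "\<dots> = w x"
    proof -
      have "w x = 4 * k\<^sup>2 * b powr (- 2 * s) * inverse y" by (simp only: w_def y_def)
      then show ?thesis using y by (simp add: field_simps power2_eq_square)
    qed
    finally show ?case .
  qed
  have jm: "(\<lambda>x. jbracket x powr s) \<in> borel_measurable borel"
    unfolding jbracket_def by measurable
  have int: "integrable lborel (\<lambda>x. (jbracket x powr s * g x)\<^sup>2)"
  proof (rule Bochner_Integration.integrable_bound[OF wi])
    show "(\<lambda>x. (jbracket x powr s * g x)\<^sup>2) \<in> borel_measurable lborel"
      using jm g by simp
    show "AE x in lborel. norm ((jbracket x powr s * g x)\<^sup>2) \<le> norm (w x)"
      using le by eventually_elim simp
  qed
  then show "g \<in> L2w s" using g by (simp add: L2w_def)
  have "(LINT x|lborel. (jbracket x powr s * g x)\<^sup>2) \<le> (LINT x|lborel. w x)"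
    by (rule integral_mono_AE[OF int wi le])
  also have "\<dots> = 4 * k\<^sup>2 * b powr (- 2 * s) * (pi / b)" by (rule wI)
  \<comment> \<open>Rounding pi up to 4 makes the constant a perfect square.\<close>
  also have "\<dots> \<le> 4 * k\<^sup>2 * b powr (- 2 * s) * (4 / b)"
    using b pi_less_4 by (intro mult_left_mono divide_right_mono) auto
  also have "\<dots> = (4 * k * b powr (- (s + 1 / 2)))\<^sup>2"
  proof -
    have "(b powr (- (s + 1 / 2)))\<^sup>2 = b powr (- (s + 1 / 2) + - (s + 1 / 2))"
      by (simp only: power2_eq_square powr_add)
    also have "- (s + 1 / 2) + - (s + 1 / 2) = - 2 * s - 1" by simp
    also have "b powr (- 2 * s - 1) = b powr (- 2 * s) / b"
      using b by (simp only: powr_diff powr_one less_imp_le)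
    finally show ?thesis
      by (simp only: power_mult_distrib) simp
  qed
  finally show "L2w_norm s g \<le> 4 * k * b powr (- (s + 1 / 2))"
    unfolding L2w_norm_def using \<open>0 \<le> k\<close> by (intro real_le_lsqrt) auto
qed

lemma L2w_norm_cong_AE:
  assumes "f \<in> borel_measurable borel" "g \<in> borel_measurable borel" "AE x in lborel. f x = g x"
  shows "L2w_norm s f = L2w_norm s g"
proof -
  have jm: "(\<lambda>x. jbracket x powr s) \<in> borel_measurable borel"
    unfolding jbracket_def by measurable
  have "(LINT x|lborel. (jbracket x powr s * f x)\<^sup>2) = (LINT x|lborel. (jbracket x powr s * g x)\<^sup>2)"
    using assms jm by (intro integral_cong_AE) (auto elim: eventually_mono)
  then show ?thesis by (simp add: L2w_norm_def)
qed

text \<open>Dominated convergence along sequences, with the square of the sech envelope as the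
  majorant.\<close>

lemma L2w_norm_tendsto_0:
  fixes g :: "real \<Rightarrow> real \<Rightarrow> real"
  assumes b: "0 < b" "b \<le> 1" and "0 \<le> k"
    and g: "\<And>\<tau>. g \<tau> \<in> borel_measurable borel" "\<And>\<tau> x. \<bar>g \<tau> x\<bar> \<le> k / cosh (b * x)"
    and lim: "\<And>x. ((\<lambda>\<tau>. g \<tau> x) \<longlongrightarrow> 0) (at t within S)"
  shows "((\<lambda>\<tau>. L2w_norm 0 (g \<tau>)) \<longlongrightarrow> 0) (at t within S)"
  unfolding tendsto_at_iff_sequentially
proof (intro allI impI)
  fix X :: "nat \<Rightarrow> real"
  assume X: "\<forall>i. X i \<in> S - {t}" "X \<longlonglongrightarrow> t"
  have "(\<lambda>i. LINT x|lborel. (g (X i) x)\<^sup>2) \<longlonglongrightarrow> (LINT x::real|lborel. 0)"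
  proof (rule integral_dominated_convergence)
    have "(\<lambda>x. k / cosh (b * x)) \<in> borel_measurable borel"
      by (intro borel_measurable_continuous_onI continuous_intros) auto
    then have "(\<lambda>x. k / cosh (b * x)) \<in> L2w 0"
      using \<open>0 \<le> k\<close> by (intro L2w_sech_bound(1)[OF b, of 0 _ k]) auto
    then show "integrable lborel (\<lambda>x. (k / cosh (b * x))\<^sup>2)"
      by (simp add: L2w_0_iff)
    show "AE x in lborel. (\<lambda>i. (g (X i) x)\<^sup>2) \<longlonglongrightarrow> 0"
    proof (intro AE_I2)
      fix x
      have "((\<lambda>\<tau>. g \<tau> x) \<circ> X) \<longlonglongrightarrow> 0"
        using lim[of x] X unfolding tendsto_at_iff_sequentially by blast
      from tendsto_power[OF this, of 2] show "(\<lambda>i. (g (X i) x)\<^sup>2) \<longlonglongrightarrow> 0"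
        by (simp add: o_def)
    qed
    show "AE x in lborel. norm ((g (X i) x)\<^sup>2) \<le> (k / cosh (b * x))\<^sup>2" for i
      using g(2)[of "X i"] \<open>0 \<le> k\<close> by (intro AE_I2) (simp add: abs_le_square_iff[symmetric])
  qed (use g in auto)
  then have "(\<lambda>i. sqrt (LINT x|lborel. (g (X i) x)\<^sup>2)) \<longlonglongrightarrow> sqrt (LINT x::real|lborel. 0)"
    by (rule tendsto_real_sqrt)
  then show "((\<lambda>\<tau>. L2w_norm 0 (g \<tau>)) \<circ> X) \<longlonglongrightarrow> 0"
    by (simp add: L2w_norm_0 o_def)
qed

text \<open>Compact support of \<phi> turns the Lebesgue integral over the line into a gauge
  integral over a fixed box, where the Leibniz rule needs only continuity of the time
  derivative.\<close>

lemma has_deriv_integral_mult_test: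
  fixes g g' :: "real \<Rightarrow> real \<Rightarrow> real"
  assumes g: "\<And>t x. ((\<lambda>t. g t x) has_real_derivative g' t x) (at t)"
    and gc: "\<And>t. continuous_on UNIV (g t)" and g'c: "continuous_on UNIV (\<lambda>(t, x). g' t x)"
    and \<phi>: "test_function \<phi>"
  shows "((\<lambda>t. LINT x|lborel. g t x * \<phi> x) has_real_derivative (LINT x|lborel. g' t x * \<phi> x)) (at t)"
proof -
  obtain R where R: "0 < R" "\<And>x. \<bar>x\<bar> > R \<Longrightarrow> \<phi> x = 0"
    using test_function_support[OF \<phi>] by blast
  have \<phi>c: "continuous_on S \<phi>" for S by (rule test_function_continuous[OF \<phi>])
  have eq: "(LINT x|lborel. h x * \<phi> x) = integral (cbox (-R) R) (\<lambda>x. h x * \<phi> x)"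
    if "continuous_on UNIV h" for h :: "real \<Rightarrow> real"
  proof -
    have "(LINT x|lborel. h x * \<phi> x) = (LINT x:{-R..R}|lborel. h x * \<phi> x)"
      unfolding set_lebesgue_integral_def
    proof (intro Bochner_Integration.integral_cong refl)
      show "h x * \<phi> x = indicator {-R..R} x *\<^sub>R (h x * \<phi> x)" for x
        using R(2)[of x] by (cases "\<bar>x\<bar> > R") (auto simp: indicator_def)
    qed
    also have "\<dots> = integral {-R..R} (\<lambda>x. h x * \<phi> x)"
      using that \<phi>c
      by (intro set_borel_integral_eq_integral borel_integrable_atLeastAtMost' continuous_on_mult)
         (auto intro: continuous_on_subset)
    finally show ?thesis by simp
  qed
  have g'c1: "continuous_on UNIV (g' t)" for t
  proof -
    have "continuous_on UNIV (\<lambda>x. (\<lambda>(t, x). g' t x) (t, x))"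
      by (rule continuous_on_compose2[OF g'c]) (intro continuous_intros, simp)
    then show ?thesis by simp
  qed
  have "((\<lambda>t. integral (cbox (-R) R) (\<lambda>x. g t x * \<phi> x)) has_real_derivative
      integral (cbox (-R) R) (\<lambda>x. g' t x * \<phi> x)) (at t within UNIV)"
  proof (rule leibniz_rule_field_derivative)
    show "((\<lambda>t. g t x * \<phi> x) has_real_derivative g' t x * \<phi> x) (at t within UNIV)" for t x
      using g by (auto intro!: derivative_eq_intros)
    show "(\<lambda>x. g t x * \<phi> x) integrable_on cbox (-R) R" for t
      using gc \<phi>c by (intro integrable_continuous continuous_on_mult) (auto intro: continuous_on_subset)
    show "continuous_on (UNIV \<times> cbox (-R) R) (\<lambda>(t, x). g' t x * \<phi> x)"
      unfolding split_beta
    proof (intro continuous_on_mult)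
      show "continuous_on (UNIV \<times> cbox (-R) R) (\<lambda>z. g' (fst z) (snd z))"
        using g'c unfolding split_beta by (rule continuous_on_subset) auto
      show "continuous_on (UNIV \<times> cbox (-R) R) (\<lambda>z. \<phi> (snd z))"
        by (rule continuous_on_compose2[OF \<phi>c[of UNIV]]) (auto intro: continuous_intros)
    qed
  qed auto
  then show ?thesis
    by (simp add: eq[OF gc] eq[OF g'c1])
qed

lemma continuous_on_slice:
  fixes g :: "real \<Rightarrow> real \<Rightarrow> real"
  assumes "continuous_on UNIV (\<lambda>(t, x). g t x)"
  shows "continuous_on S (g t)"
proof -
  have "continuous_on S (\<lambda>x. (\<lambda>(t, x). g t x) (t, x))"
    by (rule continuous_on_compose2[OF assms]) (intro continuous_intros, simp)
  then show ?thesis by simp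
qed

lemma sin_dist_le_sum:
  "sin_dist s f g \<le> L2w_norm s (\<lambda>x. sin ((fst f x - fst g x) / 2))
     + L2w_norm s (weak_deriv (\<lambda>x. fst f x - fst g x)) + L2w_norm s (\<lambda>x. snd f x - snd g x)"
proof -
  have n: "0 \<le> L2w_norm s h" for h
    by (simp add: L2w_norm_def)
  have "sqrt (p\<^sup>2 + q\<^sup>2 + r\<^sup>2) \<le> p + q + r" if "0 \<le> p" "0 \<le> q" "0 \<le> r" for p q r :: real
  proof (rule real_le_lsqrt)
    have "0 \<le> p * q" "0 \<le> p * r" "0 \<le> q * r" using that by auto
    then show "p\<^sup>2 + q\<^sup>2 + r\<^sup>2 \<le> (p + q + r)\<^sup>2"
      by (simp add: power2_eq_square algebra_simps)
  qed (use that in auto)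
  then show ?thesis unfolding sin_dist_def using n by blast
qed

lemma kink_has_deriv_x:
  "(kink v y t has_real_derivative
     4 * exp ((x - v * t + y) / sqrt (1 - v\<^sup>2)) / (1 + (exp ((x - v * t + y) / sqrt (1 - v\<^sup>2)))\<^sup>2) / sqrt (1 - v\<^sup>2)) (at x)"
  unfolding kink_def by (auto intro!: derivative_eq_intros simp: divide_inverse)

text \<open>The factor depending on \<open>x\<close> is positive, so whatever the trajectory does,
  the sign on the whole line is that of D - v.\<close>

lemma kink_has_deriv_t:
  assumes "(xk has_real_derivative D) (at t)"
  shows "((\<lambda>\<tau>. kink v (xk \<tau>) \<tau> x) has_real_derivative
     4 * exp ((x - v * t + xk t) / sqrt (1 - v\<^sup>2)) / (1 + (exp ((x - v * t + xk t) / sqrt (1 - v\<^sup>2)))\<^sup>2)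
       * ((D - v) / sqrt (1 - v\<^sup>2))) (at t)"
  unfolding kink_def using assms by (auto intro!: derivative_eq_intros simp: divide_inverse)

lemma set_integrable_continuous:
  fixes f :: "real \<Rightarrow> real"
  assumes "continuous_on UNIV f"
  shows "set_integrable lborel {a<..<b} f"
  using borel_integrable_atLeastAtMost'[OF continuous_on_subset[OF assms], of a b]
  by (rule set_integrable_subset) auto

lemma set_integral_square_pos:
  fixes f :: "real \<Rightarrow> real"
  assumes f: "continuous_on UNIV f" and "a < b" and nz: "\<And>x. a < x \<Longrightarrow> x < b \<Longrightarrow> f x \<noteq> 0"
  shows "0 < (LINT x:{a<..<b}|lborel. (f x)\<^sup>2)"
proof -
  have int: "integrable lborel (\<lambda>x. indicator {a<..<b} x *\<^sub>R (f x)\<^sup>2)"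
    using set_integrable_continuous[of "\<lambda>x. (f x)\<^sup>2" a b] f
    by (simp add: set_integrable_def continuous_on_power)
  have "(LINT x|lborel. indicator {a<..<b} x *\<^sub>R (f x)\<^sup>2) \<noteq> 0"
  proof
    assume "(LINT x|lborel. indicator {a<..<b} x *\<^sub>R (f x)\<^sup>2) = 0"
    then have "AE x in lborel. indicator {a<..<b} x *\<^sub>R (f x)\<^sup>2 = 0"
      using integral_nonneg_eq_0_iff_AE[OF int] by simp
    then have "AE x in lborel. x \<notin> {a<..<b}"
      by eventually_elim (use nz in \<open>auto simp: indicator_def split: if_splits\<close>)
    then have "emeasure lborel {a<..<b} = 0"
      by (subst (asm) AE_iff_measurable[of "{a<..<b}"]) auto
    then show False using \<open>a < b\<close> by simp
  qed
  moreover have "0 \<le> (LINT x|lborel. indicator {a<..<b} x *\<^sub>R (f x)\<^sup>2)"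
    by (intro integral_nonneg_AE AE_I2) simp
  ultimately show ?thesis unfolding set_lebesgue_integral_def by linarith
qed

section \<open>The kink-breather solution\<close>

text \<open>With \<theta> the sum of the two angles, sin \<theta> and cos \<theta> are E + h and 1 -
  E * h over a common root. Working with these two instead of tan \<theta> allows 1 - E * h = 0,
  which does occur for the kink-breather.\<close>

lemma sin_4_arctan_add:
  fixes E h :: real
  shows "sin (4 * arctan E + 4 * arctan h) =
    4 * (E + h) * (1 - E * h) * ((1 - E * h)\<^sup>2 - (E + h)\<^sup>2) / ((1 + E\<^sup>2) * (1 + h\<^sup>2))\<^sup>2"
proof -
  define \<theta> where "\<theta> = arctan E + arctan h"
  define r where "r = sqrt (1 + E\<^sup>2) * sqrt (1 + h\<^sup>2)"
  have pos: "0 < 1 + E\<^sup>2" "0 < 1 + h\<^sup>2" by (simp_all add: add_pos_nonneg)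
  then have r: "r\<^sup>2 = (1 + E\<^sup>2) * (1 + h\<^sup>2)" "r \<noteq> 0"
    by (simp_all add: r_def power_mult_distrib)
  have s: "sin \<theta> = (E + h) / r" and c: "cos \<theta> = (1 - E * h) / r"
    using pos by (simp_all add: \<theta>_def r_def sin_add cos_add sin_arctan cos_arctan field_simps)
  have "sin (4 * \<theta>) = 2 * sin (2 * \<theta>) * cos (2 * \<theta>)"
    using sin_double[of "2 * \<theta>"] by simp
  also have "\<dots> = 4 * sin \<theta> * cos \<theta> * ((cos \<theta>)\<^sup>2 - (sin \<theta>)\<^sup>2)"
    using sin_double[of \<theta>] cos_double[of \<theta>] by simp
  also have "\<dots> = 4 * (E + h) * (1 - E * h) * ((1 - E * h)\<^sup>2 - (E + h)\<^sup>2) / (r\<^sup>2)\<^sup>2"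
    using r(2) by (simp add: s c field_simps power2_eq_square)
  finally show ?thesis
    unfolding r(1) by (simp add: \<theta>_def algebra_simps)
qed

text \<open>In this group of identities \<open>C\<close>, \<open>S\<close>, \<open>Cb\<close>,
  \<open>Sb\<close> stand for cosh x, sinh x, cosh (b x), sinh (b x), and \<open>c\<close> for the
  cosine of the phase. Treated as indeterminates tied by the hyperbolic relations, they leave
  polynomial identities. The common factor \<open>C\<close> found here cancels against the same
  factor in the numerators of both derivatives of the angle.\<close>

lemma wobble_norm_identity:
  fixes b c C S Cb Sb :: real
  assumes "S\<^sup>2 = C\<^sup>2 - 1" "Sb\<^sup>2 = Cb\<^sup>2 - 1"
  shows "(- b * (Sb + c * S))\<^sup>2 + (C * Cb - b * S * Sb + b * c)\<^sup>2 =
    C * (C * (Cb\<^sup>2 + b\<^sup>2 * Sb\<^sup>2 + b\<^sup>2 * c\<^sup>2) - 2 * b * S * Cb * Sb + 2 * b * c * Cb)"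
  using assms by algebra

text \<open>Adds the space derivative 2 / cosh x of the kink to that of the perturbation, with
  denominators cleared; the factor \<open>C\<close> splits off and \<open>slope\<close>
  remains.\<close>

lemma wobble_space_identity:
  fixes b c C S Cb Sb :: real
  assumes "S\<^sup>2 = C\<^sup>2 - 1" "Sb\<^sup>2 = Cb\<^sup>2 - 1"
  shows "(C * (Cb\<^sup>2 + b\<^sup>2 * Sb\<^sup>2 + b\<^sup>2 * c\<^sup>2) - 2 * b * S * Cb * Sb + 2 * b * c * Cb) +
     2 * ((- b * (b * Cb + c * C)) * (C * Cb - b * S * Sb + b * c)
          - (- b * (Sb + c * S)) * ((1 - b\<^sup>2) * S * Cb)) =
    2 * C * ((Cb\<^sup>2 - b\<^sup>2 * Sb\<^sup>2 - 2 * b\<^sup>2 - b\<^sup>2 * c\<^sup>2) / 2 + b * c * (b * S * Sb - b\<^sup>2 * C * Cb))"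
proof -
  have "2 * ((Cb\<^sup>2 - b\<^sup>2 * Sb\<^sup>2 - 2 * b\<^sup>2 - b\<^sup>2 * c\<^sup>2) / 2 + b * c * (b * S * Sb - b\<^sup>2 * C * Cb)) =
    (Cb\<^sup>2 - b\<^sup>2 * Sb\<^sup>2 - 2 * b\<^sup>2 - b\<^sup>2 * c\<^sup>2) + 2 * b * c * (b * S * Sb - b\<^sup>2 * C * Cb)"
    by simp
  moreover have "(C * (Cb\<^sup>2 + b\<^sup>2 * Sb\<^sup>2 + b\<^sup>2 * c\<^sup>2) - 2 * b * S * Cb * Sb + 2 * b * c * Cb) +
     2 * ((- b * (b * Cb + c * C)) * (C * Cb - b * S * Sb + b * c)
          - (- b * (Sb + c * S)) * ((1 - b\<^sup>2) * S * Cb)) =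
    C * ((Cb\<^sup>2 - b\<^sup>2 * Sb\<^sup>2 - 2 * b\<^sup>2 - b\<^sup>2 * c\<^sup>2) + 2 * b * c * (b * S * Sb - b\<^sup>2 * C * Cb))"
    using assms by algebra
  ultimately show ?thesis by (simp only: mult.assoc mult.left_commute[of 2])
qed

lemma wobble_time_identity:
  fixes b c C S Cb Sb :: real
  assumes "S\<^sup>2 = C\<^sup>2 - 1"
  shows "- b * S * (C * Cb - b * S * Sb + b * c) - (- b * (Sb + c * S)) * b = C * (b * (b * C * Sb - S * Cb))"
  using assms by algebra

text \<open>The sine-Gordon equation multiplied by the square of the denominator \<open>M\<close>.
  The letters \<open>m\<close> and \<open>Mx\<close> are the derivatives of \<open>M\<close> in the
  phase variable and in space, \<open>Ux\<close> is the space derivative of \<open>U\<close>, and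
  \<open>K\<close> is the numerator of the sine. The factors (1 - b^2) * c and (1 - b^2) * (1 - c^2)
  are what minus the second derivative and the squared first derivative of c = cos (freq * t)
  become.\<close>

lemma wobble_equation_identity:
  fixes b c C S Cb Sb M m Mx U Ux v K :: real
  assumes "Sb\<^sup>2 = Cb\<^sup>2 - 1"
    and M: "M = C * (Cb\<^sup>2 + b\<^sup>2 * Sb\<^sup>2 + b\<^sup>2 * c\<^sup>2) - 2 * b * S * Cb * Sb + 2 * b * c * Cb"
    and U: "U = (Cb\<^sup>2 - b\<^sup>2 * Sb\<^sup>2 - 2 * b\<^sup>2 - b\<^sup>2 * c\<^sup>2) / 2 + b * c * (b * S * Sb - b\<^sup>2 * C * Cb)"
    and v: "v = b * (b * C * Sb - S * Cb)"
    and m: "m = 2 * b\<^sup>2 * c * C + 2 * b * Cb"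
    and Ux: "Ux = b * (1 - b\<^sup>2) * Cb * Sb + b\<^sup>2 * c * (1 - b\<^sup>2) * C * Sb"
    and Mx: "Mx = S * (Cb\<^sup>2 + b\<^sup>2 * Sb\<^sup>2 + b\<^sup>2 * c\<^sup>2 - 2 * b\<^sup>2 * Sb\<^sup>2 - 2 * b\<^sup>2 * Cb\<^sup>2)
              + 2 * b ^ 3 * C * Sb * Cb + 2 * b\<^sup>2 * c * Sb"
    and K: "K = (Cb\<^sup>2 - b\<^sup>2 * Sb\<^sup>2 + b\<^sup>2 * c\<^sup>2 + b * c * (2 * C * Cb - 2 * b * S * Sb)) *
      (4 * b * C * Cb * Sb - 2 * S * (Cb\<^sup>2 + b\<^sup>2 * Sb\<^sup>2 - b\<^sup>2 * c\<^sup>2) + 4 * b\<^sup>2 * c * Sb)"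
  shows "4 * ((- (1 - b\<^sup>2) * c * v * M - (1 - b\<^sup>2) * (1 - c\<^sup>2) * v * m) - (Ux * M - U * Mx)) + K = 0"
    (is "?e = 0")
proof -
  \<comment> \<open>the quotient of the left-hand side by \<open>Sb\<^sup>2 - Cb\<^sup>2 + 1\<close>, found by polynomial division\<close>
  define R where "R = 8 * b ^ 6 * c * C\<^sup>2 * Sb - 8 * b ^ 5 * c * C * S * Cb - 4 * b ^ 4 * c\<^sup>2 * S
    - 8 * b ^ 4 * c * C\<^sup>2 * Sb - 8 * b ^ 4 * c * Sb + 4 * b ^ 4 * S * Sb\<^sup>2 + 8 * b ^ 3 * c * C * S * Cb
    - 8 * b ^ 3 * C * Cb * Sb + 4 * b\<^sup>2 * S * Cb\<^sup>2"
  define U2 where "U2 = (Cb\<^sup>2 - b\<^sup>2 * Sb\<^sup>2 - 2 * b\<^sup>2 - b\<^sup>2 * c\<^sup>2) + 2 * b * c * (b * S * Sb - b\<^sup>2 * C * Cb)"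
  have "2 * U = U2" by (simp add: U U2_def)
  then have "?e = 2 * (2 * ((- (1 - b\<^sup>2) * c * v * M - (1 - b\<^sup>2) * (1 - c\<^sup>2) * v * m) - Ux * M) + U2 * Mx) + K"
    by (simp add: algebra_simps flip: \<open>2 * U = U2\<close>)
  also have "\<dots> = R * (Sb\<^sup>2 - Cb\<^sup>2 + 1)"
    unfolding R_def M v m Ux Mx K U2_def by algebra
  finally show ?thesis using assms(1) by simp
qed

text \<open>\<open>E\<close> is exp x, and \<open>F\<close>, \<open>G\<close> are the three-soliton
  functions. The kink and the perturbation combine by the addition formula into one angle with
  tangent G / F, up to the common factor \<open>C\<close>; the quadruple-angle formula then produces
  F * G * (F^2 - G^2), and \<open>K\<close> is this product without the factor E^2.\<close>

lemma wobble_sin_identity: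
  fixes b c E Cb Sb D N M K :: real
  assumes E: "0 < E" and C: "2 * E * C = E\<^sup>2 + 1" and S: "2 * E * S = E\<^sup>2 - 1"
    and D: "D = C * Cb - b * S * Sb + b * c" and N: "N = - b * (Sb + c * S)"
    and "D \<noteq> 0" "M \<noteq> 0" and M: "N\<^sup>2 + D\<^sup>2 = C * M"
    and K: "K = (Cb\<^sup>2 - b\<^sup>2 * Sb\<^sup>2 + b\<^sup>2 * c\<^sup>2 + b * c * (2 * C * Cb - 2 * b * S * Sb)) *
      (4 * b * C * Cb * Sb - 2 * S * (Cb\<^sup>2 + b\<^sup>2 * Sb\<^sup>2 - b\<^sup>2 * c\<^sup>2) + 4 * b\<^sup>2 * c * Sb)"
  shows "sin (4 * arctan E + 4 * arctan (N / D)) = K / M\<^sup>2"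
proof -
  define h where "h = N / D"
  define F where "F = Cb + b * Sb + b * c * E"
  define G where "G = E * (Cb - b * Sb) + b * c"
  have "C \<noteq> 0" using C E by (metis add_pos_pos mult_zero_right not_less_iff_gr_or_eq zero_less_one zero_less_power)
  have 1: "D - E * N = F * C"
  proof -
    have "2 * E * (D - E * N) = 2 * E * (F * C)"
      unfolding D N F_def using C S by algebra
    then show ?thesis using E by simp
  qed
  have 2: "E * D + N = G * C"
  proof -
    have "2 * E * (E * D + N) = 2 * E * (G * C)"
      unfolding D N G_def using C S by algebra
    then show ?thesis using E by simp
  qed
  have 3: "F * G * (F\<^sup>2 - G\<^sup>2) = E\<^sup>2 * K"
  proof -
    have "F * G = E * (Cb\<^sup>2 - b\<^sup>2 * Sb\<^sup>2 + b\<^sup>2 * c\<^sup>2 + b * c * (2 * C * Cb - 2 * b * S * Sb))"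
      unfolding F_def G_def using C S by algebra
    moreover have "F\<^sup>2 - G\<^sup>2 = E * (4 * b * C * Cb * Sb - 2 * S * (Cb\<^sup>2 + b\<^sup>2 * Sb\<^sup>2 - b\<^sup>2 * c\<^sup>2) + 4 * b\<^sup>2 * c * Sb)"
      unfolding F_def G_def using C S by algebra
    ultimately show ?thesis unfolding K by (simp add: power2_eq_square)
  qed
  have e: "E + h = G * C / D" "1 - E * h = F * C / D" "1 + h\<^sup>2 = C * M / D\<^sup>2" "1 + E\<^sup>2 = 2 * E * C"
    using 1 2 M C \<open>D \<noteq> 0\<close> by (simp_all add: h_def field_simps)
  have "sin (4 * arctan E + 4 * arctan h) =
      4 * (G * C / D) * (F * C / D) * ((F * C / D)\<^sup>2 - (G * C / D)\<^sup>2) / ((2 * E * C) * (C * M / D\<^sup>2))\<^sup>2"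
    unfolding sin_4_arctan_add e ..
  also have "\<dots> = (F * G * (F\<^sup>2 - G\<^sup>2)) / (E\<^sup>2 * M\<^sup>2)"
    using \<open>D \<noteq> 0\<close> \<open>C \<noteq> 0\<close> \<open>M \<noteq> 0\<close> E by (simp add: field_simps power2_eq_square)
  also have "\<dots> = K / M\<^sup>2" unfolding 3 using E by simp
  finally show ?thesis by (simp add: h_def)
qed

lemma arctan_quotient_has_deriv:
  fixes N D :: "real \<Rightarrow> real"
  assumes N: "(N has_real_derivative N') (at x within S)" and D: "(D has_real_derivative D') (at x within S)"
    and "D x \<noteq> 0"
  shows "((\<lambda>x. arctan (N x / D x)) has_real_derivative (N' * D x - N x * D') / ((N x)\<^sup>2 + (D x)\<^sup>2)) (at x within S)"
proof -
  have "((\<lambda>x. arctan (N x / D x)) has_real_derivative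
      inverse (1 + (N x / D x)\<^sup>2) * ((N' * D x - N x * D') / (D x * D x))) (at x within S)"
    using DERIV_chain2[OF DERIV_arctan DERIV_divide[OF N D \<open>D x \<noteq> 0\<close>]] .
  moreover have "1 + (N x / D x)\<^sup>2 = ((N x)\<^sup>2 + (D x)\<^sup>2) / (D x * D x)"
    using \<open>D x \<noteq> 0\<close> by (simp add: field_simps power2_eq_square)
  ultimately show ?thesis using \<open>D x \<noteq> 0\<close> by simp
qed

text \<open>The bound 1 / 4 makes \<open>den\<close> at least half its leading term cosh x * cosh (b
  * x): each of the two correction terms costs at most a quarter of it.\<close>

locale wobbling =
  fixes b :: real
  assumes b_pos: "0 < b" and b_le: "b \<le> 1 / 4"
begin

text \<open>The kink-breather solution is \<open>4 * arctan (G / F)\<close> with the three-soliton functions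
  \<open>F = cosh (b * x) + b * sinh (b * x) + b * c * exp x\<close> and
  \<open>G = exp x * (cosh (b * x) - b * sinh (b * x)) + b * c\<close>, where \<open>c = cos (sqrt (1 - b\<^sup>2) * t)\<close>. As \<open>F\<close> vanishes
  somewhere when \<open>c < 0\<close>, the kink is split off by the subtraction formula
  \<open>arctan (G / F) - arctan (exp x) = arctan (num / den)\<close>, where \<open>den > 0\<close>. In these terms
  \<open>F\<^sup>2 + G\<^sup>2 = 2 * exp x * quo\<close>, and the space and time derivatives of the angle are
  \<open>slope / quo\<close> and \<open>vel / quo\<close> (times the derivative of \<open>c\<close>).\<close>

definition num :: "real \<Rightarrow> real \<Rightarrow> real" where
  "num c x = - b * (sinh (b * x) + c * sinh x)"

definition den :: "real \<Rightarrow> real \<Rightarrow> real" where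
  "den c x = cosh x * cosh (b * x) - b * sinh x * sinh (b * x) + b * c"

definition num_x :: "real \<Rightarrow> real \<Rightarrow> real" where
  "num_x c x = - b * (b * cosh (b * x) + c * cosh x)"

definition den_x :: "real \<Rightarrow> real" where
  "den_x x = (1 - b\<^sup>2) * sinh x * cosh (b * x)"

definition quo :: "real \<Rightarrow> real \<Rightarrow> real" where
  "quo c x = cosh x * ((cosh (b * x))\<^sup>2 + b\<^sup>2 * (sinh (b * x))\<^sup>2 + b\<^sup>2 * c\<^sup>2)
     - 2 * b * sinh x * cosh (b * x) * sinh (b * x) + 2 * b * c * cosh (b * x)"

definition quo_c :: "real \<Rightarrow> real \<Rightarrow> real" where
  "quo_c c x = 2 * b\<^sup>2 * c * cosh x + 2 * b * cosh (b * x)"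

definition quo_x :: "real \<Rightarrow> real \<Rightarrow> real" where
  "quo_x c x = sinh x * ((cosh (b * x))\<^sup>2 + b\<^sup>2 * (sinh (b * x))\<^sup>2 + b\<^sup>2 * c\<^sup>2
       - 2 * b\<^sup>2 * (sinh (b * x))\<^sup>2 - 2 * b\<^sup>2 * (cosh (b * x))\<^sup>2)
     + 2 * b ^ 3 * cosh x * sinh (b * x) * cosh (b * x) + 2 * b\<^sup>2 * c * sinh (b * x)"

definition slope :: "real \<Rightarrow> real \<Rightarrow> real" where
  "slope c x = ((cosh (b * x))\<^sup>2 - b\<^sup>2 * (sinh (b * x))\<^sup>2 - 2 * b\<^sup>2 - b\<^sup>2 * c\<^sup>2) / 2
     + b * c * (b * sinh x * sinh (b * x) - b\<^sup>2 * cosh x * cosh (b * x))"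

definition slope_x :: "real \<Rightarrow> real \<Rightarrow> real" where
  "slope_x c x = b * (1 - b\<^sup>2) * cosh (b * x) * sinh (b * x) + b\<^sup>2 * c * (1 - b\<^sup>2) * cosh x * sinh (b * x)"

text \<open>Independent of the phase: at every time the velocity of the solution is this odd profile
  times a function of time, divided by the positive even function \<open>quo\<close>.\<close>

definition vel :: "real \<Rightarrow> real" where
  "vel x = b * (b * cosh x * sinh (b * x) - sinh x * cosh (b * x))"

text \<open>A breather at rest with spatial decay rate \<open>b\<close> has this frequency: the two
  squares add up to 1.\<close>

definition freq :: real where "freq = sqrt (1 - b\<^sup>2)"

definition ph :: "real \<Rightarrow> real" where "ph t = cos (freq * t)"

definition ph' :: "real \<Rightarrow> real" where "ph' t = - freq * sin (freq * t)"

definition pert :: "real \<Rightarrow> real \<Rightarrow> real" where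
  "pert t x = 4 * arctan (num (ph t) x / den (ph t) x)"

definition pert_x :: "real \<Rightarrow> real \<Rightarrow> real" where
  "pert_x t x = 4 * ((num_x (ph t) x * den (ph t) x - num (ph t) x * den_x x) / ((num (ph t) x)\<^sup>2 + (den (ph t) x)\<^sup>2))"

definition sol :: "real \<Rightarrow> real \<Rightarrow> real" where
  "sol t x = 4 * arctan (exp x) + pert t x"

definition sol_x :: "real \<Rightarrow> real \<Rightarrow> real" where
  "sol_x t x = 4 * (slope (ph t) x / quo (ph t) x)"

definition sol_xx :: "real \<Rightarrow> real \<Rightarrow> real" where
  "sol_xx t x = 4 * ((slope_x (ph t) x * quo (ph t) x - slope (ph t) x * quo_x (ph t) x) / (quo (ph t) x)\<^sup>2)"

definition sol_t :: "real \<Rightarrow> real \<Rightarrow> real" where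
  "sol_t t x = 4 * (ph' t * vel x / quo (ph t) x)"

definition sol_tt :: "real \<Rightarrow> real \<Rightarrow> real" where
  "sol_tt t x = 4 * ((- (freq\<^sup>2) * ph t * vel x * quo (ph t) x - ph' t * vel x * (ph' t * quo_c (ph t) x)) / (quo (ph t) x)\<^sup>2)"

section \<open>Lower bounds for the denominators and sech envelopes\<close>

lemma b_sq: "b\<^sup>2 \<le> 1 / 16" "b\<^sup>2 < 1"
proof -
  have "b\<^sup>2 \<le> (1 / 4)\<^sup>2" using b_pos b_le by (intro power_mono) auto
  then show "b\<^sup>2 \<le> 1 / 16" "b\<^sup>2 < 1" by (auto simp: power2_eq_square)
qed

lemma freq_sq: "freq\<^sup>2 = 1 - b\<^sup>2" and freq_pos: "0 < freq" and freq_le: "freq \<le> 1"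
  using b_sq by (auto simp: freq_def)

lemma abs_ph: "\<bar>ph t\<bar> \<le> 1" and abs_ph': "\<bar>ph' t\<bar> \<le> 1"
  using freq_pos freq_le abs_sin_le_one[of "freq * t"]
  by (auto simp: ph_def ph'_def abs_mult intro: mult_le_one)

lemma ph'_sq: "ph' t * ph' t = (1 - b\<^sup>2) * (1 - (ph t)\<^sup>2)"
proof -
  have "ph' t * ph' t = freq\<^sup>2 * (sin (freq * t))\<^sup>2"
    by (simp add: ph'_def power2_eq_square)
  then show ?thesis by (simp add: freq_sq ph_def sin_squared_eq)
qed

lemma ph_deriv: "(ph has_real_derivative ph' t) (at t)"
  unfolding ph_def ph'_def by (auto intro!: derivative_eq_intros)

lemma ph'_deriv: "(ph' has_real_derivative - (freq\<^sup>2) * ph t) (at t)"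
  unfolding ph_def ph'_def by (auto intro!: derivative_eq_intros simp: power2_eq_square)

lemma cosh_b_le: "cosh (b * x) \<le> cosh x"
proof (rule cosh_mono_abs)
  have "\<bar>b\<bar> * \<bar>x\<bar> \<le> 1 * \<bar>x\<bar>" using b_pos b_le by (intro mult_right_mono) auto
  then show "\<bar>b * x\<bar> \<le> \<bar>x\<bar>" by (simp add: abs_mult)
qed

lemma abs_sinh_sinh_le: "\<bar>sinh x * sinh (b * x)\<bar> \<le> cosh x * cosh (b * x)"
  unfolding abs_mult by (intro mult_mono abs_sinh_le_cosh) auto

lemma den_ge:
  assumes "\<bar>c\<bar> \<le> 1"
  shows "cosh x * cosh (b * x) / 2 \<le> den c x"
proof -
  define p where "p = cosh x * cosh (b * x)"
  have p: "1 \<le> p" unfolding p_def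
    using cosh_real_ge_1[of x] cosh_real_ge_1[of "b * x"] mult_mono[of 1 "cosh x" 1 "cosh (b * x)"] by simp
  have "b * (sinh x * sinh (b * x)) \<le> b * p"
    using abs_sinh_sinh_le[of x] b_pos by (intro mult_left_mono) (auto simp: p_def)
  moreover have "b * (- p) \<le> b * c" using p assms b_pos by (intro mult_left_mono) auto
  moreover have "b * p \<le> (1 / 4) * p" using b_le p by (intro mult_right_mono) auto
  ultimately show ?thesis unfolding den_def p_def[symmetric] by (simp add: mult.assoc)
qed

lemma den_pos: "\<bar>c\<bar> \<le> 1 \<Longrightarrow> 0 < den c x"
  using den_ge[of c x] by (meson cosh_real_pos half_gt_zero mult_pos_pos order_less_le_trans)

lemma norm_eq: "(num c x)\<^sup>2 + (den c x)\<^sup>2 = cosh x * quo c x"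
  unfolding num_def den_def quo_def
  by (rule wobble_norm_identity) (simp_all add: cosh_square_eq)

text \<open>Positivity is not visible in the formula for \<open>quo\<close>. It comes from the norm
  identity, where cosh x * quo is a sum of squares containing the square of
  \<open>den\<close>.\<close>

lemma quo_ge:
  assumes "\<bar>c\<bar> \<le> 1"
  shows "cosh x * (cosh (b * x))\<^sup>2 / 4 \<le> quo c x"
proof -
  have "(cosh x * cosh (b * x) / 2)\<^sup>2 \<le> (den c x)\<^sup>2"
    using den_ge[OF assms] by (intro power_mono) auto
  also have "\<dots> \<le> cosh x * quo c x"
    unfolding norm_eq[symmetric] by simp
  finally have "cosh x * (cosh x * (cosh (b * x))\<^sup>2 / 4) \<le> cosh x * quo c x"
    by (simp add: power_mult_distrib power_divide power2_eq_square ac_simps)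
  then show ?thesis by (simp only: mult_le_cancel_left_pos cosh_real_pos)
qed

lemma quo_pos: "\<bar>c\<bar> \<le> 1 \<Longrightarrow> 0 < quo c x"
  by (rule less_le_trans[OF _ quo_ge]) simp_all

lemma abs_num_le:
  assumes "\<bar>c\<bar> \<le> 1"
  shows "\<bar>num c x\<bar> \<le> 2 * b * cosh x"
proof -
  have "\<bar>sinh (b * x) + c * sinh x\<bar> \<le> \<bar>sinh (b * x)\<bar> + \<bar>c\<bar> * \<bar>sinh x\<bar>"
    using abs_triangle_ineq[of "sinh (b * x)" "c * sinh x"] by (simp only: abs_mult)
  also have "\<bar>sinh (b * x)\<bar> \<le> cosh x"
    using abs_sinh_le_cosh[of "b * x"] cosh_b_le[of x] by linarith
  also have "\<bar>c\<bar> * \<bar>sinh x\<bar> \<le> 1 * cosh x"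
    using assms by (intro mult_mono abs_sinh_le_cosh) auto
  finally have "b * \<bar>sinh (b * x) + c * sinh x\<bar> \<le> b * (cosh x + 1 * cosh x)"
    using b_pos by (intro mult_left_mono) auto
  then show ?thesis using b_pos by (simp add: num_def abs_mult)
qed

lemma abs_num_x_le:
  assumes "\<bar>c\<bar> \<le> 1"
  shows "\<bar>num_x c x\<bar> \<le> 2 * b * cosh x"
proof -
  have "\<bar>b * cosh (b * x) + c * cosh x\<bar> \<le> b * cosh (b * x) + \<bar>c\<bar> * cosh x"
    using abs_triangle_ineq[of "b * cosh (b * x)" "c * cosh x"] b_pos by (simp add: abs_mult)
  also have "b * cosh (b * x) \<le> 1 * cosh x"
    using b_pos b_le cosh_b_le by (intro mult_mono) auto
  also have "\<bar>c\<bar> * cosh x \<le> 1 * cosh x"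
    using assms by (intro mult_right_mono) auto
  finally have "b * \<bar>b * cosh (b * x) + c * cosh x\<bar> \<le> b * (1 * cosh x + 1 * cosh x)"
    using b_pos by (intro mult_left_mono) auto
  then show ?thesis using b_pos by (simp add: num_x_def abs_mult)
qed

lemma abs_den_x_le: "\<bar>den_x x\<bar> \<le> cosh x * cosh (b * x)"
proof -
  have "\<bar>den_x x\<bar> = (1 - b\<^sup>2) * (\<bar>sinh x\<bar> * cosh (b * x))"
    using b_sq by (simp add: den_x_def abs_mult)
  also have "\<dots> \<le> 1 * (cosh x * cosh (b * x))"
    using b_sq by (intro mult_mono abs_sinh_le_cosh) auto
  finally show ?thesis by simp
qed

text \<open>The factor cosh x cancels and leaves the slow decay 1 / cosh (b * x). The number
  \<open>k\<close> may depend on \<open>x\<close>; for the derivative of \<open>den\<close> it is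
  cosh (b * x) itself.\<close>

lemma quotient_le:
  assumes "\<bar>c\<bar> \<le> 1" "\<bar>y\<bar> \<le> k * cosh x"
  shows "\<bar>y / den c x\<bar> \<le> 2 * k / cosh (b * x)"
proof -
  have k: "0 \<le> k * cosh x" using assms(2) by linarith
  have "\<bar>y / den c x\<bar> = \<bar>y\<bar> / den c x" using den_pos[OF assms(1), of x] by (simp add: abs_divide)
  also have "\<dots> \<le> (k * cosh x) / (cosh x * cosh (b * x) / 2)"
    using assms den_ge[OF assms(1), of x] k by (intro frac_le) auto
  also have "\<dots> = 2 * k / cosh (b * x)" by (simp add: field_simps)
  finally show ?thesis .
qed

lemma abs_pert_le: "\<bar>pert t x\<bar> \<le> 16 * b / cosh (b * x)"
proof -
  have "\<bar>arctan y\<bar> \<le> \<bar>y\<bar>" for y :: real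
    using field_differentiable_bound[of UNIV arctan "\<lambda>x. inverse (1 + x\<^sup>2)" 1 y 0]
    by (simp add: has_field_derivative_at_within[OF DERIV_arctan] inverse_le_1_iff)
  from this[of "num (ph t) x / den (ph t) x"]
  have "\<bar>arctan (num (ph t) x / den (ph t) x)\<bar> \<le> 2 * (2 * b) / cosh (b * x)"
    using quotient_le[OF abs_ph[of t] abs_num_le[OF abs_ph[of t], of x]] by (rule order_trans)
  then show ?thesis by (simp add: pert_def)
qed

text \<open>Without N^2 in the denominator the quotient is N' / D - (N / D) * (D' / D). The bounds 4
  b for N / D and N' / D, each over cosh (b * x), and 2 for D' / D give 12 b, and the factor 4 in
  front of the arctangent gives 48 b.\<close>

lemma abs_pert_x_le: "\<bar>pert_x t x\<bar> \<le> 48 * b / cosh (b * x)"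
proof -
  define N where "N = num (ph t) x"
  define D where "D = den (ph t) x"
  define N' where "N' = num_x (ph t) x"
  define D' where "D' = den_x x"
  have D: "0 < D" unfolding D_def by (rule den_pos[OF abs_ph])
  have n: "\<bar>N / D\<bar> \<le> 2 * (2 * b) / cosh (b * x)" "\<bar>N' / D\<bar> \<le> 2 * (2 * b) / cosh (b * x)"
    unfolding N_def D_def N'_def
    by (rule quotient_le[OF abs_ph abs_num_le[OF abs_ph]] quotient_le[OF abs_ph abs_num_x_le[OF abs_ph]])+
  have n': "\<bar>D' / D\<bar> \<le> 2 * cosh (b * x) / cosh (b * x)"
    unfolding D_def D'_def using abs_den_x_le[of x] by (intro quotient_le abs_ph) (simp only: mult.commute)
  have "\<bar>(N' * D - N * D') / (N\<^sup>2 + D\<^sup>2)\<bar> = \<bar>N' * D - N * D'\<bar> / (N\<^sup>2 + D\<^sup>2)"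
    by (simp add: abs_divide)
  also have "\<dots> \<le> \<bar>N' * D - N * D'\<bar> / D\<^sup>2"
    using D by (intro divide_left_mono) (auto intro!: mult_pos_pos add_nonneg_pos)
  also have "\<dots> = \<bar>N' / D - N / D * (D' / D)\<bar>"
    using D by (simp add: abs_divide[symmetric] abs_mult field_simps power2_eq_square flip: abs_power2)
  also have "\<dots> \<le> \<bar>N' / D\<bar> + \<bar>N / D\<bar> * \<bar>D' / D\<bar>"
    unfolding abs_mult[symmetric] by (rule abs_triangle_ineq4)
  also have "\<bar>N / D\<bar> * \<bar>D' / D\<bar> \<le> (2 * (2 * b) / cosh (b * x)) * 2"
    using n n' b_pos by (intro mult_mono) auto
  finally have "\<bar>(N' * D - N * D') / (N\<^sup>2 + D\<^sup>2)\<bar> \<le> 12 * b / cosh (b * x)"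
    using n(2) by simp
  then show ?thesis
    unfolding pert_x_def N_def[symmetric] D_def[symmetric] N'_def[symmetric] D'_def[symmetric]
    by (simp only: abs_mult)
qed

lemma abs_sol_t_le: "\<bar>sol_t t x\<bar> \<le> 32 * b / cosh (b * x)"
proof -
  have "\<bar>vel x\<bar> \<le> 2 * b * (cosh x * cosh (b * x))"
  proof -
    have "\<bar>b * cosh x * sinh (b * x) - sinh x * cosh (b * x)\<bar>
        \<le> \<bar>b * cosh x * sinh (b * x)\<bar> + \<bar>sinh x * cosh (b * x)\<bar>"
      by (rule abs_triangle_ineq4)
    also have "\<bar>b * cosh x * sinh (b * x)\<bar> = b * (cosh x * \<bar>sinh (b * x)\<bar>)"
      using b_pos by (simp add: abs_mult)
    also have "\<dots> \<le> 1 * (cosh x * cosh (b * x))"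
      using b_pos b_le by (intro mult_mono mult_left_mono abs_sinh_le_cosh) auto
    also have "\<bar>sinh x * cosh (b * x)\<bar> \<le> cosh x * cosh (b * x)"
      unfolding abs_mult by (intro mult_mono abs_sinh_le_cosh) auto
    finally have "b * \<bar>b * cosh x * sinh (b * x) - sinh x * cosh (b * x)\<bar> \<le>
        b * (1 * (cosh x * cosh (b * x)) + cosh x * cosh (b * x))"
      using b_pos by (intro mult_left_mono) auto
    then show ?thesis using b_pos by (simp add: vel_def abs_mult)
  qed
  then have "\<bar>ph' t\<bar> * \<bar>vel x\<bar> \<le> 1 * (2 * b * (cosh x * cosh (b * x)))"
    using abs_ph' by (intro mult_mono) auto
  then have "\<bar>ph' t\<bar> * \<bar>vel x\<bar> / quo (ph t) x \<le>
      (1 * (2 * b * (cosh x * cosh (b * x)))) / (cosh x * (cosh (b * x))\<^sup>2 / 4)"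
    using quo_ge[OF abs_ph, of x t] b_pos by (intro frac_le) auto
  also have "\<dots> = 8 * b / cosh (b * x)"
    by (simp add: field_simps power2_eq_square)
  finally show ?thesis
    using quo_pos[OF abs_ph, of t x] by (simp add: sol_t_def abs_mult abs_divide)
qed

section \<open>Derivatives of the solution and the sine-Gordon equation\<close>

lemma num_deriv_x: "(num c has_real_derivative num_x c x) (at x)"
  unfolding num_def num_x_def by (auto intro!: derivative_eq_intros simp: algebra_simps)

lemma den_deriv_x: "(den c has_real_derivative den_x x) (at x)"
  unfolding den_def den_x_def by (auto intro!: derivative_eq_intros simp: algebra_simps power2_eq_square)

lemma quo_deriv_x: "(quo c has_real_derivative quo_x c x) (at x)"
  unfolding quo_def quo_x_def
  by (auto intro!: derivative_eq_intros simp: algebra_simps power2_eq_square power3_eq_cube)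

lemma slope_deriv_x: "(slope c has_real_derivative slope_x c x) (at x)"
  unfolding slope_def slope_x_def
  by (auto intro!: derivative_eq_intros simp: field_simps power2_eq_square power3_eq_cube)

lemma pert_deriv_x: "(pert t has_real_derivative pert_x t x) (at x)"
  unfolding pert_def pert_x_def using den_pos[OF abs_ph, of t x]
  by (intro DERIV_cmult arctan_quotient_has_deriv num_deriv_x den_deriv_x) simp

lemma kink_deriv: "((\<lambda>x. 4 * arctan (exp x)) has_real_derivative 2 / cosh x) (at x)"
  by (auto intro!: derivative_eq_intros simp: cosh_field_def exp_minus field_simps power2_eq_square)

text \<open>Two forms of one derivative: the single fraction serves the equation, the sum serves the
  decay estimates and the comparison with the kink.\<close>

lemma sol_x_eq: "sol_x t x = 2 / cosh x + pert_x t x"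
proof -
  have "quo (ph t) x + 2 * (num_x (ph t) x * den (ph t) x - num (ph t) x * den_x x)
      = 2 * cosh x * slope (ph t) x"
    unfolding quo_def num_x_def den_def num_def den_x_def slope_def
    by (rule wobble_space_identity) (simp_all add: cosh_square_eq)
  then show ?thesis
    using quo_pos[OF abs_ph, of t x] unfolding sol_x_def pert_x_def norm_eq by (simp add: field_simps)
qed

lemma sol_deriv_x: "(sol t has_real_derivative sol_x t x) (at x)"
  unfolding sol_def sol_x_eq by (intro DERIV_add kink_deriv pert_deriv_x)

lemma sol_x_deriv_x: "(sol_x t has_real_derivative sol_xx t x) (at x)"
proof -
  have "(sol_x t has_real_derivative 4 * ((slope_x (ph t) x * quo (ph t) x - slope (ph t) x * quo_x (ph t) x) / (quo (ph t) x * quo (ph t) x))) (at x)"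
    unfolding sol_x_def using quo_pos[OF abs_ph, of t x]
    by (intro DERIV_cmult DERIV_divide slope_deriv_x quo_deriv_x) simp
  then show ?thesis by (simp add: sol_xx_def power2_eq_square)
qed

lemma sol_deriv_t: "((\<lambda>t. sol t x) has_real_derivative sol_t t x) (at t)"
proof -
  have "((\<lambda>t. num (ph t) x) has_real_derivative - b * sinh x * ph' t) (at t)"
    unfolding num_def by (auto intro!: derivative_eq_intros ph_deriv simp: algebra_simps)
  moreover have "((\<lambda>t. den (ph t) x) has_real_derivative b * ph' t) (at t)"
    unfolding den_def by (auto intro!: derivative_eq_intros ph_deriv)
  ultimately have d: "((\<lambda>t. 4 * arctan (exp x) + 4 * arctan (num (ph t) x / den (ph t) x)) has_real_derivative
      0 + 4 * (((- b * sinh x * ph' t) * den (ph t) x - num (ph t) x * (b * ph' t)) /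
        ((num (ph t) x)\<^sup>2 + (den (ph t) x)\<^sup>2))) (at t)"
    using den_pos[OF abs_ph, of t x] by (intro DERIV_add DERIV_const DERIV_cmult arctan_quotient_has_deriv) auto
  have e: "(- b * sinh x * ph' t) * den (ph t) x - num (ph t) x * (b * ph' t) = ph' t * (cosh x * vel x)"
  proof -
    have "- b * sinh x * den (ph t) x - num (ph t) x * b = cosh x * vel x"
      unfolding den_def num_def vel_def by (rule wobble_time_identity) (simp add: cosh_square_eq)
    moreover have "(- b * sinh x * ph' t) * den (ph t) x - num (ph t) x * (b * ph' t) =
        ph' t * (- b * sinh x * den (ph t) x - num (ph t) x * b)"
      by (simp add: algebra_simps)
    ultimately show ?thesis by (simp only:)
  qed
  show ?thesis
    using d unfolding e norm_eq sol_def pert_def sol_t_def by (simp add: mult.left_commute)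
qed

lemma sol_t_deriv_t: "((\<lambda>t. sol_t t x) has_real_derivative sol_tt t x) (at t)"
proof -
  have "((\<lambda>t. quo (ph t) x) has_real_derivative ph' t * quo_c (ph t) x) (at t)"
    unfolding quo_def quo_c_def
    by (auto intro!: derivative_eq_intros ph_deriv simp: algebra_simps power2_eq_square)
  moreover have "((\<lambda>t. ph' t * vel x) has_real_derivative - (freq\<^sup>2) * ph t * vel x) (at t)"
    by (auto intro!: derivative_eq_intros ph'_deriv)
  ultimately have "((\<lambda>t. 4 * (ph' t * vel x / quo (ph t) x)) has_real_derivative
      4 * ((- (freq\<^sup>2) * ph t * vel x * quo (ph t) x - ph' t * vel x * (ph' t * quo_c (ph t) x)) /
        (quo (ph t) x * quo (ph t) x))) (at t)"
    using quo_pos[OF abs_ph, of t x] by (intro DERIV_cmult DERIV_divide) auto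
  then show ?thesis by (simp add: sol_t_def sol_tt_def power2_eq_square)
qed

text \<open>The second time derivative contains the phase velocity only through its square, which is
  a polynomial in the phase; so the equation reduces to the polynomial identity over the square of
  \<open>quo\<close>.\<close>

lemma sol_equation: "sol_tt t x = sol_xx t x - sin (sol t x)"
proof -
  define K where "K = ((cosh (b * x))\<^sup>2 - b\<^sup>2 * (sinh (b * x))\<^sup>2 + b\<^sup>2 * (ph t)\<^sup>2
       + b * ph t * (2 * cosh x * cosh (b * x) - 2 * b * sinh x * sinh (b * x))) *
      (4 * b * cosh x * cosh (b * x) * sinh (b * x)
       - 2 * sinh x * ((cosh (b * x))\<^sup>2 + b\<^sup>2 * (sinh (b * x))\<^sup>2 - b\<^sup>2 * (ph t)\<^sup>2) + 4 * b\<^sup>2 * ph t * sinh (b * x))"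
  have quo: "quo (ph t) x \<noteq> 0" using quo_pos[OF abs_ph, of t x] by simp
  have "sin (sol t x) = K / (quo (ph t) x)\<^sup>2"
    unfolding sol_def pert_def
  proof (rule wobble_sin_identity[OF _ _ _ _ _ _ _ norm_eq K_def])
    show "den (ph t) x \<noteq> 0" using den_pos[OF abs_ph, of t x] by simp
  qed (use quo in \<open>auto simp: den_def num_def cosh_field_def sinh_field_def exp_minus field_simps power2_eq_square\<close>)
  moreover have "4 * ((- (1 - b\<^sup>2) * ph t * vel x * quo (ph t) x - (1 - b\<^sup>2) * (1 - (ph t)\<^sup>2) * vel x * quo_c (ph t) x)
      - (slope_x (ph t) x * quo (ph t) x - slope (ph t) x * quo_x (ph t) x)) + K = 0"
    by (rule wobble_equation_identity[OF _ quo_def slope_def vel_def quo_c_def slope_x_def quo_x_def K_def])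
       (simp add: cosh_square_eq)
  moreover have "- (freq\<^sup>2) * ph t * vel x * quo (ph t) x - ph' t * vel x * (ph' t * quo_c (ph t) x) =
      - (1 - b\<^sup>2) * ph t * vel x * quo (ph t) x - (1 - b\<^sup>2) * (1 - (ph t)\<^sup>2) * vel x * quo_c (ph t) x"
    unfolding freq_sq ph'_sq[of t, symmetric] by simp
  ultimately show ?thesis
    using quo unfolding sol_tt_def sol_xx_def by (simp add: field_simps)
qed

section \<open>Continuity and the position of the solution in the function spaces\<close>

lemma
  fixes f :: "'a::t2_space \<Rightarrow> real"
  shows continuous_on_ph: "continuous_on S f \<Longrightarrow> continuous_on S (\<lambda>z. ph (f z))"
  and continuous_on_ph': "continuous_on S f \<Longrightarrow> continuous_on S (\<lambda>z. ph' (f z))"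
  and continuous_on_vel: "continuous_on S f \<Longrightarrow> continuous_on S (\<lambda>z. vel (f z))"
  unfolding ph_def ph'_def vel_def by (auto intro!: continuous_intros)

lemma
  fixes f g :: "'a::t2_space \<Rightarrow> real"
  shows continuous_on_quo:
    "continuous_on S f \<Longrightarrow> continuous_on S g \<Longrightarrow> continuous_on S (\<lambda>z. quo (f z) (g z))"
  and continuous_on_quo_c:
    "continuous_on S f \<Longrightarrow> continuous_on S g \<Longrightarrow> continuous_on S (\<lambda>z. quo_c (f z) (g z))"
  and continuous_on_slope:
    "continuous_on S f \<Longrightarrow> continuous_on S g \<Longrightarrow> continuous_on S (\<lambda>z. slope (f z) (g z))"
  unfolding quo_def quo_c_def slope_def by (auto intro!: continuous_intros)

lemma quo_nonzero: "quo (ph t) x \<noteq> 0"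
  using quo_pos[OF abs_ph, of t x] by simp

lemma continuous_on_sol_t: "continuous_on UNIV (\<lambda>(t, x). sol_t t x)"
  unfolding split_beta sol_t_def
  by (intro continuous_intros continuous_on_ph continuous_on_ph' continuous_on_vel continuous_on_quo)
     (simp add: quo_nonzero)

lemma continuous_on_sol_tt: "continuous_on UNIV (\<lambda>(t, x). sol_tt t x)"
  unfolding split_beta sol_tt_def
  by (intro continuous_intros continuous_on_ph continuous_on_ph' continuous_on_vel continuous_on_quo continuous_on_quo_c)
     (simp add: quo_nonzero)

lemma continuous_on_sol: "continuous_on S (sol t)"
  and continuous_on_sol_x: "continuous_on S (sol_x t)"
  and continuous_on_pert: "continuous_on S (pert t)"
  by (rule DERIV_continuous_on[OF has_field_derivative_at_within[OF sol_deriv_x]]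
      DERIV_continuous_on[OF has_field_derivative_at_within[OF sol_x_deriv_x]]
      DERIV_continuous_on[OF has_field_derivative_at_within[OF pert_deriv_x]])+

lemma continuous_on_pert_x: "continuous_on S (pert_x t)"
proof -
  have "pert_x t = (\<lambda>x. sol_x t x - 2 / cosh x)" by (simp add: sol_x_eq)
  then show ?thesis
    by (simp only:) (intro continuous_intros continuous_on_sol_x, simp)
qed

text \<open>Read off from the equation, whose other terms are known to be continuous.\<close>

lemma continuous_on_sol_xx: "continuous_on S (sol_xx t)"
proof -
  have "sol_xx t = (\<lambda>x. sol_tt t x + sin (sol t x))" by (simp add: sol_equation)
  then show ?thesis
    by (simp only:) (intro continuous_intros continuous_on_sol continuous_on_slice[OF continuous_on_sol_tt])
qed

lemma sol_weak_deriv: "has_weak_deriv (sol t) (sol_x t)"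
  by (rule has_weak_deriv_if_C1[OF sol_deriv_x continuous_on_sol_x])

lemma pert_weak_deriv: "has_weak_deriv (pert t) (pert_x t)"
  by (rule has_weak_deriv_if_C1[OF pert_deriv_x continuous_on_pert_x])

lemma sol_diff_weak_deriv:
  "has_weak_deriv (\<lambda>x. sol \<tau> x - sol t x) (\<lambda>x. sol_x \<tau> x - sol_x t x)"
  by (rule has_weak_deriv_diff[OF sol_weak_deriv sol_weak_deriv])

lemma inverse_cosh_le: "0 \<le> k \<Longrightarrow> k / cosh x \<le> k / cosh (b * x)"
  using cosh_b_le[of x] by (intro divide_left_mono) auto

lemma abs_sol_x_le: "\<bar>sol_x t x\<bar> \<le> (2 + 48 * b) / cosh (b * x)"
proof -
  have "\<bar>sol_x t x\<bar> \<le> 2 / cosh x + \<bar>pert_x t x\<bar>"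
    using abs_triangle_ineq[of "2 / cosh x" "pert_x t x"] by (simp add: sol_x_eq)
  then show ?thesis
    using inverse_cosh_le[of 2 x] abs_pert_x_le[of t x] by (simp add: add_divide_distrib)
qed

text \<open>Half of the kink is 2 * arctan (exp x), whose sine is 1 / cosh x; the addition formula
  leaves half of the perturbation as the only other contribution.\<close>

lemma abs_sin_sol_le: "\<bar>sin (sol t x / 2)\<bar> \<le> (1 + 8 * b) / cosh (b * x)"
proof -
  define \<theta> where "\<theta> = arctan (exp x)"
  have "1 + (exp x)\<^sup>2 \<noteq> 0" by (simp add: add_pos_nonneg less_imp_neq[symmetric])
  then have sin\<theta>: "sin (2 * \<theta>) = 1 / cosh x"
    by (simp add: \<theta>_def sin_double sin_arctan cos_arctan cosh_field_def exp_minus field_simps power2_eq_square)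
  have "sin (sol t x / 2) = sin (2 * \<theta>) * cos (pert t x / 2) + cos (2 * \<theta>) * sin (pert t x / 2)"
    by (simp add: sol_def \<theta>_def sin_add[symmetric] add_divide_distrib)
  also have "\<bar>\<dots>\<bar> \<le> \<bar>sin (2 * \<theta>)\<bar> * \<bar>cos (pert t x / 2)\<bar> + \<bar>cos (2 * \<theta>)\<bar> * \<bar>sin (pert t x / 2)\<bar>"
    unfolding abs_mult[symmetric] by (rule abs_triangle_ineq)
  also have "\<dots> \<le> \<bar>sin (2 * \<theta>)\<bar> * 1 + 1 * \<bar>pert t x / 2\<bar>"
    using abs_sin_x_le_abs_x[of "pert t x / 2"] by (intro add_mono mult_mono) auto
  also have "\<dots> \<le> (1 + 8 * b) / cosh (b * x)"
    using inverse_cosh_le[of 1 x] abs_pert_le[of t x] by (simp add: sin\<theta> add_divide_distrib)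
  finally show ?thesis .
qed

lemma b_le_1: "b \<le> 1"
  using b_le by simp

lemma sol_in_H1sin:
  assumes "0 \<le> s" "s \<le> 1"
  shows "sol t \<in> H1sin s"
proof -
  have "(\<lambda>x. sin (sol t x / 2)) \<in> L2w s"
    using b_pos abs_sin_sol_le
    by (intro L2w_sech_bound(1)[OF b_pos b_le_1 assms, where k="1 + 8 * b"] borel_measurable_continuous_onI
        continuous_intros continuous_on_sol AE_I2) auto
  moreover have "weak_deriv (sol t) \<in> L2w s"
  proof (rule L2w_sech_bound(1)[OF b_pos b_le_1 assms, where k="2 + 48 * b"])
    show "AE x in lborel. \<bar>weak_deriv (sol t) x\<bar> \<le> (2 + 48 * b) / cosh (b * x)"
      using weak_deriv_AE[OF sol_weak_deriv[of t]] by eventually_elim (simp add: abs_sol_x_le)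
  qed (use b_pos weak_deriv_measurable[OF sol_weak_deriv[of t]] in auto)
  ultimately show ?thesis
    using sol_weak_deriv by (auto simp: H1sin_def)
qed

lemma sol_t_in_L2w:
  assumes "0 \<le> s" "s \<le> 1"
  shows "sol_t t \<in> L2w s"
  using b_pos abs_sol_t_le
  by (intro L2w_sech_bound(1)[OF b_pos b_le_1 assms, where k="32 * b"] borel_measurable_continuous_onI
      continuous_on_slice[OF continuous_on_sol_t] AE_I2) auto

text \<open>The kink cancels, and the phase starts at rest, so only the perturbation and its space
  derivative count: heights 8 b and 48 b with the factor 4 of the sech bound give 32 + 192 =
  224.\<close>

lemma sol_0_close:
  assumes s: "0 \<le> s" "s \<le> 1"
  shows "sin_dist s (sol 0, \<lambda>_. 0) (kink 0 0 0, \<lambda>_. 0) \<le> 224 * b powr (1 / 2 - s)"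
proof -
  have diff: "sol 0 x - kink 0 0 0 x = pert 0 x" for x
    by (simp add: sol_def kink_def)
  have "L2w_norm s (\<lambda>x. sin (pert 0 x / 2)) \<le> 4 * (8 * b) * b powr (- (s + 1 / 2))"
  proof (rule L2w_sech_bound(2)[OF b_pos b_le_1 s])
    show "(\<lambda>x. sin (pert 0 x / 2)) \<in> borel_measurable borel"
      by (intro borel_measurable_continuous_onI continuous_intros continuous_on_pert) auto
    show "AE x in lborel. \<bar>sin (pert 0 x / 2)\<bar> \<le> 8 * b / cosh (b * x)"
    proof (intro AE_I2)
      fix x
      have "\<bar>sin (pert 0 x / 2)\<bar> \<le> \<bar>pert 0 x / 2\<bar>" by (rule abs_sin_x_le_abs_x)
      then show "\<bar>sin (pert 0 x / 2)\<bar> \<le> 8 * b / cosh (b * x)"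
        using abs_pert_le[of 0 x] by simp
    qed
  qed (use b_pos in auto)
  moreover have "L2w_norm s (weak_deriv (pert 0)) \<le> 4 * (48 * b) * b powr (- (s + 1 / 2))"
  proof (rule L2w_sech_bound(2)[OF b_pos b_le_1 s])
    show "AE x in lborel. \<bar>weak_deriv (pert 0) x\<bar> \<le> 48 * b / cosh (b * x)"
      using weak_deriv_AE[OF pert_weak_deriv[of 0]] by eventually_elim (simp add: abs_pert_x_le)
  qed (use b_pos weak_deriv_measurable[OF pert_weak_deriv[of 0]] in auto)
  moreover have "L2w_norm s (\<lambda>x. 0) = 0"
    by (simp add: L2w_norm_def)
  ultimately have "sin_dist s (sol 0, \<lambda>_. 0) (kink 0 0 0, \<lambda>_. 0)
      \<le> 4 * (8 * b) * b powr (- (s + 1 / 2)) + 4 * (48 * b) * b powr (- (s + 1 / 2))"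
    using sin_dist_le_sum[of s "(sol 0, \<lambda>_. 0)" "(kink 0 0 0, \<lambda>_. 0)"] by (simp add: diff)
  also have "\<dots> = 224 * (b powr 1 * b powr (- (s + 1 / 2)))"
    using b_pos by simp
  also have "b powr 1 * b powr (- (s + 1 / 2)) = b powr (1 / 2 - s)"
    unfolding powr_add[symmetric] by simp
  finally show ?thesis .
qed

text \<open>The kink cancels in every difference in time, so twice the envelopes of the perturbation
  and the velocity are majorants (halved again inside the sine), and pointwise continuity in time
  suffices.\<close>

lemma sol_curve_continuous:
  "((\<lambda>\<tau>. sin_dist 0 (sol \<tau>, sol_t \<tau>) (sol t, sol_t t)) \<longlongrightarrow> 0) (at t within S)"
proof -
  have 1: "((\<lambda>\<tau>. L2w_norm 0 (\<lambda>x. sin ((sol \<tau> x - sol t x) / 2))) \<longlongrightarrow> 0) (at t within S)"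
  proof (rule L2w_norm_tendsto_0[OF b_pos b_le_1, where k="16 * b"])
    show "(\<lambda>x. sin ((sol \<tau> x - sol t x) / 2)) \<in> borel_measurable borel" for \<tau>
      by (intro borel_measurable_continuous_onI continuous_intros continuous_on_sol) auto
    show "\<bar>sin ((sol \<tau> x - sol t x) / 2)\<bar> \<le> 16 * b / cosh (b * x)" for \<tau> x
    proof -
      have "\<bar>sin ((sol \<tau> x - sol t x) / 2)\<bar> \<le> \<bar>(pert \<tau> x - pert t x) / 2\<bar>"
        using abs_sin_x_le_abs_x[of "(sol \<tau> x - sol t x) / 2"] by (simp add: sol_def)
      then show ?thesis
        using abs_pert_le[of \<tau> x] abs_pert_le[of t x] abs_triangle_ineq4[of "pert \<tau> x" "pert t x"] by simp
    qed
    show "((\<lambda>\<tau>. sin ((sol \<tau> x - sol t x) / 2)) \<longlongrightarrow> 0) (at t within S)" for x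
    proof -
      have "((\<lambda>\<tau>. sol \<tau> x) \<longlongrightarrow> sol t x) (at t)"
        using DERIV_isCont[OF sol_deriv_t[of x t]] by (simp add: isCont_def)
      then have "((\<lambda>\<tau>. sin ((sol \<tau> x - sol t x) / 2)) \<longlongrightarrow> sin ((sol t x - sol t x) / 2)) (at t)"
        by (intro tendsto_intros) simp_all
      from tendsto_within_subset[OF this subset_UNIV, of S] show ?thesis by simp
    qed
  qed (use b_pos in auto)
  have 2: "((\<lambda>\<tau>. L2w_norm 0 (\<lambda>x. sol_x \<tau> x - sol_x t x)) \<longlongrightarrow> 0) (at t within S)"
  proof (rule L2w_norm_tendsto_0[OF b_pos b_le_1, where k="96 * b"])
    show "(\<lambda>x. sol_x \<tau> x - sol_x t x) \<in> borel_measurable borel" for \<tau>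
      by (intro borel_measurable_continuous_onI continuous_intros continuous_on_sol_x)
    show "\<bar>sol_x \<tau> x - sol_x t x\<bar> \<le> 96 * b / cosh (b * x)" for \<tau> x
      using abs_pert_x_le[of \<tau> x] abs_pert_x_le[of t x] abs_triangle_ineq4[of "pert_x \<tau> x" "pert_x t x"]
      by (simp add: sol_x_eq)
    show "((\<lambda>\<tau>. sol_x \<tau> x - sol_x t x) \<longlongrightarrow> 0) (at t within S)" for x
    proof -
      have "continuous_on UNIV (\<lambda>\<tau>. sol_x \<tau> x - sol_x t x)"
        unfolding sol_x_def
        by (intro continuous_intros continuous_on_ph continuous_on_quo continuous_on_slope)
           (simp_all add: quo_nonzero)
      then have "((\<lambda>\<tau>. sol_x \<tau> x - sol_x t x) \<longlongrightarrow> sol_x t x - sol_x t x) (at t)"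
        unfolding continuous_on_def by blast
      from tendsto_within_subset[OF this subset_UNIV, of S] show ?thesis by simp
    qed
  qed (use b_pos in auto)
  have 3: "((\<lambda>\<tau>. L2w_norm 0 (\<lambda>x. sol_t \<tau> x - sol_t t x)) \<longlongrightarrow> 0) (at t within S)"
  proof (rule L2w_norm_tendsto_0[OF b_pos b_le_1, where k="64 * b"])
    show "(\<lambda>x. sol_t \<tau> x - sol_t t x) \<in> borel_measurable borel" for \<tau>
      by (intro borel_measurable_continuous_onI continuous_intros continuous_on_slice[OF continuous_on_sol_t])
    show "\<bar>sol_t \<tau> x - sol_t t x\<bar> \<le> 64 * b / cosh (b * x)" for \<tau> x
      using abs_sol_t_le[of \<tau> x] abs_sol_t_le[of t x] abs_triangle_ineq4[of "sol_t \<tau> x" "sol_t t x"]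
      by simp
    show "((\<lambda>\<tau>. sol_t \<tau> x - sol_t t x) \<longlongrightarrow> 0) (at t within S)" for x
    proof -
      have "((\<lambda>\<tau>. sol_t \<tau> x) \<longlongrightarrow> sol_t t x) (at t)"
        using DERIV_isCont[OF sol_t_deriv_t[of x t]] by (simp add: isCont_def)
      then have "((\<lambda>\<tau>. sol_t \<tau> x - sol_t t x) \<longlongrightarrow> sol_t t x - sol_t t x) (at t)"
        by (intro tendsto_intros)
      from tendsto_within_subset[OF this subset_UNIV, of S] show ?thesis by simp
    qed
  qed (use b_pos in auto)
  have weak: "L2w_norm 0 (weak_deriv (\<lambda>x. sol \<tau> x - sol t x)) = L2w_norm 0 (\<lambda>x. sol_x \<tau> x - sol_x t x)" for \<tau>
    by (rule L2w_norm_cong_AE[OF weak_deriv_measurable[OF sol_diff_weak_deriv] _ weak_deriv_AE[OF sol_diff_weak_deriv]])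
       (intro borel_measurable_continuous_onI continuous_intros continuous_on_sol_x)
  have "((\<lambda>\<tau>. sqrt ((L2w_norm 0 (\<lambda>x. sin ((sol \<tau> x - sol t x) / 2)))\<^sup>2
      + (L2w_norm 0 (\<lambda>x. sol_x \<tau> x - sol_x t x))\<^sup>2 + (L2w_norm 0 (\<lambda>x. sol_t \<tau> x - sol_t t x))\<^sup>2))
      \<longlongrightarrow> sqrt (0\<^sup>2 + 0\<^sup>2 + 0\<^sup>2)) (at t within S)"
    by (intro tendsto_intros 1 2 3)
  then show ?thesis
    by (simp add: sin_dist_def weak)
qed

lemma sol_weak_equation:
  assumes \<phi>: "test_function \<phi>"
  shows "((\<lambda>\<tau>. LINT x|lborel. sol \<tau> x * \<phi> x) has_real_derivative (LINT x|lborel. sol_t t x * \<phi> x)) (at t)"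
    and "((\<lambda>\<tau>. LINT x|lborel. sol_t \<tau> x * \<phi> x) has_real_derivative
      (LINT x|lborel. sol t x * deriv (deriv \<phi>) x - sin (sol t x) * \<phi> x)) (at t)"
proof -
  show "((\<lambda>\<tau>. LINT x|lborel. sol \<tau> x * \<phi> x) has_real_derivative (LINT x|lborel. sol_t t x * \<phi> x)) (at t)"
    by (rule has_deriv_integral_mult_test[OF sol_deriv_t continuous_on_sol continuous_on_sol_t \<phi>])
  have "(LINT x|lborel. sol_tt t x * \<phi> x) = (LINT x|lborel. sol_xx t x * \<phi> x - sin (sol t x) * \<phi> x)"
    by (simp add: sol_equation left_diff_distrib)
  also have "\<dots> = (LINT x|lborel. sol_xx t x * \<phi> x) - (LINT x|lborel. sin (sol t x) * \<phi> x)"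
    by (intro Bochner_Integration.integral_diff integrable_mult_test locally_integrable_continuous
        continuous_on_sol_xx continuous_intros continuous_on_sol \<phi>)
  also have "(LINT x|lborel. sol_xx t x * \<phi> x) = (LINT x|lborel. sol t x * deriv (deriv \<phi>) x)"
    using integral_mult_deriv_test[OF sol_deriv_x continuous_on_sol_x test_function_deriv[OF \<phi>], of t]
      integral_mult_deriv_test[OF sol_x_deriv_x continuous_on_sol_xx \<phi>, of t] by simp
  also have "(LINT x|lborel. sol t x * deriv (deriv \<phi>) x) - (LINT x|lborel. sin (sol t x) * \<phi> x) =
      (LINT x|lborel. sol t x * deriv (deriv \<phi>) x - sin (sol t x) * \<phi> x)"
    by (intro Bochner_Integration.integral_diff[symmetric] integrable_mult_test locally_integrable_continuous
        continuous_intros continuous_on_sol \<phi> test_function_deriv)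
  finally have eq: "(LINT x|lborel. sol_tt t x * \<phi> x) =
      (LINT x|lborel. sol t x * deriv (deriv \<phi>) x - sin (sol t x) * \<phi> x)" .
  show "((\<lambda>\<tau>. LINT x|lborel. sol_t \<tau> x * \<phi> x) has_real_derivative
      (LINT x|lborel. sol t x * deriv (deriv \<phi>) x - sin (sol t x) * \<phi> x)) (at t)"
    using has_deriv_integral_mult_test[OF sol_t_deriv_t continuous_on_slice[OF continuous_on_sol_t] continuous_on_sol_tt \<phi>, of t]
    unfolding eq .
qed

section \<open>Sign of the velocity and failure of the decomposition\<close>

lemma sol_t_0: "sol_t 0 x = 0"
  by (simp add: sol_t_def ph'_def)

lemma sol_is_solution: "sine_gordon_solution (sol 0) (\<lambda>_. 0) sol sol_t"
  unfolding sine_gordon_solution_def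
  using sol_weak_equation sol_curve_continuous sol_in_H1sin[of 0] sol_t_in_L2w[of 0]
  by (auto simp: sol_t_0 intro: has_field_derivative_at_within)

text \<open>Up to the factor - b the profile is a function that vanishes at 0 and has derivative (1
  - b^2) * cosh x * cosh (b * x) > 0.\<close>

lemma vel_sign: "0 < x \<Longrightarrow> vel x < 0" "x < 0 \<Longrightarrow> 0 < vel x"
proof -
  define w where "w x = sinh x * cosh (b * x) - b * cosh x * sinh (b * x)" for x
  have w': "(w has_real_derivative (1 - b\<^sup>2) * (cosh x * cosh (b * x))) (at x)" for x
    unfolding w_def by (auto intro!: derivative_eq_intros simp: algebra_simps power2_eq_square)
  have mono: "w x < w y" if "x < y" for x y
  proof (rule DERIV_pos_imp_increasing[OF that])
    fix z
    have "0 < (1 - b\<^sup>2) * (cosh z * cosh (b * z))" using b_sq by simp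
    then show "\<exists>y. (w has_real_derivative y) (at z) \<and> 0 < y" using w'[of z] by blast
  qed
  have "w 0 = 0" by (simp add: w_def)
  moreover have "vel x = - b * w x" for x by (simp add: vel_def w_def algebra_simps)
  ultimately show "0 < x \<Longrightarrow> vel x < 0" "x < 0 \<Longrightarrow> 0 < vel x"
    using mono[of 0 x] mono[of x 0] b_pos by (auto simp: mult_less_0_iff)
qed

text \<open>The times at which the phase angle is pi / 2 modulo 2 * pi: there the cosine vanishes
  and the phase velocity is - freq. One such time per period, all with the same velocity
  profile.\<close>

definition still :: "nat \<Rightarrow> real" where
  "still n = (pi / 2 + 2 * pi * real n) / freq"

lemma still_pos: "0 < still n"
  using freq_pos by (simp add: still_def add_pos_nonneg)

lemma still_at_top: "filterlim still at_top sequentially"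
proof -
  have "filterlim (\<lambda>n. (pi / 2) / freq + (2 * pi / freq) * real n) at_top sequentially"
    using freq_pos
    by (intro filterlim_tendsto_add_at_top[OF tendsto_const]
        filterlim_tendsto_pos_mult_at_top[OF tendsto_const _ filterlim_real_sequentially]) auto
  then show ?thesis by (simp add: still_def[abs_def] add_divide_distrib)
qed

lemma sol_t_still: "sol_t (still n) = sol_t (still 0)"
proof -
  have "freq * still n = pi / 2 + 2 * pi * real n" for n
    using freq_pos by (simp add: still_def)
  moreover have "cos (pi / 2 + 2 * pi * real n) = 0" "sin (pi / 2 + 2 * pi * real n) = 1" for n
  proof -
    have "2 * pi * real n = 2 * real n * pi" by simp
    then show "cos (pi / 2 + 2 * pi * real n) = 0" "sin (pi / 2 + 2 * pi * real n) = 1"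
      by (simp_all only: sin_add cos_add cos_2npi sin_2npi) simp_all
  qed
  ultimately have "ph (still n) = 0" "ph' (still n) = - freq" for n
    by (simp_all add: ph_def ph'_def)
  then show ?thesis by (simp add: sol_t_def fun_eq_iff)
qed

lemma sol_t_still_sign: "0 < x \<Longrightarrow> 0 < sol_t (still n) x" "x < 0 \<Longrightarrow> sol_t (still n) x < 0"
proof -
  have "ph' (still 0) = - freq"
    using freq_pos by (simp add: still_def ph'_def)
  moreover define A where "A = 4 * freq / quo (ph (still 0)) x"
  ultimately have "sol_t (still n) x = - (A * vel x)"
    unfolding sol_t_still[of n] by (simp add: sol_t_def)
  moreover have "0 < A"
    using freq_pos quo_pos[OF abs_ph, of "still 0" x] by (simp add: A_def)
  ultimately show "0 < x \<Longrightarrow> 0 < sol_t (still n) x" "x < 0 \<Longrightarrow> sol_t (still n) x < 0"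
    using vel_sign[of x] mult_pos_neg[of A "vel x"] mult_pos_pos[of A "vel x"] by auto
qed

text \<open>At the times \<open>still n\<close> the velocity of the breather part is odd in space, whereas the velocity
  of any kink has constant sign; so on one of the two half lines they cannot be close.\<close>

lemma sol_not_decomposes:
  assumes f: "sine_gordon_solution (sol 0) (\<lambda>_. 0) f ft"
  shows "\<not> decomposes_into_kink f ft"
proof
  assume "decomposes_into_kink f ft"
  then obtain v xk and k :: int where v: "-1 < v" "v < 1" and xk: "\<And>t. 0 < t \<Longrightarrow> xk differentiable (at t)"
    and lim: "\<And>V L. 0 < L \<Longrightarrow> ((\<lambda>t. LINT x:{x. \<bar>x - V * t\<bar> < L}|lborel.
                (f t x - (kink v (xk t) t x + 2 * pi * of_int k))\<^sup>2
              + (weak_deriv (\<lambda>y. f t y - (kink v (xk t) t y + 2 * pi * of_int k)) x)\<^sup>2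
              + (ft t x - deriv (\<lambda>\<tau>. kink v (xk \<tau>) \<tau> x) t)\<^sup>2) \<longlongrightarrow> 0) at_top"
    unfolding decomposes_into_kink_def by blast
  define J where "J t = (LINT x:{x. \<bar>x - 0 * t\<bar> < 1}|lborel.
                (f t x - (kink v (xk t) t x + 2 * pi * of_int k))\<^sup>2
              + (weak_deriv (\<lambda>y. f t y - (kink v (xk t) t y + 2 * pi * of_int k)) x)\<^sup>2
              + (ft t x - deriv (\<lambda>\<tau>. kink v (xk \<tau>) \<tau> x) t)\<^sup>2)" for t
  define P where "P = sol_t (still 0)"
  have Pc: "continuous_on UNIV P"
    unfolding P_def by (rule continuous_on_slice[OF continuous_on_sol_t])
  \<comment> \<open>The minimum over both sides, because the side on which the velocities have
    opposite signs is dictated by the trajectory and may differ from one \<open>n\<close> to the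
    next.\<close>
  define \<delta> where "\<delta> = min (LINT x:{-1<..<0}|lborel. (P x)\<^sup>2) (LINT x:{0<..<1}|lborel. (P x)\<^sup>2)"
  have "0 < \<delta>"
    unfolding \<delta>_def min_less_iff_conj
  proof
    show "0 < (LINT x:{-1<..<0}|lborel. (P x)\<^sup>2)"
      using sol_t_still_sign(2)[of _ 0] by (intro set_integral_square_pos Pc) (auto simp: P_def less_imp_neq)
    show "0 < (LINT x:{0<..<1}|lborel. (P x)\<^sup>2)"
      using sol_t_still_sign(1)[of _ 0] by (intro set_integral_square_pos Pc) (auto simp: P_def less_imp_neq[symmetric])
  qed
  have r: "0 < sqrt (1 - v\<^sup>2)"
    using v by (simp add: abs_square_less_1 abs_less_iff)
  have "\<delta> \<le> J (still n)" for n
  proof -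
    define t where "t = still n"
    have t: "0 < t" "0 \<le> t" using still_pos[of n] by (auto simp: t_def)
    obtain D where D: "(xk has_real_derivative D) (at t)"
      using xk[OF t(1)] by (auto simp: real_differentiable_def)
    define q where "q x = 4 * exp ((x - v * t + xk t) / sqrt (1 - v\<^sup>2)) / (1 + (exp ((x - v * t + xk t) / sqrt (1 - v\<^sup>2)))\<^sup>2)" for x
    have q: "0 \<le> q x" for x by (simp add: q_def)
    have qc: "continuous_on S q" for S
    proof -
      have "1 + (exp y)\<^sup>2 \<noteq> 0" for y :: real by (simp add: add_pos_nonneg less_imp_neq[symmetric])
      then show ?thesis unfolding q_def using r by (intro continuous_intros) auto
    qed
    define kd where "kd x = q x * ((D - v) / sqrt (1 - v\<^sup>2))" for x
    have kd: "deriv (\<lambda>\<tau>. kink v (xk \<tau>) \<tau> x) t = kd x" for x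
      unfolding kd_def q_def by (rule DERIV_imp_deriv[OF kink_has_deriv_t[OF D]])
    have kdc: "continuous_on S kd" for S
      unfolding kd_def using r by (intro continuous_intros qc) auto
    define \<kappa> where "\<kappa> x = kink v (xk t) t x + 2 * pi * of_int k" for x
    have \<kappa>': "(\<kappa> has_real_derivative q x / sqrt (1 - v\<^sup>2)) (at x)" for x
      unfolding \<kappa>_def q_def using DERIV_add[OF kink_has_deriv_x DERIV_const] by simp
    have \<kappa>c: "continuous_on S \<kappa>" for S
      by (rule DERIV_continuous_on[OF has_field_derivative_at_within[OF \<kappa>']])
    have weak: "has_weak_deriv (\<lambda>x. sol t x - \<kappa> x) (\<lambda>x. sol_x t x - q x / sqrt (1 - v\<^sup>2))"
      using r by (intro has_weak_deriv_diff sol_weak_deriv has_weak_deriv_if_C1[OF \<kappa>'] continuous_intros qc) auto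
    note feq = sg_unique[OF f sol_is_solution t(2)]
    note reg = sg_regular[OF f t(2)]
    have fm: "f t \<in> borel_measurable borel" "ft t \<in> borel_measurable borel"
      using reg by (auto intro!: locally_integrable_measurable)
    have km: "\<kappa> \<in> borel_measurable borel" "kd \<in> borel_measurable borel"
      by (auto intro!: borel_measurable_continuous_onI \<kappa>c kdc)
    \<comment> \<open>The integrand contains the weak derivative of a difference with the given
      solution; agreement almost everywhere with the explicit solution makes the known derivative
      available for it.\<close>
    have weak_f: "has_weak_deriv (\<lambda>x. f t x - \<kappa> x) (\<lambda>x. sol_x t x - q x / sqrt (1 - v\<^sup>2))"
      by (rule has_weak_deriv_cong_AE[OF weak])
         (use feq(1) fm km in \<open>auto elim: eventually_mono\<close>)
    define G where "G x = (sol t x - \<kappa> x)\<^sup>2 + (sol_x t x - q x / sqrt (1 - v\<^sup>2))\<^sup>2 + (P x - kd x)\<^sup>2" for x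
    have Gc: "continuous_on UNIV G"
      unfolding G_def using r
      by (intro continuous_intros continuous_on_sol continuous_on_sol_x \<kappa>c qc kdc Pc) auto
    have "J t = (LINT x:{-1<..<1}|lborel. G x)"
    proof -
      have "{x. \<bar>x - 0 * t\<bar> < 1} = {-1<..<1}" by auto
      then have "J t = (LINT x|lborel. indicator {-1<..<1} x *\<^sub>R ((f t x - \<kappa> x)\<^sup>2
          + (weak_deriv (\<lambda>y. f t y - \<kappa> y) x)\<^sup>2 + (ft t x - kd x)\<^sup>2))"
        by (simp only: J_def kd \<kappa>_def set_lebesgue_integral_def)
      also have "\<dots> = (LINT x|lborel. indicator {-1<..<1} x *\<^sub>R G x)"
      proof (rule integral_cong_AE)
        show "(\<lambda>x. indicator {-1<..<1} x *\<^sub>R ((f t x - \<kappa> x)\<^sup>2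
          + (weak_deriv (\<lambda>y. f t y - \<kappa> y) x)\<^sup>2 + (ft t x - kd x)\<^sup>2)) \<in> borel_measurable lborel"
          using fm km weak_deriv_measurable[OF weak_f] by simp
        show "(\<lambda>x. indicator {-1<..<1} x *\<^sub>R G x) \<in> borel_measurable lborel"
          using borel_measurable_continuous_onI[OF Gc] by simp
        show "AE x in lborel. indicator {-1<..<1} x *\<^sub>R ((f t x - \<kappa> x)\<^sup>2
          + (weak_deriv (\<lambda>y. f t y - \<kappa> y) x)\<^sup>2 + (ft t x - kd x)\<^sup>2) = indicator {-1<..<1} x *\<^sub>R G x"
          using feq weak_deriv_AE[OF weak_f]
          by eventually_elim (simp add: G_def P_def t_def sol_t_still[of n])
      qed
      finally show ?thesis by (simp add: set_lebesgue_integral_def)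
    qed
    moreover have lower: "(LINT x:{a<..<c}|lborel. (P x)\<^sup>2) \<le> (LINT x:{-1<..<1}|lborel. G x)"
      if ac: "-1 \<le> a" "c \<le> 1" and le: "\<And>x. a < x \<Longrightarrow> x < c \<Longrightarrow> (P x)\<^sup>2 \<le> (P x - kd x)\<^sup>2" for a c
      unfolding set_lebesgue_integral_def
    proof (rule integral_mono)
      show "integrable lborel (\<lambda>x. indicator {a<..<c} x *\<^sub>R (P x)\<^sup>2)"
        using set_integrable_continuous[of "\<lambda>x. (P x)\<^sup>2" a c] Pc
        by (simp add: set_integrable_def continuous_on_power)
      show "integrable lborel (\<lambda>x. indicator {-1<..<1} x *\<^sub>R G x)"
        using set_integrable_continuous[OF Gc] by (simp add: set_integrable_def)
      have "(P x - kd x)\<^sup>2 \<le> G x" "0 \<le> G x" for x by (simp_all add: G_def)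
      then show "indicator {a<..<c} x *\<^sub>R (P x)\<^sup>2 \<le> indicator {-1<..<1} x *\<^sub>R G x" for x
        using ac le[of x] order_trans by (fastforce simp: indicator_def)
    qed
    \<comment> \<open>Subtracting a number of the opposite sign can only enlarge a square, so a
      large kink velocity is as useless as a small one.\<close>
    moreover have sq: "p\<^sup>2 \<le> (p - z)\<^sup>2" if "p * z \<le> 0" for p z :: real
    proof -
      have "(p - z)\<^sup>2 = p\<^sup>2 - 2 * (p * z) + z\<^sup>2" by (simp add: power2_diff)
      then show ?thesis using that zero_le_power2[of z] by linarith
    qed
    have "(LINT x:{-1<..<0}|lborel. (P x)\<^sup>2) \<le> (LINT x:{-1<..<1}|lborel. G x) \<or>
        (LINT x:{0<..<1}|lborel. (P x)\<^sup>2) \<le> (LINT x:{-1<..<1}|lborel. G x)"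
    \<comment> \<open>For v <= D the kink velocity is nonnegative everywhere, against a negative
      profile on the left; otherwise it is nonpositive, against a positive profile on the
      right.\<close>
    proof (cases "v \<le> D")
      case True
      have "P x * kd x \<le> 0" if "x < 0" for x
        using sol_t_still_sign(2)[OF that, of 0] q[of x] True r
        by (intro mult_nonpos_nonneg) (auto simp: P_def kd_def)
      then show ?thesis by (intro disjI1 lower sq) auto
    next
      case False
      have "P x * kd x \<le> 0" if "0 < x" for x
        using sol_t_still_sign(1)[OF that, of 0] q[of x] False r
        by (intro mult_nonneg_nonpos) (auto simp: P_def kd_def intro!: mult_nonneg_nonpos divide_nonpos_pos)
      then show ?thesis by (intro disjI2 lower sq) auto
    qed
    ultimately show "\<delta> \<le> J (still n)"
      by (auto simp: \<delta>_def t_def)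
  qed
  moreover have "(\<lambda>n. J (still n)) \<longlonglongrightarrow> 0"
    using filterlim_compose[OF lim[of 1 0] still_at_top] by (simp only: J_def zero_less_one)
  ultimately have "\<delta> \<le> 0"
    by (intro tendsto_lowerbound) auto
  with \<open>0 < \<delta>\<close> show False by simp
qed

end

theorem proposition1p11:
  fixes s :: real
  assumes "0 \<le> s" and "s < 1/2"
  shows "\<forall>\<epsilon>>0. \<exists>g1 g2.
           g1 \<in> H1sin s \<and> g2 \<in> L2w s \<and>
           sin_dist s (g1, g2) (kink 0 0 0, \<lambda>_. 0) < \<epsilon> \<and>
           (\<exists>f ft. sine_gordon_solution g1 g2 f ft) \<and>
           (\<forall>f ft. sine_gordon_solution g1 g2 f ft \<longrightarrow> \<not> decomposes_into_kink f ft)"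
proof (intro allI impI)
  fix \<epsilon> :: real
  assume "0 < \<epsilon>"
  define p where "p = 1 / 2 - s"
  have p: "0 < p" using assms by (simp add: p_def)
  \<comment> \<open>448 is twice the constant 224 of the distance bound, so that the distance is at
    most \<epsilon> / 2 and the inequality strict.\<close>
  define b where "b = min (1 / 4) ((\<epsilon> / 448) powr (1 / p))"
  interpret wobbling b
    using \<open>0 < \<epsilon>\<close> by unfold_locales (auto simp: b_def)
  have "b powr p \<le> ((\<epsilon> / 448) powr (1 / p)) powr p"
    using p b_pos by (intro powr_mono2) (auto simp: b_def)
  also have "\<dots> = \<epsilon> / 448"
    using p \<open>0 < \<epsilon>\<close> by (simp add: powr_powr)
  finally have "224 * b powr p < \<epsilon>" using \<open>0 < \<epsilon>\<close> by simp
  moreover have "sin_dist s (sol 0, \<lambda>_. 0) (kink 0 0 0, \<lambda>_. 0) \<le> 224 * b powr p"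
    unfolding p_def using assms by (intro sol_0_close) auto
  moreover have "(\<lambda>_. 0) \<in> L2w s"
    by (simp add: L2w_def)
  ultimately show "\<exists>g1 g2.
           g1 \<in> H1sin s \<and> g2 \<in> L2w s \<and>
           sin_dist s (g1, g2) (kink 0 0 0, \<lambda>_. 0) < \<epsilon> \<and>
           (\<exists>f ft. sine_gordon_solution g1 g2 f ft) \<and>
           (\<forall>f ft. sine_gordon_solution g1 g2 f ft \<longrightarrow> \<not> decomposes_into_kink f ft)"
    using sol_in_H1sin[of s 0] sol_is_solution sol_not_decomposes assms
    by (intro exI[of _ "sol 0"] exI[of _ "\<lambda>_. 0"]) auto
qed

end
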